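(* Let $G=A\rtimes_F K$, let $\omega\in Z^3(G,\mathbb{C}^* )$, and let $\mathcal{M}=\mathcal{M}(A\backslash G,\mu)$ be a right module category over $\mathcal{V}(G,\omega)$, where $\mu\in C^2(G,\mathrm{Map}(K,\mathbb{C}^* ))$ satisfies $\delta_G\mu^{-1}=\pi^*\omega$. If the tensor category $\mathcal{V}(G,\omega)^*_{\mathcal{M}}=\mathrm{Fun}_{\mathcal{V}(G,\omega)}(\mathcal{M},\mathcal{M})$ is pointed, then $\omega$ is cohomologous to a cocycle that lives in $C^{2,1}\oplus C^{3,0}$ of the double complex $C^{*,*}$; that is, $\pi^*\omega\in C^{0,3}$ is cohomologous in $\mathrm{Tot}(C^{*,*})$ to a $3$-cocycle of $\mathrm{Tot}(C^{*,*})$ lying in $C^{2,1}\oplus C^{3,0}$.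
   Context: All group cochains are normalized and cochain groups are written multiplicatively. Group. $K$ is a finite group acting on the left on a finite abelian group $A$ (multiplicative) by $a\mapsto{}^k a$; $F:K\times K\to A$ is a normalized $2$-cocycle, ${}^{k_1}F(k_2,k_3)F(k_1k_2,k_3)^{-1}F(k_1,k_2k_3)F(k_1,k_2)^{-1}=1$; $A\rtimes_F K$ is $A\times K$ with product $(a_1,k_1)(a_2,k_2)=(a_1({}^{k_1}a_2)F(k_1,k_2),k_1k_2)$, and $A$ is identified with $\{(a,1)\}$. Then $A\backslash G\cong K$, with right $G$-action $x\triangleleft(a,k)=xk$. Double complex. $C^q(G,\mathrm{Map}(K,\mathbb{C}^* ))$ is the group of maps $f:K\times G^q\to\mathbb{C}^*$ with $f(k;g_1,\dots,g_q)=1$ if some $g_i=1$, with $$(\delta_Gf)(k;g_1,\dots,g_q)=f(k\triangleleft g_1;g_2,\dots,g_q)\prod_{i=1}^{q-1}f(k;g_1,\dots,g_ig_{i+1},\dots,g_q)^{(-1)^i}\,f(k;g_1,\dots,g_{q-1})^{(-1)^q},$$ and right $K$-action $(f\triangleleft k)(x;g_1,\dots,g_q)=f(kx;g_1,\dots,g_q)$. $C^{p,q}:=C^p(K,C^q(G,\mathrm{Map}(K,\mathbb{C}^* )))$ consists of normalized maps $K^p\to C^q(G,\mathrm{Map}(K,\mathbb{C}^* ))$, with $$(\delta_Kf)(k_1,\dots,k_p)=f(k_2,\dots,k_p)\prod_{i=1}^{p-1}f(k_1,\dots,k_ik_{i+1},\dots,k_p)^{(-1)^i}\,(f(k_1,\dots,k_{p-1})\triangleleft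 k_p)^{(-1)^p}.$$ $\mathrm{Tot}(C^{*,*})$ has differential $\delta_{Tot}=\delta_K\oplus(\delta_G)^{(-1)^p}$. For $\omega\in Z^3(G,\mathbb{C}^* )$, $\pi^*\omega\in C^{0,3}$ is $\pi^*\omega(k;g_1,g_2,g_3)=\omega(g_1,g_2,g_3)$. Filtering by $p$ gives the Lyndon-Hochschild-Serre spectral sequence of $1\to A\to G\to K\to1$. Categories. $\mathcal{V}(G,\omega)$ is the skeletal fusion category over $\mathbb{C}$ with simple objects the elements of $G$, $g\otimes h=gh$, associativity $\omega(g,h,k)\,\mathrm{id}_{ghk}:(g\otimes h)\otimes k\to g\otimes(h\otimes k)$ and identity unit constraints. $\mathcal{M}(A\backslash G,\mu)$ is the skeletal semisimple right $\mathcal{V}(G,\omega)$-module category with simple objects the elements of $K=A\backslash G$, action $k\otimes g=k\triangleleft g$, associativity $k\otimes(g_1\otimes g_2)\to(k\otimes g_1)\otimes g_2$ given by the scalar $\mu(k;g_1,g_2)$, and identity unit constraint; the pentagon axiom is $\delta_G\mu^{-1}=\pi^*\omega$. $\mathrm{Fun}_{\mathcal{C}}(\mathcal{M},\mathcal{M})$ is the category of $\mathcal{C}$-module endofunctors of $\mathcal{M}$, a tensor category under composition. A fusion category is pointed if all its simple objects are invertible. *)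

theory Defs
  imports "HOL-Algebra.Bij" "Jordan_Normal_Form.Matrix"
begin

section \<open>The group extension\<close>

text \<open>\<open>\<phi> k a\<close> is the element written ${}^k a$.\<close>

definition normalized_2_cocycle ::
  "('k, 'y) monoid_scheme \<Rightarrow> ('a, 'x) monoid_scheme \<Rightarrow> ('k \<Rightarrow> 'a \<Rightarrow> 'a) \<Rightarrow> ('k \<Rightarrow> 'k \<Rightarrow> 'a) \<Rightarrow> bool"
  where
  "normalized_2_cocycle K A \<phi> F \<longleftrightarrow>
     (\<forall>k\<in>carrier K. \<forall>l\<in>carrier K. F k l \<in> carrier A) \<and>
     (\<forall>k\<in>carrier K. F k \<one>\<^bsub>K\<^esub> = \<one>\<^bsub>A\<^esub> \<and> F \<one>\<^bsub>K\<^esub> k = \<one>\<^bsub>A\<^esub>) \<and>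
     (\<forall>k1\<in>carrier K. \<forall>k2\<in>carrier K. \<forall>k3\<in>carrier K.
        \<phi> k1 (F k2 k3) \<otimes>\<^bsub>A\<^esub> inv\<^bsub>A\<^esub> F (k1 \<otimes>\<^bsub>K\<^esub> k2) k3
          \<otimes>\<^bsub>A\<^esub> F k1 (k2 \<otimes>\<^bsub>K\<^esub> k3) \<otimes>\<^bsub>A\<^esub> inv\<^bsub>A\<^esub> F k1 k2 = \<one>\<^bsub>A\<^esub>)"

definition twisted_product ::
  "('a, 'x) monoid_scheme \<Rightarrow> ('k, 'y) monoid_scheme \<Rightarrow> ('k \<Rightarrow> 'a \<Rightarrow> 'a) \<Rightarrow> ('k \<Rightarrow> 'k \<Rightarrow> 'a)
     \<Rightarrow> ('a \<times> 'k) monoid"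
  where
  "twisted_product A K \<phi> F =
     \<lparr>carrier = carrier A \<times> carrier K,
      monoid.mult = (\<lambda>(a1, k1) (a2, k2). (a1 \<otimes>\<^bsub>A\<^esub> \<phi> k1 a2 \<otimes>\<^bsub>A\<^esub> F k1 k2, k1 \<otimes>\<^bsub>K\<^esub> k2)),
      monoid.one = (\<one>\<^bsub>A\<^esub>, \<one>\<^bsub>K\<^esub>)\<rparr>"

definition right_act :: "('k, 'y) monoid_scheme \<Rightarrow> 'k \<Rightarrow> 'a \<times> 'k \<Rightarrow> 'k"
  where "right_act K x g = x \<otimes>\<^bsub>K\<^esub> snd g"

section \<open>Cochains\<close>

text \<open>
  An \<open>n\<close>-tuple is a list of length \<open>n\<close>. Cochains are total functions on lists that take the
  value \<open>1\<close> outside their domain, so that equality of cochains is equality of functions, and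
  pointwise products and the differentials below need no degree argument.
\<close>

text \<open>\<open>merge G i [g\<^sub>1, \<dots>, g\<^sub>n] = [g\<^sub>1, \<dots>, g\<^sub>i g\<^sub>i\<^sub>+\<^sub>1, \<dots>, g\<^sub>n]\<close> for \<open>1 \<le> i < n\<close>.\<close>

definition merge :: "('g, 'x) monoid_scheme \<Rightarrow> nat \<Rightarrow> 'g list \<Rightarrow> 'g list"
  where "merge G i gs = take (i - 1) gs @ [gs ! (i - 1) \<otimes>\<^bsub>G\<^esub> gs ! i] @ drop (i + 1) gs"

definition tuples :: "('g, 'x) monoid_scheme \<Rightarrow> nat \<Rightarrow> 'g list set"
  where "tuples G n = {gs \<in> lists (carrier G). length gs = n}"

definition cochains :: "('g, 'x) monoid_scheme \<Rightarrow> nat \<Rightarrow> ('g list \<Rightarrow> complex) set"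
  where
  "cochains G n = {f.
     (\<forall>gs\<in>tuples G n. f gs \<noteq> 0) \<and>
     (\<forall>gs\<in>tuples G n. \<one>\<^bsub>G\<^esub> \<in> set gs \<longrightarrow> f gs = 1) \<and>
     (\<forall>gs. gs \<notin> tuples G n \<longrightarrow> f gs = 1)}"

definition coboundary :: "('g, 'x) monoid_scheme \<Rightarrow> ('g list \<Rightarrow> complex) \<Rightarrow> 'g list \<Rightarrow> complex"
  where
  "coboundary G f gs =
     (if gs \<in> lists (carrier G) \<and> gs \<noteq> []
      then f (tl gs) * (\<Prod>i = 1..<length gs. f (merge G i gs) powi ((-1) ^ i))
             * f (butlast gs) powi ((-1) ^ length gs)
      else 1)"

definition cocycles :: "('g, 'x) monoid_scheme \<Rightarrow> nat \<Rightarrow> ('g list \<Rightarrow> complex) set"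
  where "cocycles G n = {f \<in> cochains G n. coboundary G f = (\<lambda>_. 1)}"

definition map_cochains ::
  "('k, 'y) monoid_scheme \<Rightarrow> ('a \<times> 'k, 'x) monoid_scheme \<Rightarrow> nat
     \<Rightarrow> ('k \<Rightarrow> ('a \<times> 'k) list \<Rightarrow> complex) set"
  where
  "map_cochains K G q = {f.
     (\<forall>x\<in>carrier K. \<forall>gs\<in>tuples G q. f x gs \<noteq> 0) \<and>
     (\<forall>x\<in>carrier K. \<forall>gs\<in>tuples G q. \<one>\<^bsub>G\<^esub> \<in> set gs \<longrightarrow> f x gs = 1) \<and>
     (\<forall>x gs. \<not> (x \<in> carrier K \<and> gs \<in> tuples G q) \<longrightarrow> f x gs = 1)}"

definition delta_G ::
  "('k, 'y) monoid_scheme \<Rightarrow> ('a \<times> 'k, 'x) monoid_scheme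
     \<Rightarrow> ('k \<Rightarrow> ('a \<times> 'k) list \<Rightarrow> complex) \<Rightarrow> 'k \<Rightarrow> ('a \<times> 'k) list \<Rightarrow> complex"
  where
  "delta_G K G f x gs =
     (if x \<in> carrier K \<and> gs \<in> lists (carrier G) \<and> gs \<noteq> []
      then f (right_act K x (hd gs)) (tl gs)
             * (\<Prod>i = 1..<length gs. f x (merge G i gs) powi ((-1) ^ i))
             * f x (butlast gs) powi ((-1) ^ length gs)
      else 1)"

definition translate ::
  "('k, 'y) monoid_scheme \<Rightarrow> ('k \<Rightarrow> ('a \<times> 'k) list \<Rightarrow> complex) \<Rightarrow> 'k
     \<Rightarrow> 'k \<Rightarrow> ('a \<times> 'k) list \<Rightarrow> complex"
  where
  "translate K f k = (\<lambda>x gs. f (k \<otimes>\<^bsub>K\<^esub> x) gs)"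

definition pullback ::
  "('k, 'y) monoid_scheme \<Rightarrow> (('a \<times> 'k) list \<Rightarrow> complex) \<Rightarrow> 'k \<Rightarrow> ('a \<times> 'k) list \<Rightarrow> complex"
  where "pullback K w x gs = (if x \<in> carrier K then w gs else 1)"

section \<open>The double complex and its total complex\<close>

type_synonym ('a, 'k) bicochain = "'k list \<Rightarrow> 'k \<Rightarrow> ('a \<times> 'k) list \<Rightarrow> complex"

definition bicochains ::
  "('k, 'y) monoid_scheme \<Rightarrow> ('a \<times> 'k, 'x) monoid_scheme \<Rightarrow> nat \<Rightarrow> nat \<Rightarrow> ('a, 'k) bicochain set"
  where
  "bicochains K G p q = {f.
     (\<forall>ks\<in>tuples K p. f ks \<in> map_cochains K G q) \<and>
     (\<forall>ks\<in>tuples K p. \<one>\<^bsub>K\<^esub> \<in> set ks \<longrightarrow> f ks = (\<lambda>_ _. 1)) \<and>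
     (\<forall>ks. ks \<notin> tuples K p \<longrightarrow> f ks = (\<lambda>_ _. 1))}"

definition delta_K ::
  "('k, 'y) monoid_scheme \<Rightarrow> ('a, 'k) bicochain \<Rightarrow> ('a, 'k) bicochain"
  where
  "delta_K K f ks x gs =
     (if ks \<in> lists (carrier K) \<and> ks \<noteq> [] \<and> x \<in> carrier K
      then f (tl ks) x gs
             * (\<Prod>i = 1..<length ks. f (merge K i ks) x gs powi ((-1) ^ i))
             * translate K (f (butlast ks)) (last ks) x gs powi ((-1) ^ length ks)
      else 1)"

text \<open>
  A total cochain \<open>c\<close> of degree \<open>n\<close> is the family of its components \<open>c p\<close> in bidegree
  \<open>(p, n - p)\<close>.
\<close>

definition total_cochains ::
  "('k, 'y) monoid_scheme \<Rightarrow> ('a \<times> 'k, 'x) monoid_scheme \<Rightarrow> nat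
     \<Rightarrow> (nat \<Rightarrow> ('a, 'k) bicochain) set"
  where
  "total_cochains K G n = {c.
     (\<forall>p\<le>n. c p \<in> bicochains K G p (n - p)) \<and> (\<forall>p>n. c p = (\<lambda>_ _ _. 1))}"

definition delta_Tot ::
  "('k, 'y) monoid_scheme \<Rightarrow> ('a \<times> 'k, 'x) monoid_scheme
     \<Rightarrow> (nat \<Rightarrow> ('a, 'k) bicochain) \<Rightarrow> nat \<Rightarrow> ('a, 'k) bicochain"
  where
  "delta_Tot K G c p ks x gs =
     (if p = 0 then 1 else delta_K K (c (p - 1)) ks x gs)
       * delta_G K G (c p ks) x gs powi ((-1) ^ p)"

definition total_cocycles ::
  "('k, 'y) monoid_scheme \<Rightarrow> ('a \<times> 'k, 'x) monoid_scheme \<Rightarrow> nat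
     \<Rightarrow> (nat \<Rightarrow> ('a, 'k) bicochain) set"
  where
  "total_cocycles K G n = {c \<in> total_cochains K G n. delta_Tot K G c = (\<lambda>_ _ _ _. 1)}"

definition total_cohomologous ::
  "('k, 'y) monoid_scheme \<Rightarrow> ('a \<times> 'k, 'x) monoid_scheme \<Rightarrow> nat
     \<Rightarrow> (nat \<Rightarrow> ('a, 'k) bicochain) \<Rightarrow> (nat \<Rightarrow> ('a, 'k) bicochain) \<Rightarrow> bool"
  where
  "total_cohomologous K G n z z' \<longleftrightarrow>
     z \<in> total_cocycles K G n \<and> z' \<in> total_cocycles K G n \<and>
     (\<exists>c\<in>total_cochains K G (n - 1).
        z' = (\<lambda>p ks x gs. z p ks x gs * delta_Tot K G c p ks x gs))"

text \<open>The inclusion of \<open>C\<^sup>0\<^sup>,\<^sup>q = C\<^sup>q(G, Map(K, \<complex>*))\<close> into the total complex.\<close>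

definition column0 ::
  "('k \<Rightarrow> ('a \<times> 'k) list \<Rightarrow> complex) \<Rightarrow> nat \<Rightarrow> ('a, 'k) bicochain"
  where "column0 f p ks = (if p = 0 \<and> ks = [] then f else (\<lambda>_ _. 1))"

section \<open>Linear categories, monoidal categories and module categories\<close>

text \<open>
  Morphisms do not carry their domain and codomain. Where an operation on morphisms depends on
  them, it takes them as additional arguments. \<open>ccomp C g f\<close> is the composite of \<open>f\<close> followed
  by \<open>g\<close>.
\<close>

record ('o, 'm) lin_cat =
  cobj :: "'o set"
  chom :: "'o \<Rightarrow> 'o \<Rightarrow> 'm set"
  cid :: "'o \<Rightarrow> 'm"
  ccomp :: "'m \<Rightarrow> 'm \<Rightarrow> 'm"
  cadd :: "'m \<Rightarrow> 'm \<Rightarrow> 'm"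
  cscale :: "complex \<Rightarrow> 'm \<Rightarrow> 'm"

text \<open>
  \<open>thom C X X' Y Y' f g : X \<otimes> Y \<rightarrow> X' \<otimes> Y'\<close> for \<open>f : X \<rightarrow> X'\<close> and \<open>g : Y \<rightarrow> Y'\<close>;
  \<open>tassoc C X Y Z : (X \<otimes> Y) \<otimes> Z \<rightarrow> X \<otimes> (Y \<otimes> Z)\<close>.
\<close>

record ('o, 'm) mon_cat = "('o, 'm) lin_cat" +
  tobj :: "'o \<Rightarrow> 'o \<Rightarrow> 'o"
  thom :: "'o \<Rightarrow> 'o \<Rightarrow> 'o \<Rightarrow> 'o \<Rightarrow> 'm \<Rightarrow> 'm \<Rightarrow> 'm"
  tunit :: "'o"
  tassoc :: "'o \<Rightarrow> 'o \<Rightarrow> 'o \<Rightarrow> 'm"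
  tlunit :: "'o \<Rightarrow> 'm"
  trunit :: "'o \<Rightarrow> 'm"

text \<open>
  Right module category with objects \<open>'o\<close> over a monoidal category with objects \<open>'c\<close>:
  \<open>massoc M X V W : X \<otimes> (V \<otimes> W) \<rightarrow> (X \<otimes> V) \<otimes> W\<close> and \<open>munit M X : X \<otimes> 1 \<rightarrow> X\<close>.
\<close>

record ('o, 'm, 'c, 'd) mod_cat = "('o, 'm) lin_cat" +
  aobj :: "'o \<Rightarrow> 'c \<Rightarrow> 'o"
  ahom :: "'o \<Rightarrow> 'o \<Rightarrow> 'c \<Rightarrow> 'c \<Rightarrow> 'm \<Rightarrow> 'd \<Rightarrow> 'm"
  massoc :: "'o \<Rightarrow> 'c \<Rightarrow> 'c \<Rightarrow> 'm"
  munit :: "'o \<Rightarrow> 'm"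

definition is_iso :: "('o, 'm, 'z) lin_cat_scheme \<Rightarrow> 'o \<Rightarrow> 'o \<Rightarrow> 'm \<Rightarrow> bool"
  where
  "is_iso C X Y f \<longleftrightarrow> f \<in> chom C X Y \<and>
     (\<exists>g\<in>chom C Y X. ccomp C g f = cid C X \<and> ccomp C f g = cid C Y)"

definition isomorphic :: "('o, 'm, 'z) lin_cat_scheme \<Rightarrow> 'o \<Rightarrow> 'o \<Rightarrow> bool"
  where "isomorphic C X Y \<longleftrightarrow> (\<exists>f. is_iso C X Y f)"

definition is_mono :: "('o, 'm, 'z) lin_cat_scheme \<Rightarrow> 'o \<Rightarrow> 'o \<Rightarrow> 'm \<Rightarrow> bool"
  where
  "is_mono C X Y f \<longleftrightarrow> f \<in> chom C X Y \<and>
     (\<forall>Z\<in>cobj C. \<forall>g\<in>chom C Z X. \<forall>h\<in>chom C Z X. ccomp C f g = ccomp C f h \<longrightarrow> g = h)"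

definition zero_object :: "('o, 'm, 'z) lin_cat_scheme \<Rightarrow> 'o \<Rightarrow> bool"
  where
  "zero_object C X \<longleftrightarrow> X \<in> cobj C \<and>
     (\<forall>Y\<in>cobj C. (\<exists>!f. f \<in> chom C X Y) \<and> (\<exists>!f. f \<in> chom C Y X))"

text \<open>Nonzero, and every nonzero subobject is the whole object.\<close>

definition simple_object :: "('o, 'm, 'z) lin_cat_scheme \<Rightarrow> 'o \<Rightarrow> bool"
  where
  "simple_object C X \<longleftrightarrow> X \<in> cobj C \<and> \<not> zero_object C X \<and>
     (\<forall>Y\<in>cobj C. \<forall>f. is_mono C Y X f \<longrightarrow> zero_object C Y \<or> is_iso C Y X f)"

definition invertible_object :: "('o, 'm, 'z) mon_cat_scheme \<Rightarrow> 'o \<Rightarrow> bool"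
  where
  "invertible_object C X \<longleftrightarrow> X \<in> cobj C \<and>
     (\<exists>Y\<in>cobj C. isomorphic C (tobj C X Y) (tunit C) \<and> isomorphic C (tobj C Y X) (tunit C))"

definition pointed :: "('o, 'm, 'z) mon_cat_scheme \<Rightarrow> bool"
  where "pointed C \<longleftrightarrow> (\<forall>X. simple_object C X \<longrightarrow> invertible_object C X)"

section \<open>The category of module endofunctors\<close>

text \<open>\<open>fstr T X V : T(X \<otimes> V) \<rightarrow> T(X) \<otimes> V\<close> is the module structure of the functor \<open>T\<close>.\<close>

record ('o, 'm, 'c) mod_fun =
  fobj :: "'o \<Rightarrow> 'o"
  fmor :: "'o \<Rightarrow> 'o \<Rightarrow> 'm \<Rightarrow> 'm"
  fstr :: "'o \<Rightarrow> 'c \<Rightarrow> 'm"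

definition linear_functor ::
  "('o, 'm, 'z) lin_cat_scheme \<Rightarrow> ('o \<Rightarrow> 'o) \<Rightarrow> ('o \<Rightarrow> 'o \<Rightarrow> 'm \<Rightarrow> 'm) \<Rightarrow> bool"
  where
  "linear_functor M T t \<longleftrightarrow>
     (\<forall>X\<in>cobj M. T X \<in> cobj M) \<and>
     (\<forall>X\<in>cobj M. \<forall>Y\<in>cobj M. \<forall>f\<in>chom M X Y. t X Y f \<in> chom M (T X) (T Y)) \<and>
     (\<forall>X\<in>cobj M. t X X (cid M X) = cid M (T X)) \<and>
     (\<forall>X\<in>cobj M. \<forall>Y\<in>cobj M. \<forall>Z\<in>cobj M. \<forall>f\<in>chom M X Y. \<forall>g\<in>chom M Y Z.
        t X Z (ccomp M g f) = ccomp M (t Y Z g) (t X Y f)) \<and>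
     (\<forall>X\<in>cobj M. \<forall>Y\<in>cobj M. \<forall>f\<in>chom M X Y. \<forall>g\<in>chom M X Y.
        t X Y (cadd M f g) = cadd M (t X Y f) (t X Y g)) \<and>
     (\<forall>X\<in>cobj M. \<forall>Y\<in>cobj M. \<forall>f\<in>chom M X Y. \<forall>c.
        t X Y (cscale M c f) = cscale M c (t X Y f))"

definition module_functor ::
  "('c, 'd, 'y) mon_cat_scheme \<Rightarrow> ('o, 'm, 'c, 'd, 'z) mod_cat_scheme \<Rightarrow> ('o, 'm, 'c) mod_fun \<Rightarrow> bool"
  where
  "module_functor C M T \<longleftrightarrow>
     linear_functor M (fobj T) (fmor T) \<and>
     (\<forall>X\<in>cobj M. \<forall>V\<in>cobj C.
        is_iso M (fobj T (aobj M X V)) (aobj M (fobj T X) V) (fstr T X V)) \<and>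
     (\<forall>X\<in>cobj M. \<forall>X'\<in>cobj M. \<forall>V\<in>cobj C. \<forall>V'\<in>cobj C. \<forall>f\<in>chom M X X'. \<forall>u\<in>chom C V V'.
        ccomp M (fstr T X' V') (fmor T (aobj M X V) (aobj M X' V') (ahom M X X' V V' f u))
          = ccomp M (ahom M (fobj T X) (fobj T X') V V' (fmor T X X' f) u) (fstr T X V)) \<and>
     (\<forall>X\<in>cobj M. \<forall>V\<in>cobj C. \<forall>W\<in>cobj C.
        ccomp M (massoc M (fobj T X) V W) (fstr T X (tobj C V W))
          = ccomp M
              (ahom M (fobj T (aobj M X V)) (aobj M (fobj T X) V) W W (fstr T X V) (cid C W))
              (ccomp M (fstr T (aobj M X V) W)
                 (fmor T (aobj M X (tobj C V W)) (aobj M (aobj M X V) W) (massoc M X V W)))) \<and>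
     (\<forall>X\<in>cobj M.
        ccomp M (munit M (fobj T X)) (fstr T X (tunit C))
          = fmor T (aobj M X (tunit C)) X (munit M X))"

text \<open>
  A natural transformation is its family of components, \<open>undefined\<close> outside the objects of
  \<open>M\<close>.
\<close>

definition module_nat ::
  "('c, 'd, 'y) mon_cat_scheme \<Rightarrow> ('o, 'm, 'c, 'd, 'z) mod_cat_scheme
     \<Rightarrow> ('o, 'm, 'c) mod_fun \<Rightarrow> ('o, 'm, 'c) mod_fun \<Rightarrow> ('o \<Rightarrow> 'm) set"
  where
  "module_nat C M S T = {\<nu> \<in> extensional (cobj M).
     (\<forall>X\<in>cobj M. \<nu> X \<in> chom M (fobj S X) (fobj T X)) \<and>
     (\<forall>X\<in>cobj M. \<forall>Y\<in>cobj M. \<forall>f\<in>chom M X Y.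
        ccomp M (\<nu> Y) (fmor S X Y f) = ccomp M (fmor T X Y f) (\<nu> X)) \<and>
     (\<forall>X\<in>cobj M. \<forall>V\<in>cobj C.
        ccomp M (fstr T X V) (\<nu> (aobj M X V))
          = ccomp M (ahom M (fobj S X) (fobj T X) V V (\<nu> X) (cid C V)) (fstr S X V))}"

definition fun_id :: "('o, 'm, 'c, 'd, 'z) mod_cat_scheme \<Rightarrow> ('o, 'm, 'c) mod_fun"
  where
  "fun_id M = \<lparr>fobj = (\<lambda>X. X), fmor = (\<lambda>X Y f. f), fstr = (\<lambda>X V. cid M (aobj M X V))\<rparr>"

definition fun_comp ::
  "('o, 'm, 'c, 'd, 'z) mod_cat_scheme \<Rightarrow> ('o, 'm, 'c) mod_fun \<Rightarrow> ('o, 'm, 'c) mod_fun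
     \<Rightarrow> ('o, 'm, 'c) mod_fun"
  where
  "fun_comp M T S =
     \<lparr>fobj = (\<lambda>X. fobj T (fobj S X)),
      fmor = (\<lambda>X Y f. fmor T (fobj S X) (fobj S Y) (fmor S X Y f)),
      fstr = (\<lambda>X V. ccomp M (fstr T (fobj S X) V)
                (fmor T (fobj S (aobj M X V)) (aobj M (fobj S X) V) (fstr S X V)))\<rparr>"

definition Fun_cat ::
  "('c, 'd, 'y) mon_cat_scheme \<Rightarrow> ('o, 'm, 'c, 'd, 'z) mod_cat_scheme
     \<Rightarrow> (('o, 'm, 'c) mod_fun, 'o \<Rightarrow> 'm) mon_cat"
  where
  "Fun_cat C M =
     \<lparr>cobj = {T. module_functor C M T},
      chom = module_nat C M,
      cid = (\<lambda>T. \<lambda>X\<in>cobj M. cid M (fobj T X)),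
      ccomp = (\<lambda>\<beta> \<alpha>. \<lambda>X\<in>cobj M. ccomp M (\<beta> X) (\<alpha> X)),
      cadd = (\<lambda>\<alpha> \<beta>. \<lambda>X\<in>cobj M. cadd M (\<alpha> X) (\<beta> X)),
      cscale = (\<lambda>c \<alpha>. \<lambda>X\<in>cobj M. cscale M c (\<alpha> X)),
      tobj = fun_comp M,
      thom = (\<lambda>T T' S S' \<beta> \<alpha>. \<lambda>X\<in>cobj M.
                ccomp M (\<beta> (fobj S' X)) (fmor T (fobj S X) (fobj S' X) (\<alpha> X))),
      tunit = fun_id M,
      tassoc = (\<lambda>T S R. \<lambda>X\<in>cobj M. cid M (fobj T (fobj S (fobj R X)))),
      tlunit = (\<lambda>T. \<lambda>X\<in>cobj M. cid M (fobj T X)),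
      trunit = (\<lambda>T. \<lambda>X\<in>cobj M. cid M (fobj T X))\<rparr>"

section \<open>The categories $\mathcal{V}(G,\omega)$ and $\mathcal{M}(A\backslash G,\mu)$\<close>

text \<open>
  The semisimple category with set \<open>S\<close> of simple objects: the list \<open>[x\<^sub>1, \<dots>, x\<^sub>n]\<close> is the direct
  sum of the \<open>x\<^sub>i\<close>, and a morphism is a matrix whose entry at \<open>(i, j)\<close>, a map from the \<open>j\<close>-th
  summand of the source to the \<open>i\<close>-th summand of the target, vanishes unless these summands are
  the same element of \<open>S\<close>. This is skeletal on simple objects: distinct elements of \<open>S\<close> are not
  isomorphic. Lists that differ by a permutation are isomorphic.
\<close>

definition graded_hom :: "'s list \<Rightarrow> 's list \<Rightarrow> complex mat set"
  where
  "graded_hom xs ys = {f \<in> carrier_mat (length ys) (length xs).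
     \<forall>i<length ys. \<forall>j<length xs. ys ! i \<noteq> xs ! j \<longrightarrow> f $$ (i, j) = 0}"

definition kronecker :: "complex mat \<Rightarrow> complex mat \<Rightarrow> complex mat"
  where
  "kronecker f g = mat (dim_row f * dim_row g) (dim_col f * dim_col g)
     (\<lambda>(i, j). f $$ (i div dim_row g, j div dim_col g) * g $$ (i mod dim_row g, j mod dim_col g))"

definition diagonal :: "complex list \<Rightarrow> complex mat"
  where "diagonal cs = mat_diag (length cs) (\<lambda>i. cs ! i)"

text \<open>
  The product is extended bilinearly from the simple objects. With the lexicographic order on
  summands used here and in \<open>kronecker\<close>, both bracketings of a triple product are the same list,
  so that the associativity constraint is a diagonal matrix.
\<close>

definition V_cat ::
  "('g, 'x) monoid_scheme \<Rightarrow> ('g list \<Rightarrow> complex) \<Rightarrow> ('g list, complex mat) mon_cat"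
  where
  "V_cat G \<omega> =
     \<lparr>cobj = lists (carrier G),
      chom = graded_hom,
      cid = (\<lambda>V. 1\<^sub>m (length V)),
      ccomp = (*),
      cadd = (+),
      cscale = (\<cdot>\<^sub>m),
      tobj = (\<lambda>V W. [g \<otimes>\<^bsub>G\<^esub> h. g \<leftarrow> V, h \<leftarrow> W]),
      thom = (\<lambda>_ _ _ _. kronecker),
      tunit = [\<one>\<^bsub>G\<^esub>],
      tassoc = (\<lambda>U V W. diagonal [\<omega> [g, h, k]. g \<leftarrow> U, h \<leftarrow> V, k \<leftarrow> W]),
      tlunit = (\<lambda>V. 1\<^sub>m (length V)),
      trunit = (\<lambda>V. 1\<^sub>m (length V))\<rparr>"

definition M_cat ::
  "('k, 'y) monoid_scheme \<Rightarrow> ('k \<Rightarrow> ('a \<times> 'k) list \<Rightarrow> complex)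
     \<Rightarrow> ('k list, complex mat, ('a \<times> 'k) list, complex mat) mod_cat"
  where
  "M_cat K \<mu> =
     \<lparr>cobj = lists (carrier K),
      chom = graded_hom,
      cid = (\<lambda>X. 1\<^sub>m (length X)),
      ccomp = (*),
      cadd = (+),
      cscale = (\<cdot>\<^sub>m),
      aobj = (\<lambda>X V. [right_act K x g. x \<leftarrow> X, g \<leftarrow> V]),
      ahom = (\<lambda>_ _ _ _. kronecker),
      massoc = (\<lambda>X V W. diagonal [\<mu> x [g, h]. x \<leftarrow> X, g \<leftarrow> V, h \<leftarrow> W]),
      munit = (\<lambda>X. 1\<^sub>m (length X))\<rparr>"

end

theory Submission
  imports Defs "Jordan_Normal_Form.Determinant"
begin

text \<open>
  Write \<open>\<mu>\<^sub>k\<close> for the translate \<open>x \<mapsto> \<mu> (k x)\<close>. Since \<open>\<delta>\<^sub>G \<mu>\<close> is inverse to the pullback of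
  \<open>\<omega>\<close>, multiplying the pullback by the total coboundary of \<open>\<mu>\<close>, viewed in bidegree \<open>(0, 2)\<close>,
  leaves the cochain \<open>k \<mapsto> \<mu> / \<mu>\<^sub>k\<close> in bidegree \<open>(1, 2)\<close>. If for each \<open>k\<close> there is a \<open>\<gamma>\<^sub>k\<close> with
  \<open>\<delta>\<^sub>G \<gamma>\<^sub>k = \<mu> / \<mu>\<^sub>k\<close>, the coboundary of \<open>\<gamma>\<close>, in bidegree \<open>(1, 1)\<close>, removes this cochain as
  well and leaves \<open>\<delta>\<^sub>K \<gamma>\<close> in bidegree \<open>(2, 1)\<close>
  (\<open>total_cohomologous_if_translates_cohomologous\<close>). The cocycle obtained in this way has a
  trivial component in bidegree \<open>(3, 0)\<close>.

  The inverse of such a \<open>\<gamma>\<^sub>k\<close> is the same as a module endofunctor that sends each simple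
  object \<open>x\<close> to \<open>k x\<close>: the pentagon axiom for its structure maps, which are scalars, is the
  equation for \<open>\<gamma>\<^sub>k\<close>. So pointedness has to provide a functor that sends \<open>\<one>\<close> to \<open>k\<close> with
  multiplicity one. Functors that send \<open>\<one>\<close> to some positive multiple of \<open>k\<close> exist, namely the
  regular functor \<open>X \<mapsto> k \<otimes> Hom(\<one>, X)\<close>, which has multiplicity \<open>|A|\<close> (\<open>reg_functor_module\<close>).
  Among them choose one of least multiplicity. It is simple (\<open>minimal_functor_simple\<close>), so it
  is invertible by pointedness, and since multiplicities multiply under composition, an
  invertible functor has multiplicity one (\<open>invertible_functor_length\<close>).

  Simplicity of the minimal functor requires that monomorphisms of functors are injective on
  the value at \<open>\<one>\<close>. Instead of constructing kernels, this uses that regular functors represent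
  evaluation at \<open>\<one>\<close> (\<open>yoneda\<close>), so that there are enough morphisms out of them to test
  injectivity (\<open>mono_Fun_injective\<close>).

  The objects of the categories are lists of simple objects. Most of the technical work
  reduces statements about all objects to simple ones, by means of the decomposition of an
  object into its summands (\<open>extend_simple_natural\<close>, \<open>module_nat_from_simple\<close>) and of the
  block form of the structure maps (\<open>rep_functor_module\<close>).
\<close>

section \<open>Kronecker products\<close>

lemma sum_lessThan_product:
  fixes f :: "nat \<Rightarrow> 'b::comm_monoid_add"
  shows "(\<Sum>p<a * b. f p) = (\<Sum>r<a. \<Sum>t<b. f (r * b + t))"
proof (induction a)
  case (Suc a)
  have "(\<Sum>p<Suc a * b. f p) = (\<Sum>p<a * b + b. f p)" by (simp add: add.commute)
  also have "\<dots> = (\<Sum>p<a * b. f p) + (\<Sum>t<b. f (a * b + t))"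
    using sum.atLeastLessThan_concat[of 0 "a * b" "a * b + b" f]
      sum.shift_bounds_nat_ivl[of f 0 "a * b" b]
    by (simp add: lessThan_atLeast0 add.commute)
  finally show ?case using Suc by simp
qed simp

lemma block_index_less:
  assumes "i < a" "k < (b::nat)"
  shows "i * b + k < a * b"
proof -
  have "i * b + k < Suc i * b" using assms(2) by simp
  also have "\<dots> \<le> a * b" using assms(1) by (intro mult_le_mono1) simp
  finally show ?thesis .
qed

lemma block_index_eq_iff:
  assumes "k < (b::nat)" "l < b"
  shows "i * b + k = j * b + l \<longleftrightarrow> i = j \<and> k = l"
proof
  assume "i * b + k = j * b + l"
  then have "(i * b + k) div b = (j * b + l) div b" "(i * b + k) mod b = (j * b + l) mod b" by simp_all
  then show "i = j \<and> k = l" using assms by simp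
qed simp

lemma block_index_cases:
  assumes "p < a * (b::nat)"
  obtains i k where "i < a" "k < b" "p = i * b + k"
proof
  show "p div b < a" using assms by (simp add: less_mult_imp_div_less)
  show "p mod b < b" using assms by (cases b) auto
  show "p = p div b * b + p mod b" by simp
qed

lemma index_mult_sum:
  assumes "A \<in> carrier_mat n m" "B \<in> carrier_mat m l" "i < n" "j < l"
  shows "(A * B) $$ (i, j) = (\<Sum>k<m. A $$ (i, k) * B $$ (k, j))"
  using assms by (auto simp: scalar_prod_def lessThan_atLeast0 intro!: sum.cong)

lemma block_mat_eqI:
  assumes "A \<in> carrier_mat (a * c) (b * d)" "B \<in> carrier_mat (a * c) (b * d)"
    and "\<And>i k j l. i < a \<Longrightarrow> k < c \<Longrightarrow> j < b \<Longrightarrow> l < d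
           \<Longrightarrow> A $$ (i * c + k, j * d + l) = B $$ (i * c + k, j * d + l)"
  shows "A = B"
proof (rule eq_matI)
  fix p q assume "p < dim_row B" "q < dim_col B"
  then have "p < a * c" "q < b * d" using assms(2) by auto
  then show "A $$ (p, q) = B $$ (p, q)"
    by (auto elim!: block_index_cases intro: assms(3))
qed (use assms in auto)

lemma kronecker_carrier [simp, intro]:
  "f \<in> carrier_mat a b \<Longrightarrow> g \<in> carrier_mat c d \<Longrightarrow> kronecker f g \<in> carrier_mat (a * c) (b * d)"
  by (auto simp: kronecker_def)

lemma index_kronecker:
  assumes "f \<in> carrier_mat a b" "g \<in> carrier_mat c d" "i < a" "k < c" "j < b" "l < d"
  shows "kronecker f g $$ (i * c + k, j * d + l) = f $$ (i, j) * g $$ (k, l)"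
  using assms block_index_less[of i a k c] block_index_less[of j b l d]
  by (auto simp: kronecker_def)

text \<open>
  The mixed product rule makes the Kronecker product a bifunctor; all naturality statements for
  the module action come down to it.
\<close>

lemma kronecker_mult:
  assumes "f \<in> carrier_mat a b" "f' \<in> carrier_mat b c" "g \<in> carrier_mat a' b'" "g' \<in> carrier_mat b' c'"
  shows "kronecker f g * kronecker f' g' = kronecker (f * f') (g * g')"
proof (rule block_mat_eqI[of _ a a' c c'])
  fix i k j l assume *: "i < a" "k < a'" "j < c" "l < c'"
  have "(kronecker f g * kronecker f' g') $$ (i * a' + k, j * c' + l)
      = (\<Sum>r<b. \<Sum>t<b'. kronecker f g $$ (i * a' + k, r * b' + t) * kronecker f' g' $$ (r * b' + t, j * c' + l))"
    using * assms by (subst index_mult_sum[of _ "a * a'" "b * b'" _ "c * c'"])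
      (auto simp: sum_lessThan_product block_index_less)
  also have "\<dots> = (\<Sum>r<b. \<Sum>t<b'. (f $$ (i, r) * f' $$ (r, j)) * (g $$ (k, t) * g' $$ (t, l)))"
    by (intro sum.cong refl) (use * in \<open>simp add: index_kronecker[OF assms(1,3)] index_kronecker[OF assms(2,4)]\<close>)
  also have "\<dots> = (f * f') $$ (i, j) * (g * g') $$ (k, l)"
    using * by (simp add: index_mult_sum[OF assms(1,2)] index_mult_sum[OF assms(3,4)] sum_product)
  also have "\<dots> = kronecker (f * f') (g * g') $$ (i * a' + k, j * c' + l)"
    using * assms by (intro index_kronecker[symmetric]) auto
  finally show "(kronecker f g * kronecker f' g') $$ (i * a' + k, j * c' + l)
      = kronecker (f * f') (g * g') $$ (i * a' + k, j * c' + l)" .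
qed (use assms in \<open>auto intro: mult_carrier_mat[OF kronecker_carrier kronecker_carrier]\<close>)

lemma kronecker_one: "kronecker (1\<^sub>m a) (1\<^sub>m b) = 1\<^sub>m (a * b)"
proof (rule block_mat_eqI[of _ a b a b])
  fix i k j l assume *: "i < a" "k < b" "j < a" "l < b"
  have "i * b + k = j * b + l \<longleftrightarrow> i = j \<and> k = l"
    using * by (intro block_index_eq_iff)
  then show "kronecker (1\<^sub>m a) (1\<^sub>m b) $$ (i * b + k, j * b + l) = 1\<^sub>m (a * b) $$ (i * b + k, j * b + l)"
    using * by (simp add: index_kronecker[of _ a a _ b b] block_index_less)
qed auto

lemma kronecker_assoc: 
  assumes "f \<in> carrier_mat a b" "g \<in> carrier_mat c d" "h \<in> carrier_mat m n"
  shows "kronecker (kronecker f g) h = kronecker f (kronecker g h)"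
proof (rule block_mat_eqI[of _ a "c * m" b "d * n"])
  fix i k j l assume *: "i < a" "k < c * m" "j < b" "l < d * n"
  obtain k1 k2 where k: "k1 < c" "k2 < m" "k = k1 * m + k2" using *(2) by (rule block_index_cases)
  obtain l1 l2 where l: "l1 < d" "l2 < n" "l = l1 * n + l2" using *(4) by (rule block_index_cases)
  have "kronecker (kronecker f g) h $$ (i * (c * m) + k, j * (d * n) + l)
      = kronecker (kronecker f g) h $$ ((i * c + k1) * m + k2, (j * d + l1) * n + l2)"
    by (simp add: k l algebra_simps)
  also have "\<dots> = kronecker f g $$ (i * c + k1, j * d + l1) * h $$ (k2, l2)"
    by (rule index_kronecker) (use assms * k l in \<open>auto simp: block_index_less\<close>)
  also have "\<dots> = f $$ (i, j) * kronecker g h $$ (k, l)"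
    using assms * k l by (simp add: index_kronecker[OF assms(1,2)] index_kronecker[OF assms(2,3)])
  also have "\<dots> = kronecker f (kronecker g h) $$ (i * (c * m) + k, j * (d * n) + l)"
    using assms * by (intro index_kronecker[symmetric]) auto
  finally show "kronecker (kronecker f g) h $$ (i * (c * m) + k, j * (d * n) + l)
    = kronecker f (kronecker g h) $$ (i * (c * m) + k, j * (d * n) + l)" .
qed (use assms kronecker_carrier[OF kronecker_carrier[OF assms(1,2)] assms(3)] in \<open>auto simp: algebra_simps\<close>)

lemma kronecker_one_right [simp]: "kronecker f (1\<^sub>m (Suc 0)) = f"
  by (auto simp: kronecker_def)

section \<open>Graded matrices\<close>

lemma graded_homD: "f \<in> graded_hom xs ys \<Longrightarrow> f \<in> carrier_mat (length ys) (length xs)"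
  by (simp add: graded_hom_def)

lemma graded_hom_nonzeroD:
  "f \<in> graded_hom xs ys \<Longrightarrow> i < length ys \<Longrightarrow> j < length xs \<Longrightarrow> f $$ (i, j) \<noteq> 0 \<Longrightarrow> ys ! i = xs ! j"
  by (auto simp: graded_hom_def)

lemma graded_hom_one [simp]: "1\<^sub>m (length xs) \<in> graded_hom xs xs"
  by (auto simp: graded_hom_def)

lemma graded_hom_zero [simp]: "0\<^sub>m (length ys) (length xs) \<in> graded_hom xs ys"
  by (auto simp: graded_hom_def)

lemma graded_hom_mult [intro]:
  assumes "f \<in> graded_hom ys zs" "g \<in> graded_hom xs ys"
  shows "f * g \<in> graded_hom xs zs"
proof -
  have "(f * g) $$ (i, j) = 0" if *: "i < length zs" "j < length xs" "zs ! i \<noteq> xs ! j" for i j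
  proof -
    have "(f * g) $$ (i, j) = (\<Sum>k<length ys. f $$ (i, k) * g $$ (k, j))"
      using * assms by (intro index_mult_sum) (auto dest: graded_homD)
    also have "\<dots> = 0"
    proof (intro sum.neutral ballI)
      fix k assume "k \<in> {..<length ys}"
      moreover from this have "zs ! i \<noteq> ys ! k \<or> ys ! k \<noteq> xs ! j" using *(3) by auto
      ultimately show "f $$ (i, k) * g $$ (k, j) = 0"
        using * assms by (auto simp: graded_hom_def)
    qed
    finally show ?thesis .
  qed
  then show ?thesis using assms by (auto simp: graded_hom_def)
qed

text \<open>
  The object parts of both tensor product and action are lists of this form; their order is
  the one in which \<open>kronecker\<close> enumerates rows and columns.
\<close>

lemma length_list_product [simp]: "length [f x y. x \<leftarrow> xs, y \<leftarrow> ys] = length xs * length ys"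
  by (induction xs) auto

lemma nth_list_product:
  "i < length xs \<Longrightarrow> j < length ys \<Longrightarrow> [f x y. x \<leftarrow> xs, y \<leftarrow> ys] ! (i * length ys + j) = f (xs ! i) (ys ! j)"
proof (induction xs arbitrary: i)
  case (Cons x xs)
  then show ?case by (cases i) (auto simp: nth_append)
qed simp

lemma kronecker_graded:
  assumes "f \<in> graded_hom xs xs'" "g \<in> graded_hom ys ys'"
  shows "kronecker f g \<in> graded_hom [h x y. x \<leftarrow> xs, y \<leftarrow> ys] [h x y. x \<leftarrow> xs', y \<leftarrow> ys']"
proof -
  note fg = graded_homD[OF assms(1)] graded_homD[OF assms(2)]
  have "kronecker f g $$ (p, q) = 0" if *: "p < length xs' * length ys'" "q < length xs * length ys"
    "[h x y. x \<leftarrow> xs', y \<leftarrow> ys'] ! p \<noteq> [h x y. x \<leftarrow> xs, y \<leftarrow> ys] ! q" for p q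
  proof -
    obtain i k where p: "i < length xs'" "k < length ys'" "p = i * length ys' + k"
      using *(1) by (rule block_index_cases)
    obtain j l where q: "j < length xs" "l < length ys" "q = j * length ys + l"
      using *(2) by (rule block_index_cases)
    have "kronecker f g $$ (p, q) = f $$ (i, j) * g $$ (k, l)"
      unfolding p q by (rule index_kronecker) (use fg p q in auto)
    moreover have "xs' ! i \<noteq> xs ! j \<or> ys' ! k \<noteq> ys ! l"
      using *(3) p q by (auto simp: nth_list_product)
    ultimately show ?thesis
      using p q graded_hom_nonzeroD[OF assms(1), of i j] graded_hom_nonzeroD[OF assms(2), of k l] by auto
  qed
  then show ?thesis using kronecker_carrier[OF fg] by (auto simp: graded_hom_def)
qed

section \<open>Finite sums of matrices and the summands of a list\<close>

text \<open>
  Matrices of varying size form no additive monoid, so sums of them carry their size explicitly.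
\<close>

definition mat_sum :: "nat \<Rightarrow> nat \<Rightarrow> 'i set \<Rightarrow> ('i \<Rightarrow> complex mat) \<Rightarrow> complex mat"
  where "mat_sum m n I f = mat m n (\<lambda>p. \<Sum>a\<in>I. f a $$ p)"

lemma mat_sum_carrier [simp, intro]: "mat_sum m n I f \<in> carrier_mat m n"
  by (simp add: mat_sum_def)

lemma mat_sum_empty [simp]: "mat_sum m n {} f = 0\<^sub>m m n"
  by (auto simp: mat_sum_def)

lemma mat_sum_insert:
  "finite I \<Longrightarrow> a \<notin> I \<Longrightarrow> f a \<in> carrier_mat m n \<Longrightarrow> mat_sum m n (insert a I) f = f a + mat_sum m n I f"
  by (auto simp: mat_sum_def)

lemma mat_sum_cong: "(\<And>a. a \<in> I \<Longrightarrow> f a = g a) \<Longrightarrow> mat_sum m n I f = mat_sum m n I g"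
  by (auto simp: mat_sum_def)

lemma mult_mat_sum:
  assumes "B \<in> carrier_mat l m" "\<And>a. a \<in> I \<Longrightarrow> f a \<in> carrier_mat m n"
  shows "B * mat_sum m n I f = mat_sum l n I (\<lambda>a. B * f a)"
proof (rule eq_matI)
  fix i j assume "i < dim_row (mat_sum l n I (\<lambda>a. B * f a))" "j < dim_col (mat_sum l n I (\<lambda>a. B * f a))"
  then have *: "i < l" "j < n" by (auto simp: mat_sum_def)
  have "(B * mat_sum m n I f) $$ (i, j) = (\<Sum>k<m. \<Sum>a\<in>I. B $$ (i, k) * f a $$ (k, j))"
    using * assms by (subst index_mult_sum[of _ l m _ n]) (auto simp: mat_sum_def sum_distrib_left)
  also have "\<dots> = (\<Sum>a\<in>I. (B * f a) $$ (i, j))"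
    using * by (subst sum.swap, intro sum.cong refl)
      (subst index_mult_sum[OF assms(1) assms(2)], auto)
  finally show "(B * mat_sum m n I f) $$ (i, j) = mat_sum l n I (\<lambda>a. B * f a) $$ (i, j)"
    using * by (simp add: mat_sum_def)
qed (use assms in \<open>auto simp: mat_sum_def\<close>)

lemma mat_sum_mult:
  assumes "B \<in> carrier_mat n l" "\<And>a. a \<in> I \<Longrightarrow> f a \<in> carrier_mat m n"
  shows "mat_sum m n I f * B = mat_sum m l I (\<lambda>a. f a * B)"
proof (rule eq_matI)
  fix i j assume "i < dim_row (mat_sum m l I (\<lambda>a. f a * B))" "j < dim_col (mat_sum m l I (\<lambda>a. f a * B))"
  then have *: "i < m" "j < l" by (auto simp: mat_sum_def)
  have "(mat_sum m n I f * B) $$ (i, j) = (\<Sum>k<n. \<Sum>a\<in>I. f a $$ (i, k) * B $$ (k, j))"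
    using * assms by (subst index_mult_sum[of _ m n _ l]) (auto simp: mat_sum_def sum_distrib_right)
  also have "\<dots> = (\<Sum>a\<in>I. (f a * B) $$ (i, j))"
    using * by (subst sum.swap, intro sum.cong refl)
      (subst index_mult_sum[OF assms(2) assms(1)], auto)
  finally show "(mat_sum m n I f * B) $$ (i, j) = mat_sum m l I (\<lambda>a. f a * B) $$ (i, j)"
    using * by (simp add: mat_sum_def)
qed (use assms in \<open>auto simp: mat_sum_def\<close>)

lemma mat_sum_graded:
  "(\<And>a. a \<in> I \<Longrightarrow> f a \<in> graded_hom xs ys) \<Longrightarrow> mat_sum (length ys) (length xs) I f \<in> graded_hom xs ys"
  by (auto simp: graded_hom_def mat_sum_def intro!: sum.neutral)

definition incl :: "nat \<Rightarrow> nat \<Rightarrow> complex mat"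
  where "incl n i = mat n 1 (\<lambda>(j, _). of_bool (j = i))"

definition proj :: "nat \<Rightarrow> nat \<Rightarrow> complex mat"
  where "proj n i = mat 1 n (\<lambda>(_, j). of_bool (j = i))"

lemma incl_graded: "i < length xs \<Longrightarrow> incl (length xs) i \<in> graded_hom [xs ! i] xs"
  by (auto simp: graded_hom_def incl_def)

lemma proj_graded: "i < length xs \<Longrightarrow> proj (length xs) i \<in> graded_hom xs [xs ! i]"
  by (auto simp: graded_hom_def proj_def)

lemma incl_carrier [simp]: "incl n i \<in> carrier_mat n (Suc 0)"
  by (simp add: incl_def)

lemma proj_carrier [simp]: "proj n i \<in> carrier_mat (Suc 0) n"
  by (simp add: proj_def)

lemma mult_incl:
  assumes "f \<in> carrier_mat m n" "i < n"
  shows "f * incl n i = mat m 1 (\<lambda>(j, _). f $$ (j, i))"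
proof (rule eq_matI)
  fix j l assume *: "j < dim_row (mat m 1 (\<lambda>(j, _). f $$ (j, i)))" "l < dim_col (mat m 1 (\<lambda>(j, _). f $$ (j, i)))"
  then have "(f * incl n i) $$ (j, l) = (\<Sum>k<n. if k = i then f $$ (j, k) else 0)"
    using assms by (subst index_mult_sum[of _ m n _ 1]) (auto simp: incl_def intro!: sum.cong)
  then show "(f * incl n i) $$ (j, l) = mat m 1 (\<lambda>(j, _). f $$ (j, i)) $$ (j, l)"
    using * assms by simp
qed (use assms in \<open>auto simp: incl_def\<close>)

lemma proj_mult:
  assumes "f \<in> carrier_mat m n" "i < m"
  shows "proj m i * f = mat 1 n (\<lambda>(_, j). f $$ (i, j))"
proof (rule eq_matI)
  fix l j assume *: "l < dim_row (mat 1 n (\<lambda>(_, j). f $$ (i, j)))" "j < dim_col (mat 1 n (\<lambda>(_, j). f $$ (i, j)))"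
  then have "(proj m i * f) $$ (l, j) = (\<Sum>k<m. if k = i then f $$ (k, j) else 0)"
    using assms by (subst index_mult_sum[of _ 1 m _ n]) (auto simp: proj_def intro!: sum.cong)
  then show "(proj m i * f) $$ (l, j) = mat 1 n (\<lambda>(_, j). f $$ (i, j)) $$ (l, j)"
    using * assms by simp
qed (use assms in \<open>auto simp: proj_def\<close>)

lemma proj_incl: "i < n \<Longrightarrow> proj n i * incl n i = 1\<^sub>m (Suc 0)"
  by (subst proj_mult[of _ _ 1]) (auto simp: incl_def)

text \<open>
  The object \<open>[x\<^sub>1, \<dots>, x\<^sub>n]\<close> is the biproduct of the \<open>[x\<^sub>i]\<close>. This relation lets statements
  about arbitrary objects be reduced to simple ones.
\<close>

lemma sum_incl_proj: "mat_sum n n {..<n} (\<lambda>i. incl n i * proj n i) = 1\<^sub>m n"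
proof (rule eq_matI)
  fix j l assume *: "j < dim_row (1\<^sub>m n)" "l < dim_col (1\<^sub>m n)"
  have "(incl n i * proj n i) $$ (j, l) = of_bool (j = i) * of_bool (l = i)" if "i < n" for i
    using * that by (subst index_mult_sum[of _ n 1 _ n]) (auto simp: incl_def proj_def)
  then have "mat_sum n n {..<n} (\<lambda>i. incl n i * proj n i) $$ (j, l) = (\<Sum>i<n. if i = j then of_bool (l = i) else 0)"
    using * by (auto simp: mat_sum_def intro!: sum.cong)
  then show "mat_sum n n {..<n} (\<lambda>i. incl n i * proj n i) $$ (j, l) = 1\<^sub>m n $$ (j, l)"
    using * by simp
qed (auto simp: mat_sum_def)

text \<open>
  The summands of \<open>X \<otimes> V\<close> are the products of the summands of \<open>X\<close> and \<open>V\<close>.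
\<close>

lemma kronecker_incl:
  assumes "i < m" "j < n"
  shows "kronecker (incl m i) (incl n j) = incl (m * n) (i * n + j)"
proof (rule block_mat_eqI[of _ m n 1 1])
  fix a k b l assume *: "a < m" "k < n" "b < (1::nat)" "l < (1::nat)"
  have "a * n + k = i * n + j \<longleftrightarrow> a = i \<and> k = j"
    using * assms by (intro block_index_eq_iff)
  then show "kronecker (incl m i) (incl n j) $$ (a * n + k, b * 1 + l) = incl (m * n) (i * n + j) $$ (a * n + k, b * 1 + l)"
    using * assms by (subst index_kronecker[of _ m 1 _ n 1]) (auto simp: incl_def block_index_less)
qed (use kronecker_carrier[of "incl m i" m 1 "incl n j" n 1] in auto)

section \<open>Traces and square matrices\<close>

definition trace :: "complex mat \<Rightarrow> complex"
  where "trace A = (\<Sum>i<dim_row A. A $$ (i, i))"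

lemma trace_mult_commute:
  assumes "A \<in> carrier_mat n m" "B \<in> carrier_mat m n"
  shows "trace (A * B) = trace (B * A)"
proof -
  have "trace (A * B) = (\<Sum>i<n. \<Sum>k<m. A $$ (i, k) * B $$ (k, i))"
    using assms unfolding trace_def by (auto simp: index_mult_sum[OF assms] simp del: index_mult_mat(1))
  also have "\<dots> = (\<Sum>k<m. \<Sum>i<n. B $$ (k, i) * A $$ (i, k))"
    by (subst sum.swap) (simp add: mult.commute)
  also have "\<dots> = trace (B * A)"
    using assms unfolding trace_def by (auto simp: index_mult_sum[OF assms(2,1)] simp del: index_mult_mat(1))
  finally show ?thesis .
qed

lemma trace_one [simp]: "trace (1\<^sub>m n) = of_nat n"
  by (simp add: trace_def)

lemma trace_mat_sum:
  assumes "\<And>a. a \<in> I \<Longrightarrow> f a \<in> carrier_mat n n"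
  shows "trace (mat_sum n n I f) = (\<Sum>a\<in>I. trace (f a))"
proof -
  have "trace (mat_sum n n I f) = (\<Sum>i<n. \<Sum>a\<in>I. f a $$ (i, i))"
    by (simp add: trace_def mat_sum_def)
  also have "\<dots> = (\<Sum>a\<in>I. trace (f a))"
    by (subst sum.swap, rule sum.cong) (use assms in \<open>auto simp: trace_def\<close>)
  finally show ?thesis .
qed

text \<open>
  Compare the traces of \<open>A B\<close> and \<open>B A\<close>, which are the two sizes.
\<close>

lemma invertible_mat_square:
  fixes A :: "complex mat"
  assumes "A \<in> carrier_mat n m" "B \<in> carrier_mat m n" "A * B = 1\<^sub>m n" "B * A = 1\<^sub>m m"
  shows "n = m"
  using trace_mult_commute[OF assms(1,2)] assms(3,4) by simp

lemma singular_mat_kernel: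
  fixes A :: "complex mat"
  assumes A: "A \<in> carrier_mat n n" and "det A = 0"
  obtains u where "u \<in> carrier_mat n 1" "u \<noteq> 0\<^sub>m n 1" "A * u = 0\<^sub>m n 1"
proof -
  obtain v where v: "v \<in> carrier_vec n" "v \<noteq> 0\<^sub>v n" "A *\<^sub>v v = 0\<^sub>v n"
    using det_0_iff_vec_prod_zero_field[OF A] assms(2) by auto
  let ?u = "mat n 1 (\<lambda>(i, _). v $ i)"
  have "A * ?u = 0\<^sub>m n 1"
  proof (rule eq_matI)
    fix i j assume ij: "i < dim_row (0\<^sub>m n 1 :: complex mat)" "j < dim_col (0\<^sub>m n 1 :: complex mat)"
    have "(A * ?u) $$ (i, j) = (\<Sum>k<n. A $$ (i, k) * v $ k)"
      using ij A by (subst index_mult_sum[of _ n n _ 1]) auto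
    also have "\<dots> = (A *\<^sub>v v) $ i"
      using ij A v(1) by (auto simp: scalar_prod_def lessThan_atLeast0 intro!: sum.cong)
    finally show "(A * ?u) $$ (i, j) = 0\<^sub>m n 1 $$ (i, j)" using v(3) ij by simp
  qed (use A in auto)
  moreover have "?u \<noteq> 0\<^sub>m n 1"
  proof
    assume u: "?u = 0\<^sub>m n 1"
    have "v $ i = 0" if "i < n" for i
      using arg_cong[OF u, of "\<lambda>u. u $$ (i, 0)"] that by simp
    then have "v = 0\<^sub>v n" using v(1) by (intro eq_vecI) auto
    then show False using v(2) by simp
  qed
  ultimately show ?thesis by (intro that[of ?u]) auto
qed

lemma trivial_kernel_invertible:
  fixes A :: "complex mat"
  assumes A: "A \<in> carrier_mat n n"
    and inj: "\<And>u. u \<in> carrier_mat n 1 \<Longrightarrow> A * u = 0\<^sub>m n 1 \<Longrightarrow> u = 0\<^sub>m n 1"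
  obtains B where "B \<in> carrier_mat n n" "A * B = 1\<^sub>m n" "B * A = 1\<^sub>m n"
proof -
  have "det A \<noteq> 0" using singular_mat_kernel[OF A] inj by metis
  from det_non_zero_imp_unit[OF A this, where b = "()"]
  show ?thesis using that by (auto simp: Units_def ring_mat_def)
qed

lemma trivial_kernel_dim_le:
  fixes A :: "complex mat"
  assumes A: "A \<in> carrier_mat m n"
    and inj: "\<And>u. u \<in> carrier_mat n 1 \<Longrightarrow> A * u = 0\<^sub>m m 1 \<Longrightarrow> u = 0\<^sub>m n 1"
  shows "n \<le> m"
proof (rule ccontr)
  assume "\<not> n \<le> m"
  then have mn: "m < n" by simp
  \<comment> \<open>Padding with zero rows gives a singular square matrix with the same kernel.\<close>
  define B where "B = mat n n (\<lambda>(i, j). if i < m then A $$ (i, j) else 0)"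
  have B: "B \<in> carrier_mat n n" by (simp add: B_def)
  have "B = mat\<^sub>r n n (\<lambda>i. if i = m then 0\<^sub>v n else row B i)"
    by (rule eq_matI) (use B mn in \<open>auto simp: B_def\<close>)
  then have "det B = 0" using det_row_0[OF mn, of "row B"] B by simp
  then obtain u where u: "u \<in> carrier_mat n 1" "u \<noteq> 0\<^sub>m n 1" "B * u = 0\<^sub>m n 1"
    using singular_mat_kernel[OF B] by auto
  have "A * u = 0\<^sub>m m 1"
  proof (rule eq_matI)
    fix i j assume ij: "i < dim_row (0\<^sub>m m 1 :: complex mat)" "j < dim_col (0\<^sub>m m 1 :: complex mat)"
    have "(A * u) $$ (i, j) = (B * u) $$ (i, j)"
      using ij A B u(1) mn index_mult_sum[OF A u(1), of i j] index_mult_sum[OF B u(1), of i j]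
      by (simp add: B_def)
    then show "(A * u) $$ (i, j) = 0\<^sub>m m 1 $$ (i, j)" using u(3) ij mn by simp
  qed (use A u in auto)
  then show False using inj u by blast
qed

section \<open>Module functors and their additivity\<close>

lemma V_cat_sel [simp]:
  "cobj (V_cat G \<omega>) = lists (carrier G)" "chom (V_cat G \<omega>) = graded_hom"
  "cid (V_cat G \<omega>) V = 1\<^sub>m (length V)"
  "tobj (V_cat G \<omega>) V W = [g \<otimes>\<^bsub>G\<^esub> h. g \<leftarrow> V, h \<leftarrow> W]" "tunit (V_cat G \<omega>) = [\<one>\<^bsub>G\<^esub>]"
  by (simp_all add: V_cat_def)

lemma M_cat_sel [simp]:
  "cobj (M_cat K \<mu>) = lists (carrier K)" "chom (M_cat K \<mu>) = graded_hom"
  "cid (M_cat K \<mu>) X = 1\<^sub>m (length X)" "ccomp (M_cat K \<mu>) = (*)"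
  "cadd (M_cat K \<mu>) = (+)" "cscale (M_cat K \<mu>) = (\<cdot>\<^sub>m)"
  "aobj (M_cat K \<mu>) X V = [right_act K x g. x \<leftarrow> X, g \<leftarrow> V]"
  "ahom (M_cat K \<mu>) X X' V V' = kronecker"
  "massoc (M_cat K \<mu>) X V W = diagonal [\<mu> x [g, h]. x \<leftarrow> X, g \<leftarrow> V, h \<leftarrow> W]"
  "munit (M_cat K \<mu>) X = 1\<^sub>m (length X)"
  by (simp_all add: M_cat_def)

lemma is_iso_M_cat:
  "is_iso (M_cat K \<mu>) X Y f \<longleftrightarrow> f \<in> graded_hom X Y \<and>
     (\<exists>g\<in>graded_hom Y X. g * f = 1\<^sub>m (length X) \<and> f * g = 1\<^sub>m (length Y))"
  by (simp add: is_iso_def)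

lemma iso_M_cat_comp:
  assumes "is_iso (M_cat K \<mu>) Y Z g" "is_iso (M_cat K \<mu>) X Y f"
  shows "is_iso (M_cat K \<mu>) X Z (g * f)"
proof -
  obtain f' where f: "f \<in> graded_hom X Y" "f' \<in> graded_hom Y X" "f' * f = 1\<^sub>m (length X)" "f * f' = 1\<^sub>m (length Y)"
    using assms(2) by (auto simp: is_iso_M_cat)
  obtain g' where g: "g \<in> graded_hom Y Z" "g' \<in> graded_hom Z Y" "g' * g = 1\<^sub>m (length Y)" "g * g' = 1\<^sub>m (length Z)"
    using assms(1) by (auto simp: is_iso_M_cat)
  note c = f(1,2)[THEN graded_homD] g(1,2)[THEN graded_homD]
  have "(f' * g') * (g * f) = f' * ((g' * g) * f)"
    by (simp only: assoc_mult_mat[OF c(2,4) mult_carrier_mat[OF c(3,1)]] assoc_mult_mat[OF c(4,3,1)])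
  moreover have "(g * f) * (f' * g') = g * ((f * f') * g')"
    by (simp only: assoc_mult_mat[OF c(3,1) mult_carrier_mat[OF c(2,4)]] assoc_mult_mat[OF c(1,2,4)])
  ultimately have "(f' * g') * (g * f) = 1\<^sub>m (length X)" "(g * f) * (f' * g') = 1\<^sub>m (length Z)"
    using c f g by auto
  then show ?thesis using f g unfolding is_iso_M_cat by blast
qed

lemma iso_M_cat_inverse:
  assumes "is_iso (M_cat K \<mu>) X Y f" "g \<in> carrier_mat (length X) (length Y)" "g * f = 1\<^sub>m (length X)"
  shows "is_iso (M_cat K \<mu>) Y X g"
proof -
  obtain f' where f: "f \<in> graded_hom X Y" "f' \<in> graded_hom Y X" "f' * f = 1\<^sub>m (length X)" "f * f' = 1\<^sub>m (length Y)"
    using assms(1) by (auto simp: is_iso_M_cat)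
  note c = f(1,2)[THEN graded_homD]
  have "g = g * (f * f')" using f assms(2) by simp
  also have "\<dots> = f'" using c assms(2,3) by (simp flip: assoc_mult_mat)
  finally show ?thesis using f by (auto simp: is_iso_M_cat)
qed

lemma nth_carrier [simp]: "X \<in> lists S \<Longrightarrow> i < length X \<Longrightarrow> X ! i \<in> S"
  by (auto simp: in_lists_conv_set)

lemma iso_M_cat_length:
  assumes "is_iso (M_cat K \<mu>) X Y f"
  shows "length X = length Y"
  using assms invertible_mat_square unfolding is_iso_M_cat by (metis graded_homD)

text \<open>
  An isomorphism has no zero rows, and distinct simple objects have no nonzero morphisms
  between them.
\<close>

lemma iso_M_cat_replicate:
  assumes "is_iso (M_cat K \<mu>) X (replicate n y) f"
  shows "X = replicate n y"
proof -
  obtain g where fg: "f \<in> graded_hom X (replicate n y)" "g \<in> graded_hom (replicate n y) X"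
    and gf: "g * f = 1\<^sub>m (length X)" "f * g = 1\<^sub>m n"
    using assms by (auto simp: is_iso_M_cat)
  have len: "length X = n" using iso_M_cat_length[OF assms] by simp
  have "X ! i = y" if i: "i < n" for i
  proof (rule ccontr)
    assume "X ! i \<noteq> y"
    then have "g $$ (i, k) = 0" if "k < n" for k
      using fg(2) i that len by (auto simp: graded_hom_def)
    then have "(g * f) $$ (i, i) = 0"
      using i len fg by (subst index_mult_sum[of _ n n _ n]) (auto dest!: graded_homD)
    then show False using gf(1) i len by simp
  qed
  then show ?thesis using len by (auto intro: nth_equalityI)
qed

text \<open>
  The extension, the cocycle and the module category of the theorem. Pointedness of the dual
  category enters in \<open>pointed_imp_translates_cohomologous\<close>.
\<close>

locale extension_data =
  fixes A :: "('a, 'x) monoid_scheme" and K :: "('k, 'y) monoid_scheme"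
    and \<phi> :: "'k \<Rightarrow> 'a \<Rightarrow> 'a" and F :: "'k \<Rightarrow> 'k \<Rightarrow> 'a"
    and G :: "('a \<times> 'k) monoid"
    and \<omega> :: "('a \<times> 'k) list \<Rightarrow> complex"
    and \<mu> :: "'k \<Rightarrow> ('a \<times> 'k) list \<Rightarrow> complex"
  assumes A: "comm_group A" and finite_A: "finite (carrier A)"
    and K: "group K"
    and \<phi>: "\<phi> \<in> hom K (AutoGroup A)"
    and F: "normalized_2_cocycle K A \<phi> F"
    and G_def: "G = twisted_product A K \<phi> F"
    and \<omega>: "\<omega> \<in> cocycles G 3"
    and \<mu>: "\<mu> \<in> map_cochains K G 2"
    and pentagon: "delta_G K G (\<lambda>x gs. inverse (\<mu> x gs)) = pullback K \<omega>"
begin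

sublocale A: comm_group A by (rule A)
sublocale K: group K by (rule K)

lemma \<phi>_closed [simp]: "k \<in> carrier K \<Longrightarrow> a \<in> carrier A \<Longrightarrow> \<phi> k a \<in> carrier A"
  using \<phi> by (auto simp: hom_def AutoGroup_def BijGroup_def auto_def Pi_def)

lemma \<phi>_mult: "k \<in> carrier K \<Longrightarrow> a \<in> carrier A \<Longrightarrow> b \<in> carrier A \<Longrightarrow> \<phi> k (a \<otimes>\<^bsub>A\<^esub> b) = \<phi> k a \<otimes>\<^bsub>A\<^esub> \<phi> k b"
  using \<phi> by (auto simp: hom_def AutoGroup_def BijGroup_def auto_def Pi_def)

lemma \<phi>_comp:
  assumes "k \<in> carrier K" "l \<in> carrier K" "a \<in> carrier A"
  shows "\<phi> (k \<otimes>\<^bsub>K\<^esub> l) a = \<phi> k (\<phi> l a)"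
proof -
  have "\<phi> (k \<otimes>\<^bsub>K\<^esub> l) = \<phi> k \<otimes>\<^bsub>AutoGroup A\<^esub> \<phi> l" using \<phi> assms by (auto simp: hom_def)
  moreover have "\<phi> k \<in> Bij (carrier A)" "\<phi> l \<in> Bij (carrier A)"
    using \<phi> assms by (auto simp: hom_def AutoGroup_def auto_def Pi_def)
  ultimately show ?thesis using assms by (simp add: AutoGroup_def BijGroup_def compose_def)
qed

lemma \<phi>_one_left: "a \<in> carrier A \<Longrightarrow> \<phi> \<one>\<^bsub>K\<^esub> a = a"
proof -
  assume a: "a \<in> carrier A"
  interpret Aut: group "AutoGroup A" by (rule A.AutoGroup)
  interpret group_hom K "AutoGroup A" \<phi> by unfold_locales (rule \<phi>)
  show ?thesis using hom_one a by (simp add: AutoGroup_def BijGroup_def)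
qed

lemma \<phi>_one_right: "k \<in> carrier K \<Longrightarrow> \<phi> k \<one>\<^bsub>A\<^esub> = \<one>\<^bsub>A\<^esub>"
  by (metis A.one_closed A.r_one A.r_cancel_one' \<phi>_closed \<phi>_mult)

lemma F_closed [simp]: "k \<in> carrier K \<Longrightarrow> l \<in> carrier K \<Longrightarrow> F k l \<in> carrier A"
  using F by (auto simp: normalized_2_cocycle_def)

lemma F_one [simp]: "k \<in> carrier K \<Longrightarrow> F k \<one>\<^bsub>K\<^esub> = \<one>\<^bsub>A\<^esub>" "k \<in> carrier K \<Longrightarrow> F \<one>\<^bsub>K\<^esub> k = \<one>\<^bsub>A\<^esub>"
  using F by (auto simp: normalized_2_cocycle_def)

lemma F_cocycle:
  assumes "k1 \<in> carrier K" "k2 \<in> carrier K" "k3 \<in> carrier K"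
  shows "\<phi> k1 (F k2 k3) \<otimes>\<^bsub>A\<^esub> F k1 (k2 \<otimes>\<^bsub>K\<^esub> k3) = F k1 k2 \<otimes>\<^bsub>A\<^esub> F (k1 \<otimes>\<^bsub>K\<^esub> k2) k3"
proof -
  have "\<phi> k1 (F k2 k3) \<otimes>\<^bsub>A\<^esub> inv\<^bsub>A\<^esub> F (k1 \<otimes>\<^bsub>K\<^esub> k2) k3
          \<otimes>\<^bsub>A\<^esub> F k1 (k2 \<otimes>\<^bsub>K\<^esub> k3) \<otimes>\<^bsub>A\<^esub> inv\<^bsub>A\<^esub> F k1 k2 = \<one>\<^bsub>A\<^esub>"
    using F assms by (auto simp: normalized_2_cocycle_def)
  then have "inv\<^bsub>A\<^esub> (inv\<^bsub>A\<^esub> F k1 k2) =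
      \<phi> k1 (F k2 k3) \<otimes>\<^bsub>A\<^esub> inv\<^bsub>A\<^esub> F (k1 \<otimes>\<^bsub>K\<^esub> k2) k3 \<otimes>\<^bsub>A\<^esub> F k1 (k2 \<otimes>\<^bsub>K\<^esub> k3)"
    by (rule A.inv_equality) (use assms in auto)
  then have "(\<phi> k1 (F k2 k3) \<otimes>\<^bsub>A\<^esub> F k1 (k2 \<otimes>\<^bsub>K\<^esub> k3)) \<otimes>\<^bsub>A\<^esub> inv\<^bsub>A\<^esub> F (k1 \<otimes>\<^bsub>K\<^esub> k2) k3 = F k1 k2"
    using assms by (simp add: A.m_ac)
  then show ?thesis using assms by (metis A.inv_solve_right' A.m_closed F_closed K.m_closed \<phi>_closed)
qed

lemma carrier_G: "carrier G = carrier A \<times> carrier K"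
  by (simp add: G_def twisted_product_def)

lemma G_one: "\<one>\<^bsub>G\<^esub> = (\<one>\<^bsub>A\<^esub>, \<one>\<^bsub>K\<^esub>)"
  by (simp add: G_def twisted_product_def)

lemma G_mult: "(a, k) \<otimes>\<^bsub>G\<^esub> (b, l) = (a \<otimes>\<^bsub>A\<^esub> \<phi> k b \<otimes>\<^bsub>A\<^esub> F k l, k \<otimes>\<^bsub>K\<^esub> l)"
  by (simp add: G_def twisted_product_def)

lemma G_closed [simp]: "g \<in> carrier G \<Longrightarrow> h \<in> carrier G \<Longrightarrow> g \<otimes>\<^bsub>G\<^esub> h \<in> carrier G"
  by (cases g; cases h) (simp add: G_mult carrier_G)

lemma G_one_closed [simp]: "\<one>\<^bsub>G\<^esub> \<in> carrier G"
  by (simp add: G_one carrier_G)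

lemma snd_G [simp]: "g \<in> carrier G \<Longrightarrow> snd g \<in> carrier K" "g \<in> carrier G \<Longrightarrow> fst g \<in> carrier A"
  by (auto simp: carrier_G)

lemma G_assoc:
  assumes "g \<in> carrier G" "h \<in> carrier G" "k \<in> carrier G"
  shows "g \<otimes>\<^bsub>G\<^esub> h \<otimes>\<^bsub>G\<^esub> k = g \<otimes>\<^bsub>G\<^esub> (h \<otimes>\<^bsub>G\<^esub> k)"
proof -
  obtain a x b y c z where [simp]: "g = (a, x)" "h = (b, y)" "k = (c, z)"
    by (cases g; cases h; cases k)
  have [simp]: "a \<in> carrier A" "b \<in> carrier A" "c \<in> carrier A" "x \<in> carrier K" "y \<in> carrier K" "z \<in> carrier K"
    using assms by (auto simp: carrier_G)
  have "a \<otimes>\<^bsub>A\<^esub> \<phi> x b \<otimes>\<^bsub>A\<^esub> F x y \<otimes>\<^bsub>A\<^esub> \<phi> (x \<otimes>\<^bsub>K\<^esub> y) c \<otimes>\<^bsub>A\<^esub> F (x \<otimes>\<^bsub>K\<^esub> y) z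
     = a \<otimes>\<^bsub>A\<^esub> \<phi> x b \<otimes>\<^bsub>A\<^esub> \<phi> x (\<phi> y c) \<otimes>\<^bsub>A\<^esub> (F x y \<otimes>\<^bsub>A\<^esub> F (x \<otimes>\<^bsub>K\<^esub> y) z)"
    by (simp add: \<phi>_comp A.m_ac)
  also have "\<dots> = a \<otimes>\<^bsub>A\<^esub> \<phi> x b \<otimes>\<^bsub>A\<^esub> \<phi> x (\<phi> y c) \<otimes>\<^bsub>A\<^esub> (\<phi> x (F y z) \<otimes>\<^bsub>A\<^esub> F x (y \<otimes>\<^bsub>K\<^esub> z))"
    by (simp add: F_cocycle)
  also have "\<dots> = a \<otimes>\<^bsub>A\<^esub> \<phi> x (b \<otimes>\<^bsub>A\<^esub> \<phi> y c \<otimes>\<^bsub>A\<^esub> F y z) \<otimes>\<^bsub>A\<^esub> F x (y \<otimes>\<^bsub>K\<^esub> z)"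
    by (simp add: \<phi>_mult A.m_ac)
  finally show ?thesis by (simp add: G_mult K.m_assoc)
qed

lemma G_one_mult [simp]: "g \<in> carrier G \<Longrightarrow> \<one>\<^bsub>G\<^esub> \<otimes>\<^bsub>G\<^esub> g = g" "g \<in> carrier G \<Longrightarrow> g \<otimes>\<^bsub>G\<^esub> \<one>\<^bsub>G\<^esub> = g"
  by (cases g; simp add: G_mult G_one carrier_G \<phi>_one_left \<phi>_one_right)+

lemma snd_G_mult: "snd (g \<otimes>\<^bsub>G\<^esub> h) = snd g \<otimes>\<^bsub>K\<^esub> snd h"
  by (cases g; cases h) (simp add: G_mult)

lemma snd_G_one: "snd \<one>\<^bsub>G\<^esub> = \<one>\<^bsub>K\<^esub>"
  by (simp add: G_one)

lemma right_act_closed [simp]: "x \<in> carrier K \<Longrightarrow> g \<in> carrier G \<Longrightarrow> right_act K x g \<in> carrier K"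
  by (simp add: right_act_def)

lemma right_act_mult:
  "x \<in> carrier K \<Longrightarrow> g \<in> carrier G \<Longrightarrow> h \<in> carrier G \<Longrightarrow> right_act K x (g \<otimes>\<^bsub>G\<^esub> h) = right_act K (right_act K x g) h"
  by (simp add: right_act_def snd_G_mult K.m_assoc)

lemma right_act_one [simp]: "x \<in> carrier K \<Longrightarrow> right_act K x \<one>\<^bsub>G\<^esub> = x"
  by (simp add: right_act_def snd_G_one)

lemma right_act_translate:
  "k \<in> carrier K \<Longrightarrow> x \<in> carrier K \<Longrightarrow> g \<in> carrier G \<Longrightarrow> right_act K (k \<otimes>\<^bsub>K\<^esub> x) g = k \<otimes>\<^bsub>K\<^esub> right_act K x g"
  by (simp add: right_act_def K.m_assoc)

lemma \<mu>_nonzero: "x \<in> carrier K \<Longrightarrow> g \<in> carrier G \<Longrightarrow> h \<in> carrier G \<Longrightarrow> \<mu> x [g, h] \<noteq> 0"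
  using \<mu> by (auto simp: map_cochains_def tuples_def)

lemma \<mu>_one:
  "x \<in> carrier K \<Longrightarrow> g \<in> carrier G \<Longrightarrow> \<mu> x [\<one>\<^bsub>G\<^esub>, g] = 1"
  "x \<in> carrier K \<Longrightarrow> g \<in> carrier G \<Longrightarrow> \<mu> x [g, \<one>\<^bsub>G\<^esub>] = 1"
  using \<mu> by (auto simp: map_cochains_def tuples_def)

text \<open>
  The pentagon axiom of the module category, solved for \<open>\<omega>\<close>. As the left side does not depend
  on \<open>x\<close>, comparing two values of \<open>x\<close> eliminates \<open>\<omega>\<close>.
\<close>

lemma \<omega>_\<mu>:
  assumes "x \<in> carrier K" "g \<in> carrier G" "h \<in> carrier G" "k \<in> carrier G"
  shows "\<omega> [g, h, k] = \<mu> x [g \<otimes>\<^bsub>G\<^esub> h, k] * \<mu> x [g, h] / (\<mu> (right_act K x g) [h, k] * \<mu> x [g, h \<otimes>\<^bsub>G\<^esub> k])"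
proof -
  have "\<omega> [g, h, k] = delta_G K G (\<lambda>x gs. inverse (\<mu> x gs)) x [g, h, k]"
    using assms by (simp add: pentagon pullback_def)
  also have "\<dots> = \<mu> x [g \<otimes>\<^bsub>G\<^esub> h, k] * \<mu> x [g, h] / (\<mu> (right_act K x g) [h, k] * \<mu> x [g, h \<otimes>\<^bsub>G\<^esub> k])"
    using assms by (simp add: delta_G_def merge_def numeral_3_eq_3 atLeastLessThanSuc field_simps)
  finally show ?thesis .
qed

abbreviation act where "act X V \<equiv> [right_act K x g. x \<leftarrow> X, g \<leftarrow> V]"

abbreviation tens where "tens V W \<equiv> [g \<otimes>\<^bsub>G\<^esub> h. g \<leftarrow> V, h \<leftarrow> W]"

abbreviation mods where "mods T \<equiv> module_functor (V_cat G \<omega>) (M_cat K \<mu>) T"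

abbreviation iso where "iso \<equiv> is_iso (M_cat K \<mu>)"

lemma act_closed [simp]: "X \<in> lists (carrier K) \<Longrightarrow> V \<in> lists (carrier G) \<Longrightarrow> act X V \<in> lists (carrier K)"
  by (auto simp: in_lists_conv_set)

context
  fixes T :: "('k list, complex mat, ('a \<times> 'k) list) mod_fun"
  assumes T: "mods T"
begin

lemma fun_obj: "X \<in> lists (carrier K) \<Longrightarrow> fobj T X \<in> lists (carrier K)"
  using T by (simp add: module_functor_def linear_functor_def)

lemma fun_mor:
  "X \<in> lists (carrier K) \<Longrightarrow> Y \<in> lists (carrier K) \<Longrightarrow> f \<in> graded_hom X Y
     \<Longrightarrow> fmor T X Y f \<in> graded_hom (fobj T X) (fobj T Y)"
  using T by (simp add: module_functor_def linear_functor_def)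

lemma fun_id: "X \<in> lists (carrier K) \<Longrightarrow> fmor T X X (1\<^sub>m (length X)) = 1\<^sub>m (length (fobj T X))"
  using T by (simp add: module_functor_def linear_functor_def)

lemma fun_comp:
  "X \<in> lists (carrier K) \<Longrightarrow> Y \<in> lists (carrier K) \<Longrightarrow> Z \<in> lists (carrier K)
    \<Longrightarrow> f \<in> graded_hom X Y \<Longrightarrow> g \<in> graded_hom Y Z
    \<Longrightarrow> fmor T X Z (g * f) = fmor T Y Z g * fmor T X Y f"
  using T by (simp add: module_functor_def linear_functor_def)

lemma fun_add:
  "X \<in> lists (carrier K) \<Longrightarrow> Y \<in> lists (carrier K) \<Longrightarrow> f \<in> graded_hom X Y \<Longrightarrow> g \<in> graded_hom X Y
    \<Longrightarrow> fmor T X Y (f + g) = fmor T X Y f + fmor T X Y g"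
  using T by (simp add: module_functor_def linear_functor_def)

lemma fun_scale:
  "X \<in> lists (carrier K) \<Longrightarrow> Y \<in> lists (carrier K) \<Longrightarrow> f \<in> graded_hom X Y
    \<Longrightarrow> fmor T X Y (c \<cdot>\<^sub>m f) = c \<cdot>\<^sub>m fmor T X Y f"
  using T by (simp add: module_functor_def linear_functor_def)

lemma str_iso:
  "X \<in> lists (carrier K) \<Longrightarrow> V \<in> lists (carrier G) \<Longrightarrow> iso (fobj T (act X V)) (act (fobj T X) V) (fstr T X V)"
  using T by (simp add: module_functor_def)

lemma str_graded:
  "X \<in> lists (carrier K) \<Longrightarrow> V \<in> lists (carrier G) \<Longrightarrow> fstr T X V \<in> graded_hom (fobj T (act X V)) (act (fobj T X) V)"
  using str_iso by (simp add: is_iso_def)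

lemma str_natural:
  "X \<in> lists (carrier K) \<Longrightarrow> X' \<in> lists (carrier K) \<Longrightarrow> V \<in> lists (carrier G) \<Longrightarrow> V' \<in> lists (carrier G)
    \<Longrightarrow> f \<in> graded_hom X X' \<Longrightarrow> u \<in> graded_hom V V'
    \<Longrightarrow> fstr T X' V' * fmor T (act X V) (act X' V') (kronecker f u) = kronecker (fmor T X X' f) u * fstr T X V"
  using T by (simp add: module_functor_def)

lemma str_pentagon:
  "X \<in> lists (carrier K) \<Longrightarrow> V \<in> lists (carrier G) \<Longrightarrow> W \<in> lists (carrier G)
    \<Longrightarrow> diagonal [\<mu> x [g, h]. x \<leftarrow> fobj T X, g \<leftarrow> V, h \<leftarrow> W] * fstr T X (tens V W)
      = kronecker (fstr T X V) (1\<^sub>m (length W)) * (fstr T (act X V) W *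
          fmor T (act X (tens V W)) (act (act X V) W) (diagonal [\<mu> x [g, h]. x \<leftarrow> X, g \<leftarrow> V, h \<leftarrow> W]))"
  using T by (simp add: module_functor_def)

text \<open>
  Since \<open>X \<otimes> [\<one>] = X\<close> strictly and the unit constraint is the identity, the unit axiom says that
  the module structure at the unit is trivial.
\<close>

lemma str_unit:
  assumes X: "X \<in> lists (carrier K)"
  shows "fstr T X [\<one>\<^bsub>G\<^esub>] = 1\<^sub>m (length (fobj T X))"
proof -
  have *: "[right_act K x \<one>\<^bsub>G\<^esub>. x \<leftarrow> X] = X" if "X \<in> lists (carrier K)" for X
    using that by (induction X) auto
  have "fstr T X [\<one>\<^bsub>G\<^esub>] \<in> graded_hom (fobj T X) (fobj T X)"
    using str_graded[OF X, of "[\<one>\<^bsub>G\<^esub>]"] fun_obj[OF X] X by (simp add: *)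
  moreover have "1\<^sub>m (length (fobj T X)) * fstr T X [\<one>\<^bsub>G\<^esub>] = fmor T X X (1\<^sub>m (length X))"
    using T X by (simp add: module_functor_def *)
  ultimately show ?thesis using X by (auto simp: fun_id dest: graded_homD)
qed

lemma fun_mat_sum:
  assumes X: "X \<in> lists (carrier K)" and Y: "Y \<in> lists (carrier K)" and "finite I"
    and f: "\<And>a. a \<in> I \<Longrightarrow> f a \<in> graded_hom X Y"
  shows "fmor T X Y (mat_sum (length Y) (length X) I f)
    = mat_sum (length (fobj T Y)) (length (fobj T X)) I (\<lambda>a. fmor T X Y (f a))"
  using \<open>finite I\<close> f
proof (induction I)
  case empty
  have "fmor T X Y (0 \<cdot>\<^sub>m 0\<^sub>m (length Y) (length X)) = 0 \<cdot>\<^sub>m fmor T X Y (0\<^sub>m (length Y) (length X))"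
    using X Y by (intro fun_scale) auto
  moreover have "fmor T X Y (0\<^sub>m (length Y) (length X)) \<in> graded_hom (fobj T X) (fobj T Y)"
    using X Y by (intro fun_mor) auto
  moreover have "0 \<cdot>\<^sub>m 0\<^sub>m (length Y) (length X) = (0\<^sub>m (length Y) (length X) :: complex mat)" by auto
  ultimately have "fmor T X Y (0\<^sub>m (length Y) (length X)) = 0 \<cdot>\<^sub>m fmor T X Y (0\<^sub>m (length Y) (length X))"
    and c: "fmor T X Y (0\<^sub>m (length Y) (length X)) \<in> carrier_mat (length (fobj T Y)) (length (fobj T X))"
    by (auto dest: graded_homD)
  moreover have "0 \<cdot>\<^sub>m fmor T X Y (0\<^sub>m (length Y) (length X)) = 0\<^sub>m (length (fobj T Y)) (length (fobj T X))"
    using c by auto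
  ultimately show ?case by simp
next
  case (insert a I)
  have "fmor T X Y (f a) \<in> graded_hom (fobj T X) (fobj T Y)" using insert X Y by (intro fun_mor) auto
  then show ?case
    using insert X Y
    by (simp add: mat_sum_insert fun_add mat_sum_graded graded_homD)
qed

lemma fun_zero:
  assumes X: "X \<in> lists (carrier K)" and Y: "Y \<in> lists (carrier K)"
  shows "fmor T X Y (0\<^sub>m (length Y) (length X)) = 0\<^sub>m (length (fobj T Y)) (length (fobj T X))"
  using fun_mat_sum[OF X Y, of "{}"] by simp

lemma fun_incl:
  "X \<in> lists (carrier K) \<Longrightarrow> i < length X
     \<Longrightarrow> fmor T [X ! i] X (incl (length X) i) \<in> graded_hom (fobj T [X ! i]) (fobj T X)"
  by (intro fun_mor incl_graded) auto

lemma fun_proj: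
  "X \<in> lists (carrier K) \<Longrightarrow> i < length X
     \<Longrightarrow> fmor T X [X ! i] (proj (length X) i) \<in> graded_hom (fobj T X) (fobj T [X ! i])"
  by (intro fun_mor proj_graded) auto

lemma fun_proj_incl:
  assumes "X \<in> lists (carrier K)" "i < length X"
  shows "fmor T X [X ! i] (proj (length X) i) * fmor T [X ! i] X (incl (length X) i) = 1\<^sub>m (length (fobj T [X ! i]))"
  using assms fun_id[of "[X ! i]"] 
  by (subst fun_comp[symmetric]) (auto simp: proj_incl incl_graded proj_graded)

lemma fun_sum_incl_proj:
  assumes X: "X \<in> lists (carrier K)"
  shows "mat_sum (length (fobj T X)) (length (fobj T X)) {..<length X}
     (\<lambda>i. fmor T [X ! i] X (incl (length X) i) * fmor T X [X ! i] (proj (length X) i)) = 1\<^sub>m (length (fobj T X))"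
proof -
  have "mat_sum (length (fobj T X)) (length (fobj T X)) {..<length X}
     (\<lambda>i. fmor T [X ! i] X (incl (length X) i) * fmor T X [X ! i] (proj (length X) i))
    = mat_sum (length (fobj T X)) (length (fobj T X)) {..<length X} (\<lambda>i. fmor T X X (incl (length X) i * proj (length X) i))"
    by (intro mat_sum_cong fun_comp[symmetric]) (use X in \<open>auto intro: incl_graded proj_graded\<close>)
  also have "\<dots> = fmor T X X (mat_sum (length X) (length X) {..<length X} (\<lambda>i. incl (length X) i * proj (length X) i))"
    by (rule fun_mat_sum[symmetric]) (use X in \<open>auto intro: incl_graded proj_graded\<close>)
  finally show ?thesis using X by (simp add: sum_incl_proj fun_id)
qed

text \<open>The trace counts summands, and it is cyclic: \<open>T\<close> sends \<open>id\<^sub>X = \<Sum>\<^sub>i incl i \<circ> proj i\<close> to the identity of \<open>T X\<close>.\<close>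

lemma fun_length:
  assumes X: "X \<in> lists (carrier K)"
  shows "length (fobj T X) = (\<Sum>i<length X. length (fobj T [X ! i]))"
proof -
  have "of_nat (length (fobj T X)) = trace (mat_sum (length (fobj T X)) (length (fobj T X)) {..<length X}
     (\<lambda>i. fmor T [X ! i] X (incl (length X) i) * fmor T X [X ! i] (proj (length X) i)))"
    by (simp only: fun_sum_incl_proj[OF X] trace_one)
  also have "\<dots> = (\<Sum>i<length X. trace (fmor T [X ! i] X (incl (length X) i) * fmor T X [X ! i] (proj (length X) i)))"
    by (rule trace_mat_sum) (use fun_incl[OF X, THEN graded_homD] fun_proj[OF X, THEN graded_homD] in \<open>auto intro: mult_carrier_mat\<close>)
  also have "\<dots> = (\<Sum>i<length X. trace (fmor T X [X ! i] (proj (length X) i) * fmor T [X ! i] X (incl (length X) i)))"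
    by (intro sum.cong refl, rule trace_mult_commute[OF fun_incl[OF X, THEN graded_homD] fun_proj[OF X, THEN graded_homD]]) auto
  also have "\<dots> = of_nat (\<Sum>i<length X. length (fobj T [X ! i]))"
    using X by (simp add: fun_proj_incl)
  finally show ?thesis by (simp only: of_nat_eq_iff)
qed

text \<open>
  The images of the inclusions of the summands are jointly epic, since \<open>T\<close> preserves the
  biproduct decomposition.
\<close>

lemma eq_on_summands:
  assumes X: "X \<in> lists (carrier K)"
    and a: "a \<in> carrier_mat m (length (fobj T X))" and b: "b \<in> carrier_mat m (length (fobj T X))"
    and eq: "\<And>i. i < length X \<Longrightarrow>
      a * fmor T [X ! i] X (incl (length X) i) = b * fmor T [X ! i] X (incl (length X) i)"
  shows "a = b"
proof -
  let ?n = "length (fobj T X)"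
  let ?i = "\<lambda>i. fmor T [X ! i] X (incl (length X) i)" and ?p = "\<lambda>i. fmor T X [X ! i] (proj (length X) i)"
  note c = fun_incl[OF X, THEN graded_homD] fun_proj[OF X, THEN graded_homD]
  have "c = mat_sum m ?n {..<length X} (\<lambda>i. (c * ?i i) * ?p i)" if "c \<in> carrier_mat m ?n" for c
  proof -
    have "c = c * mat_sum ?n ?n {..<length X} (\<lambda>i. ?i i * ?p i)"
      using that by (simp add: fun_sum_incl_proj[OF X])
    also have "\<dots> = mat_sum m ?n {..<length X} (\<lambda>i. c * (?i i * ?p i))"
      by (rule mult_mat_sum[OF that]) (use c in \<open>auto intro: mult_carrier_mat\<close>)
    also have "\<dots> = mat_sum m ?n {..<length X} (\<lambda>i. (c * ?i i) * ?p i)"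
      by (intro mat_sum_cong assoc_mult_mat[symmetric]) (use c that in auto)
    finally show ?thesis .
  qed
  note ab = this[OF a] this[OF b]
  show ?thesis by (subst ab(1), subst ab(2), rule mat_sum_cong) (simp add: eq)
qed

end

end

lemma graded_assoc:
  "f \<in> graded_hom Y Z \<Longrightarrow> g \<in> graded_hom X Y \<Longrightarrow> h \<in> graded_hom W X \<Longrightarrow> (f * g) * h = f * (g * h)"
  by (rule assoc_mult_mat[OF graded_homD graded_homD graded_homD])

lemma mat_sum_single:
  assumes "finite I" "a \<in> I" "f a \<in> carrier_mat m n" "\<And>b. b \<in> I \<Longrightarrow> b \<noteq> a \<Longrightarrow> f b = 0\<^sub>m m n"
  shows "mat_sum m n I f = f a"
proof (rule eq_matI)
  fix i j assume ij: "i < dim_row (f a)" "j < dim_col (f a)"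
  have "(\<Sum>b\<in>I. f b $$ (i, j)) = (\<Sum>b\<in>I. if b = a then f a $$ (i, j) else 0)"
    using assms ij by (intro sum.cong) auto
  then show "mat_sum m n I f $$ (i, j) = f a $$ (i, j)"
    using assms ij by (simp add: mat_sum_def)
qed (use assms in \<open>auto simp: mat_sum_def\<close>)

lemma proj_incl_neq: "i < n \<Longrightarrow> j < n \<Longrightarrow> i \<noteq> j \<Longrightarrow> proj n j * incl n i = 0\<^sub>m 1 1"
  by (subst proj_mult[of _ _ 1]) (auto simp: incl_def)

lemma graded_hom_single:
  assumes "s \<in> graded_hom [x] [y]"
  shows "s = s $$ (0, 0) \<cdot>\<^sub>m 1\<^sub>m (Suc 0)" "x \<noteq> y \<Longrightarrow> s = 0\<^sub>m (Suc 0) (Suc 0)"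
  using assms by (auto simp: graded_hom_def)

context extension_data begin

section \<open>Natural transformations are determined on simple objects\<close>

text \<open>
  Naturality for the underlying functors, without extensionality and without compatibility with
  the module structures; these two conditions are added in \<open>module_nat_from_simple\<close>.
\<close>

definition natural where
  "natural S T \<nu> \<longleftrightarrow>
     (\<forall>X\<in>lists (carrier K). \<nu> X \<in> graded_hom (fobj S X) (fobj T X)) \<and>
     (\<forall>X\<in>lists (carrier K). \<forall>Y\<in>lists (carrier K). \<forall>f\<in>graded_hom X Y.
        \<nu> Y * fmor S X Y f = fmor T X Y f * \<nu> X)"

text \<open>
  The only candidate for a natural transformation with components \<open>\<nu> x\<close> at the simple objects
  \<open>[x]\<close>.
\<close>

definition extend_simple where
  "extend_simple S T \<nu> X = mat_sum (length (fobj T X)) (length (fobj S X)) {..<length X}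
     (\<lambda>i. fmor T [X ! i] X (incl (length X) i) * (\<nu> (X ! i) * fmor S X [X ! i] (proj (length X) i)))"

context
  fixes S T :: "('k list, complex mat, ('a \<times> 'k) list) mod_fun"
  assumes S: "mods S" and T: "mods T"
begin

context
  fixes \<nu> assumes \<nu>: "\<And>x. x \<in> carrier K \<Longrightarrow> \<nu> x \<in> graded_hom (fobj S [x]) (fobj T [x])"
begin

lemma extend_simple_graded:
  assumes X: "X \<in> lists (carrier K)"
  shows "extend_simple S T \<nu> X \<in> graded_hom (fobj S X) (fobj T X)"
  unfolding extend_simple_def
  by (intro mat_sum_graded graded_hom_mult[OF fun_incl[OF T]] graded_hom_mult[OF \<nu> fun_proj[OF S]]) (use X in auto)

lemma extend_simple_incl:
  assumes X: "X \<in> lists (carrier K)" and i: "i < length X"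
  shows "extend_simple S T \<nu> X * fmor S [X ! i] X (incl (length X) i)
    = fmor T [X ! i] X (incl (length X) i) * \<nu> (X ! i)"
proof -
  let ?n = "length X"
  let ?s = "\<lambda>i. fmor S [X ! i] X (incl ?n i)" and ?p = "\<lambda>i. fmor S X [X ! i] (proj ?n i)"
  let ?t = "\<lambda>i. fmor T [X ! i] X (incl ?n i)"
  let ?m = "length (fobj T X)" and ?l = "length (fobj S [X ! i])"
  have \<nu>': "j < ?n \<Longrightarrow> \<nu> (X ! j) \<in> graded_hom (fobj S [X ! j]) (fobj T [X ! j])" for j using \<nu> X by auto
  note c = fun_incl[OF S X] fun_proj[OF S X] fun_incl[OF T X] \<nu>'
  have ps: "?p j * ?s i = (if i = j then 1\<^sub>m ?l else 0\<^sub>m (length (fobj S [X ! j])) ?l)" if j: "j < ?n" for j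
  proof (cases "i = j")
    case True then show ?thesis using fun_proj_incl[OF S X i] by simp
  next
    case False
    have "?p j * ?s i = fmor S [X ! i] [X ! j] (proj ?n j * incl ?n i)"
      using X i j by (intro fun_comp[OF S, symmetric]) (auto intro: incl_graded proj_graded)
    also have "\<dots> = fmor S [X ! i] [X ! j] (0\<^sub>m (length [X ! j]) (length [X ! i]))"
      using False i j by (simp add: proj_incl_neq)
    finally show ?thesis using False fun_zero[OF S, of "[X ! i]" "[X ! j]"] X i j by simp
  qed
  have "extend_simple S T \<nu> X * ?s i = mat_sum ?m ?l {..<?n} (\<lambda>j. ?t j * (\<nu> (X ! j) * ?p j) * ?s i)"
    unfolding extend_simple_def
    by (rule mat_sum_mult[OF graded_homD[OF c(1)[OF i]]])
      (auto intro!: graded_homD graded_hom_mult[OF c(3)] graded_hom_mult[OF c(4) c(2)])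
  also have "\<dots> = mat_sum ?m ?l {..<?n} (\<lambda>j. ?t j * (\<nu> (X ! j) * (?p j * ?s i)))"
    by (intro mat_sum_cong)
      (simp add: graded_assoc[OF c(3) graded_hom_mult[OF c(4) c(2)] c(1)[OF i]] graded_assoc[OF c(4) c(2) c(1)[OF i]])
  also have "\<dots> = ?t i * (\<nu> (X ! i) * (?p i * ?s i))"
  proof (rule mat_sum_single)
    show "?t i * (\<nu> (X ! i) * (?p i * ?s i)) \<in> carrier_mat ?m ?l"
      by (rule graded_homD[OF graded_hom_mult[OF c(3)[OF i] graded_hom_mult[OF c(4)[OF i] graded_hom_mult[OF c(2)[OF i] c(1)[OF i]]]]])
    show "?t j * (\<nu> (X ! j) * (?p j * ?s i)) = 0\<^sub>m ?m ?l" if "j \<in> {..<?n}" "j \<noteq> i" for j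
      using that ps[of j] c(3,4)[THEN graded_homD, of j] by simp
  qed (use i in auto)
  also have "\<dots> = ?t i * \<nu> (X ! i)"
    using ps[OF i] c(4)[THEN graded_homD, OF i] by simp
  finally show ?thesis .
qed

text \<open>
  A morphism \<open>f : X \<rightarrow> Y\<close> has scalar components between the simple summands of \<open>X\<close> and \<open>Y\<close>, and
  scalars commute with everything; hence a family on simple objects needs no compatibility
  condition to extend to a natural transformation.
\<close>

lemma extend_simple_natural: "natural S T (extend_simple S T \<nu>)"
  unfolding natural_def
proof (intro conjI ballI)
  fix X Y f assume X: "X \<in> lists (carrier K)" and Y: "Y \<in> lists (carrier K)" and f: "f \<in> graded_hom X Y"
  let ?E = "extend_simple S T \<nu>"
  let ?n = "length X" and ?m = "length Y"
  note E = extend_simple_graded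
  show "?E Y * fmor S X Y f = fmor T X Y f * ?E X"
  proof (rule eq_on_summands[OF S X])
    show "?E Y * fmor S X Y f \<in> carrier_mat (length (fobj T Y)) (length (fobj S X))"
      by (rule graded_homD[OF graded_hom_mult[OF E[OF Y] fun_mor[OF S X Y f]]])
    show "fmor T X Y f * ?E X \<in> carrier_mat (length (fobj T Y)) (length (fobj S X))"
      by (rule graded_homD[OF graded_hom_mult[OF fun_mor[OF T X Y f] E[OF X]]])
    fix i assume i: "i < ?n"
    let ?x = "X ! i" and ?s = "\<lambda>j. proj ?m j * (f * incl ?n i)"
    have x: "[?x] \<in> lists (carrier K)" and y: "\<And>j. j < ?m \<Longrightarrow> [Y ! j] \<in> lists (carrier K)" using X Y i by auto
    have fi: "f * incl ?n i \<in> graded_hom [?x] Y" using f i by (auto intro: incl_graded)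
    have s: "?s j \<in> graded_hom [?x] [Y ! j]" if "j < ?m" for j
      using that fi by (auto intro: proj_graded)
    have \<nu>x: "\<nu> ?x \<in> graded_hom (fobj S [?x]) (fobj T [?x])" using \<nu> x by auto
    have \<nu>y: "\<nu> (Y ! j) \<in> graded_hom (fobj S [Y ! j]) (fobj T [Y ! j])" if "j < ?m" for j using \<nu> y[OF that] by auto
    \<comment> \<open>A morphism between simple objects is a scalar, and vanishes unless they agree.\<close>
    have \<nu>s: "fmor T [?x] [Y ! j] (?s j) * \<nu> ?x = \<nu> (Y ! j) * fmor S [?x] [Y ! j] (?s j)" if j: "j < ?m" for j
    proof (cases "?x = Y ! j")
      case True
      let ?c = "?s j $$ (0, 0)"
      have "?s j = ?c \<cdot>\<^sub>m 1\<^sub>m (length [?x])" using graded_hom_single(1)[OF s[OF j]] by simp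
      moreover have "fmor U [?x] [?x] (?c \<cdot>\<^sub>m 1\<^sub>m (length [?x])) = ?c \<cdot>\<^sub>m 1\<^sub>m (length (fobj U [?x]))" if "mods U" for U
        using fun_scale[OF that x x graded_hom_one, of ?c] fun_id[OF that x] by simp
      ultimately have "fmor T [?x] [Y ! j] (?s j) = ?c \<cdot>\<^sub>m 1\<^sub>m (length (fobj T [?x]))"
        "fmor S [?x] [Y ! j] (?s j) = ?c \<cdot>\<^sub>m 1\<^sub>m (length (fobj S [?x]))"
        using S T True by (metis, metis)
      moreover have "(?c \<cdot>\<^sub>m 1\<^sub>m (length (fobj T [?x]))) * \<nu> ?x = \<nu> ?x * (?c \<cdot>\<^sub>m 1\<^sub>m (length (fobj S [?x])))"
        by (simp add: mult_smult_assoc_mat[OF one_carrier_mat \<nu>x[THEN graded_homD]]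
            mult_smult_distrib[OF \<nu>x[THEN graded_homD] one_carrier_mat] \<nu>x[THEN graded_homD]
            left_mult_one_mat[OF \<nu>x[THEN graded_homD]] right_mult_one_mat[OF \<nu>x[THEN graded_homD]])
      ultimately show ?thesis using True by simp
    next
      case False
      have "?s j = 0\<^sub>m (length [Y ! j]) (length [?x])" using graded_hom_single(2)[OF s[OF j]] False by simp
      then have "fmor T [?x] [Y ! j] (?s j) = 0\<^sub>m (length (fobj T [Y ! j])) (length (fobj T [?x]))"
        "fmor S [?x] [Y ! j] (?s j) = 0\<^sub>m (length (fobj S [Y ! j])) (length (fobj S [?x]))"
        using fun_zero[OF T x y[OF j]] fun_zero[OF S x y[OF j]] by simp_all
      then show ?thesis using \<nu>x[THEN graded_homD] \<nu>y[OF j, THEN graded_homD] by simp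
    qed
    have decomp: "f * incl ?n i = mat_sum ?m (length [?x]) {..<?m} (\<lambda>j. incl ?m j * ?s j)"
    proof -
      have "f * incl ?n i = mat_sum ?m ?m {..<?m} (\<lambda>j. incl ?m j * proj ?m j) * (f * incl ?n i)"
        by (simp only: sum_incl_proj left_mult_one_mat[OF fi[THEN graded_homD]])
      also have "\<dots> = mat_sum ?m (length [?x]) {..<?m} (\<lambda>j. incl ?m j * proj ?m j * (f * incl ?n i))"
        by (rule mat_sum_mult[OF fi[THEN graded_homD]]) (rule mult_carrier_mat[OF incl_carrier proj_carrier])
      also have "\<dots> = mat_sum ?m (length [?x]) {..<?m} (\<lambda>j. incl ?m j * ?s j)"
        by (intro mat_sum_cong assoc_mult_mat[OF incl_carrier proj_carrier fi[THEN graded_homD]])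
      finally show ?thesis .
    qed
    have isj: "incl ?m j * ?s j \<in> graded_hom [?x] Y" if "j < ?m" for j using incl_graded[OF that] s[OF that] by auto
    have U: "fmor U [?x] Y (f * incl ?n i) = mat_sum (length (fobj U Y)) (length (fobj U [?x])) {..<?m}
      (\<lambda>j. fmor U [Y ! j] Y (incl ?m j) * fmor U [?x] [Y ! j] (?s j))" if U: "mods U" for U
    proof -
      have "fmor U [?x] Y (f * incl ?n i) = mat_sum (length (fobj U Y)) (length (fobj U [?x])) {..<?m}
        (\<lambda>j. fmor U [?x] Y (incl ?m j * ?s j))"
        by (subst decomp, rule fun_mat_sum[OF U x Y]) (use isj in auto)
      then show ?thesis
        using fun_comp[OF U x y Y s incl_graded]
        by (simp only:) (rule mat_sum_cong, simp)
    qed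
    have Usc: "fmor U [?x] [Y ! j] (?s j) \<in> graded_hom (fobj U [?x]) (fobj U [Y ! j])" if "mods U" "j < ?m" for U j
      by (rule fun_mor[OF that(1) x y[OF that(2)] s[OF that(2)]])
    have "?E Y * fmor S X Y f * fmor S [?x] X (incl ?n i) = ?E Y * fmor S [?x] Y (f * incl ?n i)"
      by (simp add: graded_assoc[OF E[OF Y] fun_mor[OF S X Y f] fun_incl[OF S X i]]
          fun_comp[OF S x X Y incl_graded[OF i] f])
    also have "\<dots> = mat_sum (length (fobj T Y)) (length (fobj S [?x])) {..<?m}
        (\<lambda>j. ?E Y * (fmor S [Y ! j] Y (incl ?m j) * fmor S [?x] [Y ! j] (?s j)))"
      unfolding U[OF S]
      by (rule mult_mat_sum[OF E[OF Y, THEN graded_homD]])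
        (auto intro!: graded_homD graded_hom_mult[OF fun_incl[OF S Y] Usc[OF S]])
    also have "\<dots> = mat_sum (length (fobj T Y)) (length (fobj S [?x])) {..<?m}
        (\<lambda>j. fmor T [Y ! j] Y (incl ?m j) * fmor T [?x] [Y ! j] (?s j) * \<nu> ?x)"
    proof (rule mat_sum_cong)
      fix j assume "j \<in> {..<?m}"
      then have j: "j < ?m" by simp
      have "?E Y * (fmor S [Y ! j] Y (incl ?m j) * fmor S [?x] [Y ! j] (?s j))
        = (?E Y * fmor S [Y ! j] Y (incl ?m j)) * fmor S [?x] [Y ! j] (?s j)"
        by (rule graded_assoc[OF E[OF Y] fun_incl[OF S Y j] Usc[OF S j], symmetric])
      also have "\<dots> = fmor T [Y ! j] Y (incl ?m j) * (\<nu> (Y ! j) * fmor S [?x] [Y ! j] (?s j))"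
        by (simp only: extend_simple_incl[OF Y j] graded_assoc[OF fun_incl[OF T Y j] \<nu>y[OF j] Usc[OF S j]])
      also have "\<dots> = fmor T [Y ! j] Y (incl ?m j) * fmor T [?x] [Y ! j] (?s j) * \<nu> ?x"
        by (simp only: \<nu>s[OF j, symmetric] graded_assoc[OF fun_incl[OF T Y j] Usc[OF T j] \<nu>x])
      finally show "?E Y * (fmor S [Y ! j] Y (incl ?m j) * fmor S [?x] [Y ! j] (?s j))
        = fmor T [Y ! j] Y (incl ?m j) * fmor T [?x] [Y ! j] (?s j) * \<nu> ?x" .
    qed
    also have "\<dots> = fmor T [?x] Y (f * incl ?n i) * \<nu> ?x"
      unfolding U[OF T]
      by (rule mat_sum_mult[OF \<nu>x[THEN graded_homD], symmetric])
        (auto intro!: graded_homD graded_hom_mult[OF fun_incl[OF T Y] Usc[OF T]])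
    also have "\<dots> = fmor T X Y f * ?E X * fmor S [?x] X (incl ?n i)"
      by (simp only: fun_comp[OF T x X Y incl_graded[OF i] f] extend_simple_incl[OF X i]
          graded_assoc[OF fun_mor[OF T X Y f] E[OF X] fun_incl[OF S X i]]
          graded_assoc[OF fun_mor[OF T X Y f] fun_incl[OF T X i] \<nu>x])
    finally show "?E Y * fmor S X Y f * fmor S [?x] X (incl ?n i) = fmor T X Y f * ?E X * fmor S [?x] X (incl ?n i)" .
  qed
qed (rule extend_simple_graded)

lemma extend_simple_single:
  assumes "x \<in> carrier K"
  shows "extend_simple S T \<nu> [x] = \<nu> x"
proof -
  have x: "[x] \<in> lists (carrier K)" using assms by simp
  have i: "incl (length [x]) 0 = 1\<^sub>m (length [x])" by (auto simp: incl_def)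
  have "extend_simple S T \<nu> [x] * fmor S [x] [x] (incl (length [x]) 0) = fmor T [x] [x] (incl (length [x]) 0) * \<nu> x"
    using extend_simple_incl[OF x, of 0] by simp
  then show ?thesis
    by (simp only: i fun_id[OF S x] fun_id[OF T x] left_mult_one_mat[OF \<nu>[OF assms, THEN graded_homD]]
        right_mult_one_mat[OF extend_simple_graded[OF x, THEN graded_homD]])
qed

end

end

lemma natural_graded: "natural S T \<nu> \<Longrightarrow> X \<in> lists (carrier K) \<Longrightarrow> \<nu> X \<in> graded_hom (fobj S X) (fobj T X)"
  by (simp add: natural_def)

lemma naturalD:
  "natural S T \<nu> \<Longrightarrow> X \<in> lists (carrier K) \<Longrightarrow> Y \<in> lists (carrier K) \<Longrightarrow> f \<in> graded_hom X Y
    \<Longrightarrow> \<nu> Y * fmor S X Y f = fmor T X Y f * \<nu> X"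
  by (simp add: natural_def)

text \<open>
  The inverses on simple objects extend to all objects, and the extension is inverse to
  \<open>\<nu>\<close> because it is so on each summand.
\<close>

lemma natural_iso_from_simple:
  assumes S: "mods S" and T: "mods T"
    and \<nu>: "natural S T \<nu>" and iso: "\<And>x. x \<in> carrier K \<Longrightarrow> iso (fobj S [x]) (fobj T [x]) (\<nu> [x])"
    and X: "X \<in> lists (carrier K)"
  shows "iso (fobj S X) (fobj T X) (\<nu> X)"
proof -
  have "\<exists>g. g \<in> graded_hom (fobj T [x]) (fobj S [x]) \<and> g * \<nu> [x] = 1\<^sub>m (length (fobj S [x]))
     \<and> \<nu> [x] * g = 1\<^sub>m (length (fobj T [x]))" if "x \<in> carrier K" for x
    using iso[OF that] by (auto simp: is_iso_M_cat)
  then obtain \<rho> where \<rho>: "\<And>x. x \<in> carrier K \<Longrightarrow> \<rho> x \<in> graded_hom (fobj T [x]) (fobj S [x])"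
    and inv: "\<And>x. x \<in> carrier K \<Longrightarrow> \<rho> x * \<nu> [x] = 1\<^sub>m (length (fobj S [x]))"
      "\<And>x. x \<in> carrier K \<Longrightarrow> \<nu> [x] * \<rho> x = 1\<^sub>m (length (fobj T [x]))"
    by metis
  let ?R = "extend_simple T S \<rho> X"
  have R: "?R \<in> graded_hom (fobj T X) (fobj S X)" by (rule extend_simple_graded[OF T S \<rho> X])
  have N: "\<nu> X \<in> graded_hom (fobj S X) (fobj T X)" using \<nu> X by (simp add: natural_def)
  have "?R * \<nu> X = 1\<^sub>m (length (fobj S X))"
  proof (rule eq_on_summands[OF S X])
    fix i assume i: "i < length X"
    let ?x = "X ! i" and ?s = "fmor S [X ! i] X (incl (length X) i)" and ?t = "fmor T [X ! i] X (incl (length X) i)"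
    have x: "?x \<in> carrier K" "[?x] \<in> lists (carrier K)" using X i by auto
    have n: "\<nu> [?x] \<in> graded_hom (fobj S [?x]) (fobj T [?x])" using \<nu> x by (simp add: natural_def)
    note s = fun_incl[OF S X i] and t = fun_incl[OF T X i]
    have "?R * \<nu> X * ?s = ?R * (?t * \<nu> [?x])"
      using naturalD[OF \<nu> x(2) X incl_graded[OF i]] by (simp add: graded_assoc[OF R N s])
    also have "\<dots> = ?s * \<rho> ?x * \<nu> [?x]"
      by (simp only: graded_assoc[OF R t n, symmetric] extend_simple_incl[OF T S \<rho> X i])
    also have "\<dots> = 1\<^sub>m (length (fobj S X)) * ?s"
      using s[THEN graded_homD] by (simp add: graded_assoc[OF s \<rho>[OF x(1)] n] inv(1)[OF x(1)])
    finally show "?R * \<nu> X * ?s = 1\<^sub>m (length (fobj S X)) * ?s" .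
  qed (use R N in \<open>auto dest!: graded_homD\<close>)
  moreover have "\<nu> X * ?R = 1\<^sub>m (length (fobj T X))"
  proof (rule eq_on_summands[OF T X])
    fix i assume i: "i < length X"
    let ?x = "X ! i" and ?s = "fmor S [X ! i] X (incl (length X) i)" and ?t = "fmor T [X ! i] X (incl (length X) i)"
    have x: "?x \<in> carrier K" "[?x] \<in> lists (carrier K)" using X i by auto
    have n: "\<nu> [?x] \<in> graded_hom (fobj S [?x]) (fobj T [?x])" using \<nu> x by (simp add: natural_def)
    note s = fun_incl[OF S X i] and t = fun_incl[OF T X i]
    have "\<nu> X * ?R * ?t = \<nu> X * (?s * \<rho> ?x)"
      by (simp only: graded_assoc[OF N R t] extend_simple_incl[OF T S \<rho> X i])
    also have "\<dots> = ?t * \<nu> [?x] * \<rho> ?x"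
      using naturalD[OF \<nu> x(2) X incl_graded[OF i]] by (simp only: graded_assoc[OF N s \<rho>[OF x(1)], symmetric])
    also have "\<dots> = 1\<^sub>m (length (fobj T X)) * ?t"
      using t[THEN graded_homD] by (simp add: graded_assoc[OF t n \<rho>[OF x(1)]] inv(2)[OF x(1)])
    finally show "\<nu> X * ?R * ?t = 1\<^sub>m (length (fobj T X)) * ?t" .
  qed (use R N in \<open>auto dest!: graded_homD\<close>)
  ultimately show ?thesis using R N by (auto simp: is_iso_M_cat)
qed

text \<open>
  Both sides of the module compatibility are natural in the module category object and in the
  acting object, so it can be checked on the summands \<open>x\<^sub>i \<triangleleft> g\<^sub>j\<close> of \<open>X \<otimes> V\<close>.
\<close>

lemma module_nat_from_simple:
  assumes S: "mods S" and T: "mods T" and \<nu>: "natural S T \<nu>"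
    and simple: "\<And>x g. x \<in> carrier K \<Longrightarrow> g \<in> carrier G
      \<Longrightarrow> fstr T [x] [g] * \<nu> [right_act K x g] = \<nu> [x] * fstr S [x] [g]"
  shows "restrict \<nu> (lists (carrier K)) \<in> module_nat (V_cat G \<omega>) (M_cat K \<mu>) S T"
proof -
  have compat: "fstr T X V * \<nu> (act X V) = kronecker (\<nu> X) (1\<^sub>m (length V)) * fstr S X V"
    if X: "X \<in> lists (carrier K)" and V: "V \<in> lists (carrier G)" for X V
  proof -
    note XV = act_closed[OF X V]
    note strS = str_graded[OF S X V] and strT = str_graded[OF T X V]
    note N = natural_graded[OF \<nu> X] and NV = natural_graded[OF \<nu> XV]
    have K: "kronecker (\<nu> X) (1\<^sub>m (length V)) \<in> graded_hom (act (fobj S X) V) (act (fobj T X) V)"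
      by (rule kronecker_graded[OF N graded_hom_one])
    show ?thesis
    proof (rule eq_on_summands[OF S XV])
      fix p assume "p < length (act X V)"
      then obtain i j where i: "i < length X" and j: "j < length V" and p: "p = i * length V + j"
        by (auto elim: block_index_cases)
      define x where "x = X ! i"
      define g where "g = V ! j"
      have x: "x \<in> carrier K" "[x] \<in> lists (carrier K)" using X i by (auto simp: x_def)
      have g: "g \<in> carrier G" "[g] \<in> lists (carrier G)" using V j by (auto simp: g_def)
      have xg: "act X V ! p = right_act K x g" using i j by (simp add: p nth_list_product x_def g_def)
      have xgc: "[right_act K x g] \<in> lists (carrier K)" using x g by simp
      have p_less: "p < length (act X V)" using i j by (simp add: p block_index_less)
      have incl: "incl (length (act X V)) p = kronecker (incl (length X) i) (incl (length V) j)"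
        using i j by (simp add: kronecker_incl p)
      let ?ki = "\<lambda>U. fmor U [x] X (incl (length X) i)"
      let ?k = "\<lambda>U. kronecker (?ki U) (incl (length V) j)"
      let ?f = "\<lambda>U. fmor U [right_act K x g] (act X V) (incl (length (act X V)) p)"
      have inX: "incl (length X) i \<in> graded_hom [x] X" "incl (length V) j \<in> graded_hom [g] V"
        using incl_graded[OF i] incl_graded[OF j] by (simp_all add: x_def g_def)
      have inXV: "incl (length (act X V)) p \<in> graded_hom [right_act K x g] (act X V)"
        using incl_graded[OF p_less] by (simp add: xg)
      have kiU: "?ki U \<in> graded_hom (fobj U [x]) (fobj U X)" if "mods U" for U
        by (rule fun_mor[OF that x(2) X inX(1)])
      have kU: "?k U \<in> graded_hom (act (fobj U [x]) [g]) (act (fobj U X) V)" if "mods U" for U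
        by (rule kronecker_graded[OF kiU[OF that] inX(2)])
      have fU: "?f U \<in> graded_hom (fobj U [right_act K x g]) (fobj U (act X V))" if "mods U" for U
        by (rule fun_mor[OF that xgc XV inXV])
      have strU: "fstr U [x] [g] \<in> graded_hom (fobj U [right_act K x g]) (act (fobj U [x]) [g])" if "mods U" for U
        using str_graded[OF that x(2) g(2)] by simp
      have nat: "fstr U X V * ?f U = ?k U * fstr U [x] [g]" if "mods U" for U
        using str_natural[OF that x(2) X g(2) V inX] unfolding incl by simp
      note n = natural_graded[OF \<nu> x(2)] and ng = natural_graded[OF \<nu> xgc]
      have ng': "\<nu> [x] \<in> graded_hom (act (fobj S [x]) [g]) (act (fobj T [x]) [g])"
        using kronecker_graded[OF n graded_hom_one[of "[g]"], of "right_act K"] by simp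
      have k: "kronecker (\<nu> X) (1\<^sub>m (length V)) * ?k S = ?k T * \<nu> [x]"
      proof -
        have "kronecker (\<nu> X) (1\<^sub>m (length V)) * ?k S = kronecker (\<nu> X * ?ki S) (1\<^sub>m (length V) * incl (length V) j)"
          by (rule kronecker_mult[OF N[THEN graded_homD] kiU[OF S, THEN graded_homD] one_carrier_mat incl_carrier])
        also have "\<dots> = kronecker (?ki T * \<nu> [x]) (incl (length V) j * 1\<^sub>m (Suc 0))"
          using naturalD[OF \<nu> x(2) X inX(1)] right_mult_one_mat[OF incl_carrier]
          by (simp add: left_mult_one_mat[OF incl_carrier])
        also have "\<dots> = ?k T * kronecker (\<nu> [x]) (1\<^sub>m (Suc 0))"
          by (rule kronecker_mult[OF kiU[OF T, THEN graded_homD] n[THEN graded_homD] incl_carrier one_carrier_mat, symmetric])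
        finally show ?thesis by simp
      qed
      have "fstr T X V * \<nu> (act X V) * ?f S = fstr T X V * (?f T * \<nu> [right_act K x g])"
        by (simp only: graded_assoc[OF strT NV fU[OF S]] naturalD[OF \<nu> xgc XV inXV])
      also have "\<dots> = ?k T * fstr T [x] [g] * \<nu> [right_act K x g]"
        by (simp only: graded_assoc[OF strT fU[OF T] ng, symmetric] nat[OF T])
      also have "\<dots> = ?k T * (\<nu> [x] * fstr S [x] [g])"
        by (simp only: graded_assoc[OF kU[OF T] strU[OF T] ng] simple[OF x(1) g(1)])
      also have "\<dots> = kronecker (\<nu> X) (1\<^sub>m (length V)) * (?k S * fstr S [x] [g])"
        by (simp only: graded_assoc[OF kU[OF T] ng' strU[OF S], symmetric] k[symmetric]
            graded_assoc[OF K kU[OF S] strU[OF S]])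
      also have "\<dots> = kronecker (\<nu> X) (1\<^sub>m (length V)) * fstr S X V * ?f S"
        by (simp only: nat[OF S, symmetric] graded_assoc[OF K strS fU[OF S]])
      finally show "fstr T X V * \<nu> (act X V) * fmor S [act X V ! p] (act X V) (incl (length (act X V)) p)
        = kronecker (\<nu> X) (1\<^sub>m (length V)) * fstr S X V * fmor S [act X V ! p] (act X V) (incl (length (act X V)) p)"
        by (simp only: xg)
    next
      show "fstr T X V * \<nu> (act X V) \<in> carrier_mat (length (act (fobj T X) V)) (length (fobj S (act X V)))"
        by (rule graded_homD[OF graded_hom_mult[OF strT NV]])
      show "kronecker (\<nu> X) (1\<^sub>m (length V)) * fstr S X V \<in> carrier_mat (length (act (fobj T X) V)) (length (fobj S (act X V)))"
        by (rule graded_homD[OF graded_hom_mult[OF K strS]])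
    qed
  qed
  then show ?thesis using \<nu> by (auto simp: module_nat_def natural_def)
qed

end

section \<open>Module functors from matrix representations\<close>

lemma block_index_div [simp]: "k < b \<Longrightarrow> (i * b + k) div b = (i :: nat)"
  by simp

text \<open>
  A direct sum of \<open>L\<close> matrices of size \<open>N\<close>, with the index of the summand varying fastest. With
  this order \<open>T (X \<otimes> V)\<close> and \<open>T X \<otimes> V\<close> are the same list for the functors \<open>T\<close> below, so that their
  structure maps are matrices of this form.
\<close>

definition block_mat :: "nat \<Rightarrow> nat \<Rightarrow> (nat \<Rightarrow> complex mat) \<Rightarrow> complex mat"
  where "block_mat N L B = mat (N * L) (N * L)
    (\<lambda>(p, p'). if p mod L = p' mod L then B (p mod L) $$ (p div L, p' div L) else 0)"

lemma block_mat_carrier [simp, intro]: "block_mat N L B \<in> carrier_mat (N * L) (N * L)"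
  by (simp add: block_mat_def)

lemma index_block_mat:
  assumes "r < N" "s < N" "t < L" "u < L"
  shows "block_mat N L B $$ (r * L + t, s * L + u) = (if t = u then B t $$ (r, s) else 0)"
  using assms block_index_less[of r N t L] block_index_less[of s N u L] by (auto simp: block_mat_def)

lemma block_mat_cong:
  "L = L' \<Longrightarrow> (\<And>t. t < L' \<Longrightarrow> B t = B' t) \<Longrightarrow> block_mat N L B = block_mat N L' B'"
  by (rule block_mat_eqI[of _ N L N L]) (auto simp: index_block_mat)

lemma block_mat_mult:
  assumes "\<And>t. t < L \<Longrightarrow> B t \<in> carrier_mat N N" "\<And>t. t < L \<Longrightarrow> B' t \<in> carrier_mat N N"
  shows "block_mat N L B * block_mat N L B' = block_mat N L (\<lambda>t. B t * B' t)"
proof (rule block_mat_eqI[of _ N L N L])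
  fix r t s u assume *: "r < N" "t < L" "s < N" "u < L"
  have "(block_mat N L B * block_mat N L B') $$ (r * L + t, s * L + u)
    = (\<Sum>r'<N. \<Sum>t'<L. block_mat N L B $$ (r * L + t, r' * L + t') * block_mat N L B' $$ (r' * L + t', s * L + u))"
    using * by (subst index_mult_sum[of _ "N * L" "N * L" _ "N * L"]) (auto simp: sum_lessThan_product block_index_less)
  also have "\<dots> = (\<Sum>r'<N. \<Sum>t'<L. if t' = t then (if t = u then B t $$ (r, r') * B' t $$ (r', s) else 0) else 0)"
    using * by (intro sum.cong refl) (auto simp: index_block_mat)
  also have "\<dots> = (if t = u then \<Sum>r'<N. B t $$ (r, r') * B' t $$ (r', s) else 0)"
    using * by simp
  also have "\<dots> = block_mat N L (\<lambda>t. B t * B' t) $$ (r * L + t, s * L + u)"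
    using * index_mult_sum[OF assms(1,2)[OF *(2)] *(1,3)] by (auto simp: index_block_mat)
  finally show "(block_mat N L B * block_mat N L B') $$ (r * L + t, s * L + u)
    = block_mat N L (\<lambda>t. B t * B' t) $$ (r * L + t, s * L + u)" .
qed (auto intro: mult_carrier_mat)

lemma block_mat_one: "block_mat N L (\<lambda>_. 1\<^sub>m N) = 1\<^sub>m (N * L)"
  by (rule block_mat_eqI[of _ N L N L])
    (auto simp: index_block_mat block_index_less block_index_eq_iff)

lemma kronecker_block_mat: "kronecker (block_mat N L B) (1\<^sub>m w) = block_mat N (L * w) (\<lambda>t. B (t div w))"
proof (rule block_mat_eqI[of _ N "L * w" N "L * w"])
  fix r t s u assume *: "r < N" "t < L * w" "s < N" "u < L * w"
  obtain t1 t2 where t: "t1 < L" "t2 < w" "t = t1 * w + t2" using *(2) by (rule block_index_cases)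
  obtain u1 u2 where u: "u1 < L" "u2 < w" "u = u1 * w + u2" using *(4) by (rule block_index_cases)
  have "kronecker (block_mat N L B) (1\<^sub>m w) $$ (r * (L * w) + t, s * (L * w) + u)
    = kronecker (block_mat N L B) (1\<^sub>m w) $$ ((r * L + t1) * w + t2, (s * L + u1) * w + u2)"
    by (simp add: t u algebra_simps)
  also have "\<dots> = block_mat N L B $$ (r * L + t1, s * L + u1) * 1\<^sub>m w $$ (t2, u2)"
    by (rule index_kronecker[of _ "N * L" "N * L" _ w w]) (use * t u in \<open>auto simp: block_index_less\<close>)
  also have "\<dots> = block_mat N (L * w) (\<lambda>t. B (t div w)) $$ (r * (L * w) + t, s * (L * w) + u)"
    using * t u by (simp add: index_block_mat block_index_eq_iff)
  finally show "kronecker (block_mat N L B) (1\<^sub>m w) $$ (r * (L * w) + t, s * (L * w) + u)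
    = block_mat N (L * w) (\<lambda>t. B (t div w)) $$ (r * (L * w) + t, s * (L * w) + u)" .
qed (use kronecker_carrier[OF block_mat_carrier[of N L B] one_carrier_mat[of w]] in \<open>auto simp: mult.assoc\<close>)

lemma diagonal_block_mat:
  assumes "length cs = N * L" "\<And>r t. r < N \<Longrightarrow> t < L \<Longrightarrow> cs ! (r * L + t) = c t"
  shows "diagonal cs = block_mat N L (\<lambda>t. c t \<cdot>\<^sub>m 1\<^sub>m N)"
  by (rule block_mat_eqI[of _ N L N L])
    (use assms in \<open>auto simp: diagonal_def mat_diag_def index_block_mat block_index_less block_index_eq_iff\<close>)

lemma kronecker_one_diagonal:
  "kronecker (1\<^sub>m N) (diagonal cs) = block_mat N (length cs) (\<lambda>t. cs ! t \<cdot>\<^sub>m 1\<^sub>m N)"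
  by (rule block_mat_eqI[of _ N "length cs" N "length cs"])
    (auto simp: diagonal_def mat_diag_def index_block_mat index_kronecker[of _ N N _ "length cs" "length cs"])

text \<open>
  The hypothesis \<open>eq\<close> says that the blocks only depend on the simple object at their position,
  which is what a graded matrix \<open>h\<close> preserves.
\<close>

lemma block_mat_natural:
  assumes h: "h \<in> carrier_mat L' L" and B: "\<And>t. t < L \<Longrightarrow> B t \<in> carrier_mat N N" "\<And>t. t < L' \<Longrightarrow> B' t \<in> carrier_mat N N"
    and eq: "\<And>t t'. t < L \<Longrightarrow> t' < L' \<Longrightarrow> h $$ (t', t) \<noteq> 0 \<Longrightarrow> B' t' = B t"
  shows "block_mat N L' B' * kronecker (1\<^sub>m N) h = kronecker (1\<^sub>m N) h * block_mat N L B"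
proof (rule block_mat_eqI[of _ N L' N L])
  note k = index_kronecker[OF one_carrier_mat[of N] h]
  have kc: "kronecker (1\<^sub>m N) h \<in> carrier_mat (N * L') (N * L)" using h by auto
  fix r t' s t assume *: "r < N" "t' < L'" "s < N" "t < L"
  have "(block_mat N L' B' * kronecker (1\<^sub>m N) h) $$ (r * L' + t', s * L + t)
    = (\<Sum>r'<N. \<Sum>u<L'. block_mat N L' B' $$ (r * L' + t', r' * L' + u) * kronecker (1\<^sub>m N) h $$ (r' * L' + u, s * L + t))"
    using * kc by (subst index_mult_sum[of _ "N * L'" "N * L'" _ "N * L"]) (auto simp: sum_lessThan_product block_index_less)
  also have "\<dots> = (\<Sum>r'<N. \<Sum>u<L'. if u = t' then (if r' = s then B' t' $$ (r, s) * h $$ (t', t) else 0) else 0)"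
    using * by (intro sum.cong refl) (auto simp: index_block_mat k)
  also have "\<dots> = h $$ (t', t) * B t $$ (r, s)"
    using * eq[of t t'] by (cases "h $$ (t', t) = 0") auto
  also have "\<dots> = (\<Sum>r'<N. \<Sum>u<L. if u = t then (if r' = r then h $$ (t', t) * B t $$ (r, s) else 0) else 0)"
    using * by simp
  also have "\<dots> = (\<Sum>r'<N. \<Sum>u<L. kronecker (1\<^sub>m N) h $$ (r * L' + t', r' * L + u) * block_mat N L B $$ (r' * L + u, s * L + t))"
    using * by (intro sum.cong refl) (auto simp: index_block_mat k)
  also have "\<dots> = (kronecker (1\<^sub>m N) h * block_mat N L B) $$ (r * L' + t', s * L + t)"
    using * kc by (subst index_mult_sum[of _ "N * L'" "N * L" _ "N * L"]) (auto simp: sum_lessThan_product block_index_less)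
  finally show "(block_mat N L' B' * kronecker (1\<^sub>m N) h) $$ (r * L' + t', s * L + t)
    = (kronecker (1\<^sub>m N) h * block_mat N L B) $$ (r * L' + t', s * L + t)" .
qed (rule mult_carrier_mat[OF block_mat_carrier kronecker_carrier[OF one_carrier_mat h]]
      mult_carrier_mat[OF kronecker_carrier[OF one_carrier_mat h] block_mat_carrier])+

lemma length_list_product3 [simp]:
  "length [f x y z. x \<leftarrow> xs, y \<leftarrow> ys, z \<leftarrow> zs] = length xs * (length ys * length zs)"
  by (induction xs) auto

lemma nth_list_product3:
  assumes "i < length xs" "j < length ys" "k < length zs"
  shows "[f x y z. x \<leftarrow> xs, y \<leftarrow> ys, z \<leftarrow> zs] ! (i * (length ys * length zs) + (j * length zs + k))
    = f (xs ! i) (ys ! j) (zs ! k)"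
  using assms(1)
proof (induction xs arbitrary: i)
  case (Cons x xs)
  have "j * length zs + k < length ys * length zs" using assms(2,3) by (rule block_index_less)
  then show ?case using Cons assms(2,3) by (cases i) (auto simp: nth_append nth_list_product)
qed simp

context extension_data begin

context
  fixes y :: 'k and N :: nat and S :: "'k \<Rightarrow> 'a \<times> 'k \<Rightarrow> complex mat"
begin

definition rep_functor :: "('k list, complex mat, ('a \<times> 'k) list) mod_fun" where
  "rep_functor = \<lparr>fobj = (\<lambda>X. [y \<otimes>\<^bsub>K\<^esub> x. _ \<leftarrow> [0..<N], x \<leftarrow> X]), fmor = (\<lambda>_ _. kronecker (1\<^sub>m N)),
     fstr = (\<lambda>X V. block_mat N (length X * length V) (\<lambda>t. S (X ! (t div length V)) (V ! (t mod length V))))\<rparr>"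

lemma rep_functor_sel [simp]:
  "fobj rep_functor X = [y \<otimes>\<^bsub>K\<^esub> x. _ \<leftarrow> [0..<N], x \<leftarrow> X]" "fmor rep_functor X Y f = kronecker (1\<^sub>m N) f"
  "fstr rep_functor X V = block_mat N (length X * length V) (\<lambda>t. S (X ! (t div length V)) (V ! (t mod length V)))"
  by (simp_all add: rep_functor_def)

context
  assumes y: "y \<in> carrier K"
    and S_carrier: "\<And>x g. x \<in> carrier K \<Longrightarrow> g \<in> carrier G \<Longrightarrow> S x g \<in> carrier_mat N N"
    and S_inverse: "\<And>x g. x \<in> carrier K \<Longrightarrow> g \<in> carrier G
      \<Longrightarrow> \<exists>B\<in>carrier_mat N N. B * S x g = 1\<^sub>m N \<and> S x g * B = 1\<^sub>m N"
    and S_one: "\<And>x. x \<in> carrier K \<Longrightarrow> S x \<one>\<^bsub>G\<^esub> = 1\<^sub>m N"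
    and S_mult: "\<And>x g h. x \<in> carrier K \<Longrightarrow> g \<in> carrier G \<Longrightarrow> h \<in> carrier G \<Longrightarrow>
      \<mu> (y \<otimes>\<^bsub>K\<^esub> x) [g, h] \<cdot>\<^sub>m S x (g \<otimes>\<^bsub>G\<^esub> h) = \<mu> x [g, h] \<cdot>\<^sub>m (S x g * S (right_act K x g) h)"
begin

lemma rep_nth: "r < N \<Longrightarrow> t < length X \<Longrightarrow> [y \<otimes>\<^bsub>K\<^esub> x. _ \<leftarrow> [0..<N], x \<leftarrow> X] ! (r * length X + t) = y \<otimes>\<^bsub>K\<^esub> X ! t"
  by (subst nth_list_product) auto

lemma rep_act:
  assumes "X \<in> lists (carrier K)" "V \<in> lists (carrier G)"
  shows "act (fobj rep_functor X) V = fobj rep_functor (act X V)"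
proof (rule nth_equalityI)
  fix p assume "p < length (act (fobj rep_functor X) V)"
  then have "p < N * (length X * length V)" by (simp add: mult.assoc)
  then obtain r t where r: "r < N" "t < length X * length V" "p = r * (length X * length V) + t"
    by (rule block_index_cases)
  obtain i j where t: "i < length X" "j < length V" "t = i * length V + j"
    using r(2) by (rule block_index_cases)
  have "act (fobj rep_functor X) V ! p = act (fobj rep_functor X) V ! ((r * length X + i) * length V + j)"
    by (simp add: r t algebra_simps)
  also have "\<dots> = right_act K (fobj rep_functor X ! (r * length X + i)) (V ! j)"
    by (rule nth_list_product) (use r t in \<open>auto simp: block_index_less\<close>)
  also have "\<dots> = y \<otimes>\<^bsub>K\<^esub> right_act K (X ! i) (V ! j)"
    using r t assms y by (simp add: rep_nth right_act_translate)
  also have "\<dots> = fobj rep_functor (act X V) ! p"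
    using r t rep_nth[of r t "act X V"] by (simp add: nth_list_product)
  finally show "act (fobj rep_functor X) V ! p = fobj rep_functor (act X V) ! p" .
qed (simp add: mult.assoc)

lemma block_mat_graded:
  "block_mat N (length X) B \<in> graded_hom (fobj rep_functor X) (fobj rep_functor X)"
proof -
  have "block_mat N (length X) B $$ (p, q) = 0"
    if *: "p < N * length X" "q < N * length X" "fobj rep_functor X ! p \<noteq> fobj rep_functor X ! q" for p q
  proof -
    obtain r t where p: "r < N" "t < length X" "p = r * length X + t" using *(1) by (rule block_index_cases)
    obtain s u where q: "s < N" "u < length X" "q = s * length X + u" using *(2) by (rule block_index_cases)
    show ?thesis using * p q by (auto simp: index_block_mat rep_nth)
  qed
  then show ?thesis by (auto simp: graded_hom_def simp del: rep_functor_sel(1)) auto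
qed

lemma rep_linear: "linear_functor (M_cat K \<mu>) (fobj rep_functor) (fmor rep_functor)"
proof -
  have obj: "fobj rep_functor X \<in> lists (carrier K)" if "X \<in> lists (carrier K)" for X
    using that y by (auto simp: in_lists_conv_set)
  have mor: "kronecker (1\<^sub>m N) f \<in> graded_hom (fobj rep_functor X) (fobj rep_functor Y)"
    if "f \<in> graded_hom X Y" for X Y f
    using kronecker_graded[OF graded_hom_one[of "[0..<N]"] that, of "\<lambda>_ x. y \<otimes>\<^bsub>K\<^esub> x"] by simp
  have comp: "kronecker (1\<^sub>m N) (g * f) = kronecker (1\<^sub>m N) g * kronecker (1\<^sub>m N) f"
    if "f \<in> graded_hom X Y" "g \<in> graded_hom Y Z" for X Y Z and f g
    using kronecker_mult[OF one_carrier_mat[of N] one_carrier_mat[of N] that(2,1)[THEN graded_homD]] by simp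
  have add: "kronecker (1\<^sub>m N) (f + g) = kronecker (1\<^sub>m N) f + kronecker (1\<^sub>m N) g"
    if "f \<in> graded_hom X Y" "g \<in> graded_hom X Y" for X Y and f g
  proof -
    note c = that[THEN graded_homD]
    have fg: "f + g \<in> carrier_mat (length Y) (length X)" using c by simp
    note k = kronecker_carrier[OF one_carrier_mat c(1), of N] kronecker_carrier[OF one_carrier_mat c(2), of N]
    show ?thesis
      by (rule block_mat_eqI[of _ N "length Y" N "length X"])
        (use c kronecker_carrier[OF one_carrier_mat fg, of N] k carrier_matD[OF k(2)] in
          \<open>auto simp: index_kronecker[OF one_carrier_mat[of N] c(1)] index_kronecker[OF one_carrier_mat[of N] c(2)]
            index_kronecker[OF one_carrier_mat[of N] fg] block_index_less distrib_left\<close>)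
  qed
  have scale: "kronecker (1\<^sub>m N) (c \<cdot>\<^sub>m f) = c \<cdot>\<^sub>m kronecker (1\<^sub>m N) f"
    if "f \<in> graded_hom X Y" for X Y and f c
  proof -
    note f = that[THEN graded_homD]
    note k = kronecker_carrier[OF one_carrier_mat f, of N]
    show ?thesis
      by (rule block_mat_eqI[of _ N "length Y" N "length X"])
        (use f k carrier_matD[OF k] kronecker_carrier[OF one_carrier_mat smult_carrier_mat[OF f], of N c] in
          \<open>auto simp: index_kronecker[OF one_carrier_mat[of N] f]
            index_kronecker[OF one_carrier_mat[of N] smult_carrier_mat[OF f]] block_index_less\<close>)
  qed
  have len: "length (fobj rep_functor X) = N * length X" for X by simp
  show ?thesis
    unfolding linear_functor_def using obj mor comp add scale
    by (auto simp: kronecker_one len simp del: rep_functor_sel(1))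
qed

lemma rep_str_natural:
  assumes X: "X \<in> lists (carrier K)" "X' \<in> lists (carrier K)" and V: "V \<in> lists (carrier G)" "V' \<in> lists (carrier G)"
    and f: "f \<in> graded_hom X X'" and u: "u \<in> graded_hom V V'"
  shows "fstr rep_functor X' V' * kronecker (1\<^sub>m N) (kronecker f u) = kronecker (kronecker (1\<^sub>m N) f) u * fstr rep_functor X V"
proof -
  let ?B = "\<lambda>X V t. S (X ! (t div length V)) (V ! (t mod length V))"
  have B: "?B X V t \<in> carrier_mat N N" if "t < length X * length V" "X \<in> lists (carrier K)" "V \<in> lists (carrier G)" for X V t
    using that by (auto elim!: block_index_cases intro: S_carrier)
  have eq: "?B X' V' t' = ?B X V t"
    if tt': "t < length X * length V" "t' < length X' * length V'" "kronecker f u $$ (t', t) \<noteq> 0" for t t'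
  proof -
    obtain i j where t: "i < length X" "j < length V" "t = i * length V + j" using tt'(1) by (rule block_index_cases)
    obtain i' j' where t': "i' < length X'" "j' < length V'" "t' = i' * length V' + j'" using tt'(2) by (rule block_index_cases)
    have "f $$ (i', i) \<noteq> 0" "u $$ (j', j) \<noteq> 0"
      using tt'(3) t t' index_kronecker[OF f[THEN graded_homD] u[THEN graded_homD], of i' j' i j] by auto
    then show ?thesis using t t' graded_hom_nonzeroD[OF f, of i' i] graded_hom_nonzeroD[OF u, of j' j] by simp
  qed
  show ?thesis
    using block_mat_natural[OF kronecker_carrier[OF f[THEN graded_homD] u[THEN graded_homD]] B B eq] X V
    by (simp add: kronecker_assoc[OF one_carrier_mat f[THEN graded_homD] u[THEN graded_homD]])
qed

lemma rep_str_pentagon: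
  assumes X: "X \<in> lists (carrier K)" and V: "V \<in> lists (carrier G)" and W: "W \<in> lists (carrier G)"
  shows "diagonal [\<mu> x [g, h]. x \<leftarrow> fobj rep_functor X, g \<leftarrow> V, h \<leftarrow> W] * fstr rep_functor X (tens V W)
      = kronecker (fstr rep_functor X V) (1\<^sub>m (length W)) * (fstr rep_functor (act X V) W *
          kronecker (1\<^sub>m N) (diagonal [\<mu> x [g, h]. x \<leftarrow> X, g \<leftarrow> V, h \<leftarrow> W]))"
proof -
  let ?m = "length X" and ?q = "length V" and ?w = "length W"
  let ?L = "?m * (?q * ?w)"
  define x where "x t = X ! (t div (?q * ?w))" for t
  define g where "g t = V ! (t div ?w mod ?q)" for t
  define h where "h t = W ! (t mod ?w)" for t
  have dec: "\<exists>i<?m. \<exists>j<?q. \<exists>k<?w. t = i * (?q * ?w) + (j * ?w + k)" if "t < ?L" for t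
    using that by (metis block_index_cases)
  have xgh: "x t = X ! i" "g t = V ! j" "h t = W ! k"
    if "j < ?q" "k < ?w" "t = i * (?q * ?w) + (j * ?w + k)" for t i j k
  proof -
    have jk: "j * ?w + k < ?q * ?w" using that by (intro block_index_less)
    show "x t = X ! i" using that jk by (simp add: x_def)
    have "t div ?w = i * ?q + j"
    proof -
      have "t = (i * ?q + j) * ?w + k" by (simp add: that algebra_simps)
      then show ?thesis using that(2) by simp
    qed
    then show "g t = V ! j" using that by (simp add: g_def)
    have "t mod ?w = ((i * ?q + j) * ?w + k) mod ?w" by (simp add: that algebra_simps)
    then show "h t = W ! k" using that(2) by (simp add: h_def)
  qed
  have cl: "x t \<in> carrier K" "g t \<in> carrier G" "h t \<in> carrier G" if "t < ?L" for t
    using dec[OF that] xgh X V W by force+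
  have D1: "diagonal [\<mu> x [g, h]. x \<leftarrow> fobj rep_functor X, g \<leftarrow> V, h \<leftarrow> W]
    = block_mat N ?L (\<lambda>t. \<mu> (y \<otimes>\<^bsub>K\<^esub> x t) [g t, h t] \<cdot>\<^sub>m 1\<^sub>m N)"
  proof (rule diagonal_block_mat)
    show "length [\<mu> x [g, h]. x \<leftarrow> fobj rep_functor X, g \<leftarrow> V, h \<leftarrow> W] = N * ?L" by simp
    fix r t assume r: "r < N" and t: "t < ?L"
    obtain i j k where ijk: "i < ?m" "j < ?q" "k < ?w" "t = i * (?q * ?w) + (j * ?w + k)" using dec[OF t] by auto
    have "[\<mu> x [g, h]. x \<leftarrow> fobj rep_functor X, g \<leftarrow> V, h \<leftarrow> W] ! (r * ?L + t)
      = [\<mu> x [g, h]. x \<leftarrow> fobj rep_functor X, g \<leftarrow> V, h \<leftarrow> W] ! ((r * ?m + i) * (?q * ?w) + (j * ?w + k))"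
      by (simp add: ijk algebra_simps)
    also have "\<dots> = \<mu> (fobj rep_functor X ! (r * ?m + i)) [V ! j, W ! k]"
      by (rule nth_list_product3[of _ "fobj rep_functor X"]) (use r ijk in \<open>auto simp: block_index_less\<close>)
    also have "\<dots> = \<mu> (y \<otimes>\<^bsub>K\<^esub> x t) [g t, h t]" using r ijk xgh[OF ijk(2,3,4)] by (simp add: rep_nth)
    finally show "[\<mu> x [g, h]. x \<leftarrow> fobj rep_functor X, g \<leftarrow> V, h \<leftarrow> W] ! (r * ?L + t)
      = \<mu> (y \<otimes>\<^bsub>K\<^esub> x t) [g t, h t]" .
  qed
  have D2: "kronecker (1\<^sub>m N) (diagonal [\<mu> x [g, h]. x \<leftarrow> X, g \<leftarrow> V, h \<leftarrow> W])
    = block_mat N ?L (\<lambda>t. \<mu> (x t) [g t, h t] \<cdot>\<^sub>m 1\<^sub>m N)"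
  proof -
    have "[\<mu> x [g, h]. x \<leftarrow> X, g \<leftarrow> V, h \<leftarrow> W] ! t = \<mu> (x t) [g t, h t]" if t: "t < ?L" for t
    proof -
      obtain i j k where ijk: "i < ?m" "j < ?q" "k < ?w" "t = i * (?q * ?w) + (j * ?w + k)" using dec[OF t] by auto
      show ?thesis using nth_list_product3[OF ijk(1,2,3), of "\<lambda>x g h. \<mu> x [g, h]"] xgh[OF ijk(2,3,4)] ijk(4) by simp
    qed
    then show ?thesis unfolding kronecker_one_diagonal by (simp cong: block_mat_cong)
  qed
  have S1: "fstr rep_functor X (tens V W) = block_mat N ?L (\<lambda>t. S (x t) (g t \<otimes>\<^bsub>G\<^esub> h t))"
  proof -
    have "S (X ! (t div (?q * ?w))) (tens V W ! (t mod (?q * ?w))) = S (x t) (g t \<otimes>\<^bsub>G\<^esub> h t)" if t: "t < ?L" for t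
    proof -
      obtain i j k where ijk: "i < ?m" "j < ?q" "k < ?w" "t = i * (?q * ?w) + (j * ?w + k)" using dec[OF t] by auto
      have jk: "j * ?w + k < ?q * ?w" using ijk by (intro block_index_less)
      then have "t mod (?q * ?w) = j * ?w + k" using ijk by simp
      then show ?thesis using xgh[OF ijk(2,3,4)] nth_list_product[OF ijk(2,3), of "\<lambda>g h. g \<otimes>\<^bsub>G\<^esub> h"] by (simp add: x_def)
    qed
    then show ?thesis by (simp cong: block_mat_cong)
  qed
  have S2: "kronecker (fstr rep_functor X V) (1\<^sub>m ?w) = block_mat N ?L (\<lambda>t. S (x t) (g t))"
  proof -
    have "S (X ! (t div ?w div ?q)) (V ! (t div ?w mod ?q)) = S (x t) (g t)" for t
      by (simp add: x_def g_def div_mult2_eq[symmetric] mult.commute)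
    then show ?thesis by (simp add: kronecker_block_mat mult.assoc)
  qed
  have S3: "fstr rep_functor (act X V) W = block_mat N ?L (\<lambda>t. S (right_act K (x t) (g t)) (h t))"
  proof -
    have "S (act X V ! (t div ?w)) (W ! (t mod ?w)) = S (right_act K (x t) (g t)) (h t)" if t: "t < ?L" for t
    proof -
      obtain i j k where ijk: "i < ?m" "j < ?q" "k < ?w" "t = i * (?q * ?w) + (j * ?w + k)" using dec[OF t] by auto
      have "t = (i * ?q + j) * ?w + k" by (simp add: ijk algebra_simps)
      then have "t div ?w = i * ?q + j" using ijk(3) by simp
      then show ?thesis using xgh[OF ijk(2,3,4)] nth_list_product[OF ijk(1,2), of "right_act K"] by (simp add: h_def)
    qed
    then show ?thesis by (simp add: mult.assoc cong: block_mat_cong)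
  qed
  have c: "S (x t) (g t) \<in> carrier_mat N N" "S (x t) (g t \<otimes>\<^bsub>G\<^esub> h t) \<in> carrier_mat N N"
      "S (right_act K (x t) (g t)) (h t) \<in> carrier_mat N N"
      "\<mu> (x t) [g t, h t] \<cdot>\<^sub>m 1\<^sub>m N \<in> carrier_mat N N" "\<mu> (y \<otimes>\<^bsub>K\<^esub> x t) [g t, h t] \<cdot>\<^sub>m 1\<^sub>m N \<in> carrier_mat N N"
      if "t < ?L" for t
    using cl[OF that] by (auto intro!: S_carrier)
  have "(\<mu> (y \<otimes>\<^bsub>K\<^esub> x t) [g t, h t] \<cdot>\<^sub>m 1\<^sub>m N) * S (x t) (g t \<otimes>\<^bsub>G\<^esub> h t)
    = S (x t) (g t) * (S (right_act K (x t) (g t)) (h t) * (\<mu> (x t) [g t, h t] \<cdot>\<^sub>m 1\<^sub>m N))" if "t < ?L" for t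
  proof -
    note s = c(1-3)[OF that]
    show ?thesis
      using S_mult[OF cl[OF that]] by (simp add: mult_smult_assoc_mat[OF one_carrier_mat s(2)] left_mult_one_mat[OF s(2)]
        mult_smult_distrib[OF s(3) one_carrier_mat] right_mult_one_mat[OF s(3)] mult_smult_distrib[OF s(1,3)])
  qed
  note eq = this
  let ?M = "block_mat N ?L"
  have "?M (\<lambda>t. \<mu> (y \<otimes>\<^bsub>K\<^esub> x t) [g t, h t] \<cdot>\<^sub>m 1\<^sub>m N) * ?M (\<lambda>t. S (x t) (g t \<otimes>\<^bsub>G\<^esub> h t))
    = ?M (\<lambda>t. (\<mu> (y \<otimes>\<^bsub>K\<^esub> x t) [g t, h t] \<cdot>\<^sub>m 1\<^sub>m N) * S (x t) (g t \<otimes>\<^bsub>G\<^esub> h t))"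
    by (rule block_mat_mult) (rule c, assumption)+
  also have "\<dots> = ?M (\<lambda>t. S (x t) (g t) * (S (right_act K (x t) (g t)) (h t) * (\<mu> (x t) [g t, h t] \<cdot>\<^sub>m 1\<^sub>m N)))"
    by (rule block_mat_cong[OF refl]) (rule eq)
  also have "\<dots> = ?M (\<lambda>t. S (x t) (g t)) * ?M (\<lambda>t. S (right_act K (x t) (g t)) (h t) * (\<mu> (x t) [g t, h t] \<cdot>\<^sub>m 1\<^sub>m N))"
    by (rule block_mat_mult[symmetric]) (rule c mult_carrier_mat[OF c(3,4)], assumption+)+
  also have "?M (\<lambda>t. S (right_act K (x t) (g t)) (h t) * (\<mu> (x t) [g t, h t] \<cdot>\<^sub>m 1\<^sub>m N))
    = ?M (\<lambda>t. S (right_act K (x t) (g t)) (h t)) * ?M (\<lambda>t. \<mu> (x t) [g t, h t] \<cdot>\<^sub>m 1\<^sub>m N)"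
    by (rule block_mat_mult[symmetric]) (rule c, assumption)+
  finally show ?thesis unfolding D1 D2 S1 S2 S3 .
qed

lemma rep_str_iso:
  assumes X: "X \<in> lists (carrier K)" and V: "V \<in> lists (carrier G)"
  shows "iso (fobj rep_functor (act X V)) (act (fobj rep_functor X) V) (fstr rep_functor X V)"
proof -
  let ?L = "length X * length V"
  let ?B = "\<lambda>t. S (X ! (t div length V)) (V ! (t mod length V))"
  have "\<exists>B'. B' \<in> carrier_mat N N \<and> B' * ?B t = 1\<^sub>m N \<and> ?B t * B' = 1\<^sub>m N \<and> ?B t \<in> carrier_mat N N" if t: "t < ?L" for t
  proof -
    obtain i j where ij: "i < length X" "j < length V" "t = i * length V + j" using t by (rule block_index_cases)
    then show ?thesis using S_inverse[of "X ! i" "V ! j"] S_carrier[of "X ! i" "V ! j"] X V by auto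
  qed
  then obtain B' where B': "\<And>t. t < ?L \<Longrightarrow> B' t \<in> carrier_mat N N"
    "\<And>t. t < ?L \<Longrightarrow> B' t * ?B t = 1\<^sub>m N" "\<And>t. t < ?L \<Longrightarrow> ?B t * B' t = 1\<^sub>m N"
    and B: "\<And>t. t < ?L \<Longrightarrow> ?B t \<in> carrier_mat N N" by metis
  have "block_mat N ?L B' * block_mat N ?L ?B = block_mat N ?L (\<lambda>t. B' t * ?B t)"
    by (rule block_mat_mult) (rule B' B, assumption)+
  moreover have "block_mat N ?L ?B * block_mat N ?L B' = block_mat N ?L (\<lambda>t. ?B t * B' t)"
    by (rule block_mat_mult) (rule B' B, assumption)+
  moreover have "block_mat N ?L (\<lambda>t. B' t * ?B t) = block_mat N ?L (\<lambda>_. 1\<^sub>m N)"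
    by (rule block_mat_cong[OF refl]) (rule B')
  moreover have "block_mat N ?L (\<lambda>t. ?B t * B' t) = block_mat N ?L (\<lambda>_. 1\<^sub>m N)"
    by (rule block_mat_cong[OF refl]) (rule B')
  ultimately have "block_mat N ?L B' * block_mat N ?L ?B = 1\<^sub>m (N * ?L)" "block_mat N ?L ?B * block_mat N ?L B' = 1\<^sub>m (N * ?L)"
    by (simp_all only: block_mat_one)
  then show ?thesis
    unfolding rep_act[OF X V] is_iso_M_cat
    using block_mat_graded[of "act X V" ?B] block_mat_graded[of "act X V" B'] by auto
qed

text \<open>
  A family of invertible matrices \<open>S x g\<close> that satisfies the twisted multiplication rule is a
  module functor in disguise: on simple objects the pentagon axiom is exactly that rule. The
  block matrix bookkeeping above transports this to all objects.
\<close>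

lemma rep_functor_module: "mods rep_functor"
proof -
  have unit: "1\<^sub>m (length (fobj rep_functor X)) * fstr rep_functor X [\<one>\<^bsub>G\<^esub>] = fmor rep_functor (act X [\<one>\<^bsub>G\<^esub>]) X (1\<^sub>m (length X))"
    if X: "X \<in> lists (carrier K)" for X
  proof -
    have "fstr rep_functor X [\<one>\<^bsub>G\<^esub>] = block_mat N (length X) (\<lambda>_. 1\<^sub>m N)"
      using X by (simp add: S_one cong: block_mat_cong)
    then show ?thesis by (simp add: block_mat_one kronecker_one)
  qed
  show ?thesis
    unfolding module_functor_def
    using rep_linear rep_str_iso rep_str_natural rep_str_pentagon unit
    by (simp del: rep_functor_sel(1,3))
qed

end

end

end

context extension_data begin

section \<open>Regular representations\<close>

text \<open>
  The regular functor at \<open>y\<close> is \<open>X \<mapsto> y \<otimes> Hom(\<one>, X)\<close> with the internal Hom of the module category: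
  \<open>Hom(\<one>, x)\<close> is the sum of the elements \<open>(a, x)\<close> of \<open>G\<close> over \<open>x\<close>, so that \<open>x\<close> is sent to \<open>|A|\<close> copies of
  \<open>y x\<close>. Its structure maps combine the associativity constraints of the module category at
  \<open>y\<close> and, inverted, at \<open>\<one>\<close>.
\<close>

definition \<mu>_ratio where "\<mu>_ratio y g h = \<mu> y [g, h] / \<mu> \<one>\<^bsub>K\<^esub> [g, h]"

lemma \<mu>_ratio_nonzero: "y \<in> carrier K \<Longrightarrow> g \<in> carrier G \<Longrightarrow> h \<in> carrier G \<Longrightarrow> \<mu>_ratio y g h \<noteq> 0"
  by (simp add: \<mu>_ratio_def \<mu>_nonzero)

text \<open>
  The pentagon axiom expresses \<open>\<omega> [g, h, k]\<close> through \<open>\<mu>\<close> at the point \<open>y\<close> and at the point \<open>\<one>\<close>.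
  Dividing the two expressions leaves the twisted cocycle rule for the ratio.
\<close>

lemma \<mu>_ratio_cocycle:
  assumes "y \<in> carrier K" "g \<in> carrier G" "h \<in> carrier G" "k \<in> carrier G"
  shows "\<mu> (right_act K y g) [h, k] * \<mu>_ratio y g (h \<otimes>\<^bsub>G\<^esub> k)
    = \<mu> (snd g) [h, k] * (\<mu>_ratio y g h * \<mu>_ratio y (g \<otimes>\<^bsub>G\<^esub> h) k)"
proof -
  have "right_act K \<one>\<^bsub>K\<^esub> g = snd g" using assms by (simp add: right_act_def)
  then have "\<mu> y [g \<otimes>\<^bsub>G\<^esub> h, k] * \<mu> y [g, h] / (\<mu> (right_act K y g) [h, k] * \<mu> y [g, h \<otimes>\<^bsub>G\<^esub> k])
    = \<mu> \<one>\<^bsub>K\<^esub> [g \<otimes>\<^bsub>G\<^esub> h, k] * \<mu> \<one>\<^bsub>K\<^esub> [g, h] / (\<mu> (snd g) [h, k] * \<mu> \<one>\<^bsub>K\<^esub> [g, h \<otimes>\<^bsub>G\<^esub> k])"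
    using \<omega>_\<mu>[OF assms] \<omega>_\<mu>[OF K.one_closed assms(2-4)] by simp
  then show ?thesis
    using assms \<mu>_nonzero[of y "g \<otimes>\<^bsub>G\<^esub> h" k] \<mu>_nonzero[of y g h] \<mu>_nonzero[of "right_act K y g" h k]
      \<mu>_nonzero[of y g "h \<otimes>\<^bsub>G\<^esub> k"] \<mu>_nonzero[of "\<one>\<^bsub>K\<^esub>" "g \<otimes>\<^bsub>G\<^esub> h" k] \<mu>_nonzero[of "\<one>\<^bsub>K\<^esub>" g h]
      \<mu>_nonzero[of "snd g" h k] \<mu>_nonzero[of "\<one>\<^bsub>K\<^esub>" g "h \<otimes>\<^bsub>G\<^esub> k"]
    by (simp add: \<mu>_ratio_def field_simps)
qed

text \<open>The factor by which right multiplication by \<open>g\<close> moves the \<open>A\<close>-part of an element over \<open>x\<close>.\<close>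

definition shift where "shift x g = \<phi> x (fst g) \<otimes>\<^bsub>A\<^esub> F x (snd g)"

lemma shift_closed [simp]: "x \<in> carrier K \<Longrightarrow> g \<in> carrier G \<Longrightarrow> shift x g \<in> carrier A"
  by (simp add: shift_def)

lemma G_mult_shift:
  "a \<in> carrier A \<Longrightarrow> x \<in> carrier K \<Longrightarrow> g \<in> carrier G
    \<Longrightarrow> (a, x) \<otimes>\<^bsub>G\<^esub> g = (a \<otimes>\<^bsub>A\<^esub> shift x g, right_act K x g)"
  by (cases g) (simp add: G_mult shift_def right_act_def A.m_assoc carrier_G)

lemma shift_one: "x \<in> carrier K \<Longrightarrow> shift x \<one>\<^bsub>G\<^esub> = \<one>\<^bsub>A\<^esub>"
  by (simp add: shift_def G_one \<phi>_one_right)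

lemma shift_mult:
  assumes "x \<in> carrier K" "g \<in> carrier G" "h \<in> carrier G"
  shows "shift x (g \<otimes>\<^bsub>G\<^esub> h) = shift x g \<otimes>\<^bsub>A\<^esub> shift (right_act K x g) h"
proof -
  have "(\<one>\<^bsub>A\<^esub>, x) \<otimes>\<^bsub>G\<^esub> (g \<otimes>\<^bsub>G\<^esub> h) = (\<one>\<^bsub>A\<^esub>, x) \<otimes>\<^bsub>G\<^esub> g \<otimes>\<^bsub>G\<^esub> h"
    using assms by (intro G_assoc[symmetric]) (auto simp: carrier_G)
  then show ?thesis using assms by (simp add: G_mult_shift)
qed

definition A_list where "A_list = (SOME as. distinct as \<and> set as = carrier A)"

lemma A_list: "distinct A_list" "set A_list = carrier A"
proof -
  have "\<exists>as. distinct as \<and> set as = carrier A" using finite_distinct_list[OF finite_A] by blast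
  from someI_ex[OF this] show "distinct A_list" "set A_list = carrier A" by (simp_all add: A_list_def)
qed

abbreviation N where "N \<equiv> length A_list"

lemma N_pos: "N > 0"
  using A_list(2) A.one_closed by (cases A_list) auto

lemma A_list_nth [simp]: "r < N \<Longrightarrow> A_list ! r \<in> carrier A"
  using A_list(2) nth_mem[of r A_list] by simp

lemma A_list_index:
  assumes "a \<in> carrier A"
  obtains r where "r < N" "\<And>s. s < N \<Longrightarrow> A_list ! s = a \<longleftrightarrow> s = r"
proof -
  obtain r where "r < N" "A_list ! r = a" using assms A_list(2) by (metis in_set_conv_nth)
  then show ?thesis using A_list(1) by (intro that[of r]) (auto simp: nth_eq_iff_index_eq)
qed

definition reg_mat where
  "reg_mat y x g = mat N N (\<lambda>(r, s). if A_list ! s = A_list ! r \<otimes>\<^bsub>A\<^esub> shift x g then \<mu>_ratio y (A_list ! r, x) g else 0)"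

lemma reg_mat_carrier [simp]: "reg_mat y x g \<in> carrier_mat N N"
  by (simp add: reg_mat_def)

lemma reg_mat_inverse:
  assumes y: "y \<in> carrier K" and x: "x \<in> carrier K" and g: "g \<in> carrier G"
  shows "\<exists>B\<in>carrier_mat N N. B * reg_mat y x g = 1\<^sub>m N \<and> reg_mat y x g * B = 1\<^sub>m N"
proof -
  define B where "B = mat N N (\<lambda>(s, r).
    if A_list ! s = A_list ! r \<otimes>\<^bsub>A\<^esub> shift x g then inverse (\<mu>_ratio y (A_list ! r, x) g) else 0)"
  have B: "B \<in> carrier_mat N N" by (simp add: B_def)
  have "reg_mat y x g * B = 1\<^sub>m N"
  proof (rule eq_matI)
    fix r r' assume "r < dim_row (1\<^sub>m N :: complex mat)" "r' < dim_col (1\<^sub>m N :: complex mat)"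
    then have r: "r < N" "r' < N" by auto
    obtain q where q: "q < N" "\<And>s. s < N \<Longrightarrow> A_list ! s = A_list ! r \<otimes>\<^bsub>A\<^esub> shift x g \<longleftrightarrow> s = q"
      by (rule A_list_index[of "A_list ! r \<otimes>\<^bsub>A\<^esub> shift x g"]) (use r x g in auto)
    have "A_list ! q = A_list ! r' \<otimes>\<^bsub>A\<^esub> shift x g \<longleftrightarrow> r = r'"
      using q(2)[OF q(1)] r x g A_list(1) by (auto simp: nth_eq_iff_index_eq)
    have "(reg_mat y x g * B) $$ (r, r') = (\<Sum>s<N. reg_mat y x g $$ (r, s) * B $$ (s, r'))"
      using r B by (intro index_mult_sum) auto
    also have "\<dots> = (\<Sum>s<N. if s = q then \<mu>_ratio y (A_list ! r, x) g * B $$ (q, r') else 0)"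
      using r q by (intro sum.cong refl) (auto simp: reg_mat_def)
    also have "\<dots> = 1\<^sub>m N $$ (r, r')"
      using r q(1) \<open>A_list ! q = _ \<longleftrightarrow> _\<close> \<mu>_ratio_nonzero[OF y _ g, of "(A_list ! r, x)"] x
      by (auto simp: B_def carrier_G)
    finally show "(reg_mat y x g * B) $$ (r, r') = 1\<^sub>m N $$ (r, r')" .
  qed (use B carrier_matD[OF reg_mat_carrier] in auto)
  then show ?thesis using mat_mult_left_right_inverse[OF reg_mat_carrier B] B by blast
qed

lemma reg_mat_one: "y \<in> carrier K \<Longrightarrow> x \<in> carrier K \<Longrightarrow> reg_mat y x \<one>\<^bsub>G\<^esub> = 1\<^sub>m N"
  using A_list(1) \<mu>_one(2)
  by (auto simp: reg_mat_def shift_one \<mu>_ratio_def nth_eq_iff_index_eq carrier_G intro!: eq_matI)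

text \<open>
  Rows are indexed by the elements of \<open>G\<close> over \<open>x\<close>, columns by those over \<open>x g\<close>, and the
  nonzero entries describe right translation by \<open>g\<close>, with scalar \<open>\<mu>_ratio\<close>;
  the permutations multiply by associativity of \<open>G\<close>, the scalars by \<open>\<mu>_ratio_cocycle\<close>.
\<close>

lemma reg_mat_mult:
  assumes y: "y \<in> carrier K" and x: "x \<in> carrier K" and g: "g \<in> carrier G" and h: "h \<in> carrier G"
  shows "\<mu> (y \<otimes>\<^bsub>K\<^esub> x) [g, h] \<cdot>\<^sub>m reg_mat y x (g \<otimes>\<^bsub>G\<^esub> h)
    = \<mu> x [g, h] \<cdot>\<^sub>m (reg_mat y x g * reg_mat y (right_act K x g) h)"
proof (rule eq_matI)
  fix r s assume "r < dim_row (\<mu> x [g, h] \<cdot>\<^sub>m (reg_mat y x g * reg_mat y (right_act K x g) h))"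
    "s < dim_col (\<mu> x [g, h] \<cdot>\<^sub>m (reg_mat y x g * reg_mat y (right_act K x g) h))"
  then have r: "r < N" "s < N" by (auto simp: reg_mat_def)
  let ?b = "A_list ! r \<otimes>\<^bsub>A\<^esub> shift x g"
  obtain q where q: "q < N" "\<And>u. u < N \<Longrightarrow> A_list ! u = ?b \<longleftrightarrow> u = q"
    by (rule A_list_index[of ?b]) (use r x g in auto)
  have Aq: "A_list ! q = ?b" using q by auto
  have "(reg_mat y x g * reg_mat y (right_act K x g) h) $$ (r, s)
    = (\<Sum>u<N. reg_mat y x g $$ (r, u) * reg_mat y (right_act K x g) h $$ (u, s))"
    using r by (intro index_mult_sum) auto
  also have "\<dots> = (\<Sum>u<N. if u = q then \<mu>_ratio y (A_list ! r, x) g * reg_mat y (right_act K x g) h $$ (q, s) else 0)"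
    using r q by (intro sum.cong refl) (auto simp: reg_mat_def)
  also have "\<dots> = (if A_list ! s = A_list ! r \<otimes>\<^bsub>A\<^esub> shift x (g \<otimes>\<^bsub>G\<^esub> h)
      then \<mu>_ratio y (A_list ! r, x) g * \<mu>_ratio y ((A_list ! r, x) \<otimes>\<^bsub>G\<^esub> g) h else 0)"
    using r q(1) x g h by (simp add: reg_mat_def Aq shift_mult A.m_assoc G_mult_shift)
  finally show "(\<mu> (y \<otimes>\<^bsub>K\<^esub> x) [g, h] \<cdot>\<^sub>m reg_mat y x (g \<otimes>\<^bsub>G\<^esub> h)) $$ (r, s)
    = (\<mu> x [g, h] \<cdot>\<^sub>m (reg_mat y x g * reg_mat y (right_act K x g) h)) $$ (r, s)"
    using r x \<mu>_ratio_cocycle[OF y _ g h, of "(A_list ! r, x)"]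
    by (simp add: reg_mat_def carrier_G right_act_def index_smult_mat(1) del: index_mult_mat(1))
qed (auto simp: reg_mat_def)

definition reg_functor where "reg_functor y = rep_functor y N (reg_mat y)"

lemma reg_functor_module: "y \<in> carrier K \<Longrightarrow> mods (reg_functor y)"
  unfolding reg_functor_def
  by (rule rep_functor_module) (auto intro: reg_mat_inverse reg_mat_one reg_mat_mult)

lemma reg_functor_obj: "fobj (reg_functor y) [x] = replicate N (y \<otimes>\<^bsub>K\<^esub> x)"
proof -
  have "[y \<otimes>\<^bsub>K\<^esub> x. _ \<leftarrow> [0..<n], x \<leftarrow> [x]] = replicate n (y \<otimes>\<^bsub>K\<^esub> x)" for n
    by (induction n) (simp_all flip: replicate_append_same)
  then show ?thesis by (simp add: reg_functor_def rep_functor_def)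
qed

lemma reg_functor_str: "fstr (reg_functor y) [x] [g] = reg_mat y x g"
proof -
  have "block_mat N 1 (\<lambda>t. reg_mat y ([x] ! (t div 1)) ([g] ! (t mod 1))) = reg_mat y x g"
    by (rule eq_matI) (auto simp: block_mat_def reg_mat_def)
  then show ?thesis by (simp add: reg_functor_def rep_functor_def)
qed

end

section \<open>The category of module endofunctors\<close>

lemma Fun_cat_sel [simp]:
  "cobj (Fun_cat C M) = {T. module_functor C M T}" "chom (Fun_cat C M) = module_nat C M"
  "cid (Fun_cat C M) T = (\<lambda>X\<in>cobj M. cid M (fobj T X))"
  "ccomp (Fun_cat C M) \<beta> \<alpha> = (\<lambda>X\<in>cobj M. ccomp M (\<beta> X) (\<alpha> X))"
  "tobj (Fun_cat C M) = fun_comp M" "tunit (Fun_cat C M) = fun_id M"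
  by (simp_all add: Fun_cat_def)

context extension_data begin

abbreviation mnat where "mnat \<equiv> module_nat (V_cat G \<omega>) (M_cat K \<mu>)"

abbreviation Fun where "Fun \<equiv> Fun_cat (V_cat G \<omega>) (M_cat K \<mu>)"

lemma mnat_natural: "\<nu> \<in> mnat S T \<Longrightarrow> natural S T \<nu>"
  by (simp add: module_nat_def natural_def)

lemma mnat_ext: "\<nu> \<in> mnat S T \<Longrightarrow> \<nu> \<in> extensional (lists (carrier K))"
  by (simp add: module_nat_def)

lemma mnat_str:
  assumes "\<nu> \<in> mnat S T" "x \<in> carrier K" "g \<in> carrier G"
  shows "fstr T [x] [g] * \<nu> [right_act K x g] = \<nu> [x] * fstr S [x] [g]"
proof -
  have x: "[x] \<in> lists (carrier K)" and g: "[g] \<in> lists (carrier G)" using assms by auto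
  have "\<forall>X\<in>lists (carrier K). \<forall>V\<in>lists (carrier G).
      fstr T X V * \<nu> (act X V) = kronecker (\<nu> X) (1\<^sub>m (length V)) * fstr S X V"
    using assms(1) by (simp add: module_nat_def)
  from this[rule_format, OF x g] show ?thesis by simp
qed

lemma zero_mnat:
  assumes S: "mods S" and T: "mods T"
  shows "(\<lambda>X\<in>lists (carrier K). 0\<^sub>m (length (fobj T X)) (length (fobj S X))) \<in> mnat S T"
proof (rule module_nat_from_simple[OF S T])
  show "natural S T (\<lambda>X. 0\<^sub>m (length (fobj T X)) (length (fobj S X)))"
    unfolding natural_def
  proof (intro conjI ballI)
    fix X Y f assume XYf: "X \<in> lists (carrier K)" "Y \<in> lists (carrier K)" "f \<in> graded_hom X Y"
    show "0\<^sub>m (length (fobj T Y)) (length (fobj S Y)) * fmor S X Y f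
      = fmor T X Y f * 0\<^sub>m (length (fobj T X)) (length (fobj S X))"
      by (simp only: left_mult_zero_mat[OF fun_mor[OF S XYf, THEN graded_homD]]
          right_mult_zero_mat[OF fun_mor[OF T XYf, THEN graded_homD]])
  qed simp
  fix x g assume "x \<in> carrier K" "g \<in> carrier G"
  then have "fstr U [x] [g] \<in> carrier_mat (length (fobj U [x])) (length (fobj U [right_act K x g]))" if "mods U" for U
    using str_graded[OF that, of "[x]" "[g]", THEN graded_homD] by simp
  from this[OF S] this[OF T]
  show "fstr T [x] [g] * 0\<^sub>m (length (fobj T [right_act K x g])) (length (fobj S [right_act K x g]))
    = 0\<^sub>m (length (fobj T [x])) (length (fobj S [x])) * fstr S [x] [g]" by simp
qed

text \<open>
  The pointwise inverse of a module natural transformation is again natural and compatible with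
  the module structures, as both conditions can be multiplied by inverses.
\<close>

lemma iso_Fun_cat:
  assumes S: "mods S" and T: "mods T" and \<nu>: "\<nu> \<in> mnat S T"
    and iso: "\<And>x. x \<in> carrier K \<Longrightarrow> iso (fobj S [x]) (fobj T [x]) (\<nu> [x])"
  shows "is_iso Fun S T \<nu>"
proof -
  note nat = mnat_natural[OF \<nu>]
  have "iso (fobj S X) (fobj T X) (\<nu> X)" if "X \<in> lists (carrier K)" for X
    by (rule natural_iso_from_simple[OF S T nat iso that])
  then have "\<forall>X\<in>lists (carrier K). \<exists>g. g \<in> graded_hom (fobj T X) (fobj S X) \<and> g * \<nu> X = 1\<^sub>m (length (fobj S X))
     \<and> \<nu> X * g = 1\<^sub>m (length (fobj T X))"
    by (auto simp: is_iso_M_cat)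
  from bchoice[OF this] obtain \<rho> where
    \<rho>: "\<And>X. X \<in> lists (carrier K) \<Longrightarrow> \<rho> X \<in> graded_hom (fobj T X) (fobj S X)"
    and inv: "\<And>X. X \<in> lists (carrier K) \<Longrightarrow> \<rho> X * \<nu> X = 1\<^sub>m (length (fobj S X))"
      "\<And>X. X \<in> lists (carrier K) \<Longrightarrow> \<nu> X * \<rho> X = 1\<^sub>m (length (fobj T X))"
    by blast
  note N = natural_graded[OF nat]
  have nat': "natural T S \<rho>"
    unfolding natural_def
  proof (intro conjI ballI)
    fix X Y f assume X: "X \<in> lists (carrier K)" and Y: "Y \<in> lists (carrier K)" and f: "f \<in> graded_hom X Y"
    note s = fun_mor[OF S X Y f] and t = fun_mor[OF T X Y f]
    have "\<rho> Y * fmor T X Y f = \<rho> Y * (fmor T X Y f * (\<nu> X * \<rho> X))"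
      by (simp only: inv(2)[OF X] right_mult_one_mat[OF t[THEN graded_homD]])
    also have "\<dots> = \<rho> Y * ((\<nu> Y * fmor S X Y f) * \<rho> X)"
      by (simp only: graded_assoc[OF t N[OF X] \<rho>[OF X], symmetric] naturalD[OF nat X Y f])
    also have "\<dots> = (\<rho> Y * \<nu> Y) * (fmor S X Y f * \<rho> X)"
      by (simp only: graded_assoc[OF N[OF Y] s \<rho>[OF X]] graded_assoc[OF \<rho>[OF Y] N[OF Y] graded_hom_mult[OF s \<rho>[OF X]]])
    also have "\<dots> = fmor S X Y f * \<rho> X"
      by (simp only: inv(1)[OF Y] left_mult_one_mat[OF graded_hom_mult[OF s \<rho>[OF X], THEN graded_homD]])
    finally show "\<rho> Y * fmor T X Y f = fmor S X Y f * \<rho> X" .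
  qed (rule \<rho>)
  have "restrict \<rho> (lists (carrier K)) \<in> mnat T S"
  proof (rule module_nat_from_simple[OF T S nat'])
    fix x g assume x: "x \<in> carrier K" and g: "g \<in> carrier G"
    have X: "[x] \<in> lists (carrier K)" and XG: "[right_act K x g] \<in> lists (carrier K)" and V: "[g] \<in> lists (carrier G)"
      using x g by auto
    let ?a = "fstr S [x] [g]" and ?b = "fstr T [x] [g]" and ?xg = "[right_act K x g]"
    have a: "?a \<in> carrier_mat (length (fobj S [x])) (length (fobj S ?xg))"
      and b: "?b \<in> carrier_mat (length (fobj T [x])) (length (fobj T ?xg))"
      using str_graded[OF S X V, THEN graded_homD] str_graded[OF T X V, THEN graded_homD] by simp_all
    note nx = N[OF X, THEN graded_homD] and ng = N[OF XG, THEN graded_homD]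
      and rx = \<rho>[OF X, THEN graded_homD] and rg = \<rho>[OF XG, THEN graded_homD]
    have "?a * \<rho> ?xg = (\<rho> [x] * \<nu> [x]) * (?a * \<rho> ?xg)"
      by (simp only: inv(1)[OF X] left_mult_one_mat[OF mult_carrier_mat[OF a rg]])
    also have "\<dots> = \<rho> [x] * ((\<nu> [x] * ?a) * \<rho> ?xg)"
      by (simp only: assoc_mult_mat[OF rx nx mult_carrier_mat[OF a rg]] assoc_mult_mat[OF nx a rg])
    also have "\<dots> = \<rho> [x] * (?b * (\<nu> ?xg * \<rho> ?xg))"
      by (simp only: mnat_str[OF \<nu> x g, symmetric] assoc_mult_mat[OF b ng rg])
    also have "\<dots> = \<rho> [x] * ?b" by (simp only: inv(2)[OF XG] right_mult_one_mat[OF b])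
    finally show "?a * \<rho> ?xg = \<rho> [x] * ?b" .
  qed
  moreover have "ccomp Fun (restrict \<rho> (lists (carrier K))) \<nu> = cid Fun S"
    "ccomp Fun \<nu> (restrict \<rho> (lists (carrier K))) = cid Fun T"
    using inv by (auto simp: fun_eq_iff restrict_def)
  ultimately show ?thesis using \<nu> unfolding is_iso_def Fun_cat_sel(2) by blast
qed

text \<open>
  The action of \<open>G\<close> on the simple objects is transitive, so the structure maps of a module functor
  express each \<open>T [x]\<close> through \<open>T [\<one>]\<close>.
\<close>

lemma right_act_transitive: "x \<in> carrier K \<Longrightarrow> (\<one>\<^bsub>A\<^esub>, x) \<in> carrier G" "x \<in> carrier K \<Longrightarrow> right_act K \<one>\<^bsub>K\<^esub> (\<one>\<^bsub>A\<^esub>, x) = x"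
  by (simp_all add: carrier_G right_act_def)

lemma str_iso_one:
  assumes T: "mods T" and g: "g \<in> carrier G"
  shows "iso (fobj T [snd g]) (act (fobj T [\<one>\<^bsub>K\<^esub>]) [g]) (fstr T [\<one>\<^bsub>K\<^esub>] [g])"
  using str_iso[OF T, of "[\<one>\<^bsub>K\<^esub>]" "[g]"] g by (simp add: right_act_def)

lemma length_fun_single:
  assumes T: "mods T" and x: "x \<in> carrier K"
  shows "length (fobj T [x]) = length (fobj T [\<one>\<^bsub>K\<^esub>])"
  using iso_M_cat_length[OF str_iso_one[OF T right_act_transitive(1)[OF x]]] by simp

lemma fobj_replicate:
  assumes T: "mods T" and x: "x \<in> carrier K" and "fobj T [\<one>\<^bsub>K\<^esub>] = replicate n k"
  shows "fobj T [x] = replicate n (k \<otimes>\<^bsub>K\<^esub> x)"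
proof -
  have "act (fobj T [\<one>\<^bsub>K\<^esub>]) [(\<one>\<^bsub>A\<^esub>, x)] = replicate n (k \<otimes>\<^bsub>K\<^esub> x)"
    unfolding assms(3) by (induction n) (simp_all add: right_act_def)
  then show ?thesis
    using iso_M_cat_replicate[of K \<mu> "fobj T [x]" n "k \<otimes>\<^bsub>K\<^esub> x"] str_iso_one[OF T right_act_transitive(1)[OF x]] by simp
qed

lemma length_fun:
  assumes T: "mods T" and X: "X \<in> lists (carrier K)"
  shows "length (fobj T X) = length X * length (fobj T [\<one>\<^bsub>K\<^esub>])"
proof -
  have "length (fobj T X) = (\<Sum>i<length X. length (fobj T [\<one>\<^bsub>K\<^esub>]))"
    unfolding fun_length[OF T X] using X by (intro sum.cong refl length_fun_single[OF T]) auto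
  then show ?thesis by simp
qed

text \<open>
  By transitivity and additivity the length of \<open>T [\<one>]\<close> determines the length of every \<open>T X\<close>. If it
  is positive, the identity and the zero transformation of \<open>T\<close> differ.
\<close>

lemma zero_object_Fun:
  assumes T: "mods T"
  shows "zero_object Fun T \<longleftrightarrow> fobj T [\<one>\<^bsub>K\<^esub>] = []"
proof
  assume "zero_object Fun T"
  then have uniq: "\<exists>!f. f \<in> mnat T T" using T by (auto simp: zero_object_def)
  have "restrict (\<lambda>X. 1\<^sub>m (length (fobj T X))) (lists (carrier K)) \<in> mnat T T"
  proof (rule module_nat_from_simple[OF T T])
    show "natural T T (\<lambda>X. 1\<^sub>m (length (fobj T X)))"
      unfolding natural_def
    proof (intro conjI ballI)
      fix X Y f assume XYf: "X \<in> lists (carrier K)" "Y \<in> lists (carrier K)" "f \<in> graded_hom X Y"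
      show "1\<^sub>m (length (fobj T Y)) * fmor T X Y f = fmor T X Y f * 1\<^sub>m (length (fobj T X))"
        using fun_mor[OF T XYf, THEN graded_homD] by (simp only: left_mult_one_mat right_mult_one_mat)
    qed simp
    fix x g assume "x \<in> carrier K" "g \<in> carrier G"
    then have "fstr T [x] [g] \<in> carrier_mat (length (fobj T [x])) (length (fobj T [right_act K x g]))"
      using str_graded[OF T, of "[x]" "[g]", THEN graded_homD] by simp
    then show "fstr T [x] [g] * 1\<^sub>m (length (fobj T [right_act K x g])) = 1\<^sub>m (length (fobj T [x])) * fstr T [x] [g]"
      by simp
  qed
  with zero_mnat[OF T T] uniq have "(\<lambda>X\<in>lists (carrier K). 0\<^sub>m (length (fobj T X)) (length (fobj T X)))
    = restrict (\<lambda>X. 1\<^sub>m (length (fobj T X)) :: complex mat) (lists (carrier K))" by blast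
  from fun_cong[OF this, of "[\<one>\<^bsub>K\<^esub>]"]
  have eq: "0\<^sub>m (length (fobj T [\<one>\<^bsub>K\<^esub>])) (length (fobj T [\<one>\<^bsub>K\<^esub>])) = (1\<^sub>m (length (fobj T [\<one>\<^bsub>K\<^esub>])) :: complex mat)"
    by simp
  show "fobj T [\<one>\<^bsub>K\<^esub>] = []"
  proof (rule ccontr)
    assume "fobj T [\<one>\<^bsub>K\<^esub>] \<noteq> []"
    then show False using arg_cong[OF eq, of "\<lambda>m. m $$ (0, 0)"] by simp
  qed
next
  assume "fobj T [\<one>\<^bsub>K\<^esub>] = []"
  then have len: "length (fobj T X) = 0" if "X \<in> lists (carrier K)" for X using length_fun[OF T that] by simp
  have empty: "f = g" if "f \<in> carrier_mat m n" "g \<in> carrier_mat m n" "m = 0 \<or> n = 0" for f g :: "complex mat" and m n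
    using that by (intro eq_matI) auto
  have "(\<exists>!f. f \<in> mnat T Y) \<and> (\<exists>!f. f \<in> mnat Y T)" if Y: "mods Y" for Y
  proof -
    have "f = g" if "f \<in> mnat U W" "g \<in> mnat U W" "U = T \<or> W = T" for U W f g
    proof (rule extensionalityI[OF mnat_ext[OF that(1)] mnat_ext[OF that(2)]])
      fix X assume X: "X \<in> lists (carrier K)"
      show "f X = g X"
        using natural_graded[OF mnat_natural[OF that(1)] X, THEN graded_homD]
          natural_graded[OF mnat_natural[OF that(2)] X, THEN graded_homD] that(3) len[OF X]
        by (intro empty) auto
    qed
    then show ?thesis using zero_mnat[OF T Y] zero_mnat[OF Y T] by blast
  qed
  then show "zero_object Fun T" using T by (simp add: zero_object_def)
qed

section \<open>Monomorphisms are injective\<close>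

lemma scalar_fmor:
  assumes T: "mods T" and x: "x \<in> carrier K"
  shows "fmor T [x] [x] (c \<cdot>\<^sub>m 1\<^sub>m (Suc 0)) = c \<cdot>\<^sub>m 1\<^sub>m (length (fobj T [x]))"
  using fun_scale[OF T, of "[x]" "[x]" "1\<^sub>m (Suc 0)" c] fun_id[OF T, of "[x]"] graded_hom_one[of "[x]"] x by simp

lemma diagonal_single: "diagonal [c] = c \<cdot>\<^sub>m 1\<^sub>m (Suc 0)"
  by (rule eq_matI) (auto simp: diagonal_def mat_diag_def)

lemma str_pentagon_single:
  assumes T: "mods T" and x: "x \<in> carrier K" and g: "g \<in> carrier G" and h: "h \<in> carrier G"
  shows "diagonal [\<mu> z [g, h]. z \<leftarrow> fobj T [x]] * fstr T [x] [g \<otimes>\<^bsub>G\<^esub> h]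
    = \<mu> x [g, h] \<cdot>\<^sub>m (fstr T [x] [g] * fstr T [right_act K x g] [h])"
proof -
  let ?xg = "right_act K x g" and ?xgh = "right_act K x (g \<otimes>\<^bsub>G\<^esub> h)"
  have lists: "[x] \<in> lists (carrier K)" "[?xg] \<in> lists (carrier K)" "[g] \<in> lists (carrier G)" "[h] \<in> lists (carrier G)"
    using x g h by auto
  have a: "fstr T [x] [g] \<in> carrier_mat (length (fobj T [x])) (length (fobj T [?xg]))"
    using str_graded[OF T lists(1,3), THEN graded_homD] by simp
  have b: "fstr T [?xg] [h] \<in> carrier_mat (length (fobj T [?xg])) (length (fobj T [?xgh]))"
    using str_graded[OF T lists(2,4), THEN graded_homD] x g h by (simp add: right_act_mult)
  have "diagonal [\<mu> z [g, h]. z \<leftarrow> fobj T [x]] * fstr T [x] [g \<otimes>\<^bsub>G\<^esub> h]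
    = fstr T [x] [g] * (fstr T [?xg] [h] * fmor T [?xgh] [?xgh] (diagonal [\<mu> x [g, h]]))"
    using str_pentagon[OF T lists(1,3,4)] x g h by (simp add: right_act_mult)
  also have "fmor T [?xgh] [?xgh] (diagonal [\<mu> x [g, h]]) = \<mu> x [g, h] \<cdot>\<^sub>m 1\<^sub>m (length (fobj T [?xgh]))"
    using scalar_fmor[OF T, of ?xgh] x g h by (simp add: diagonal_single)
  also have "fstr T [x] [g] * (fstr T [?xg] [h] * (\<mu> x [g, h] \<cdot>\<^sub>m 1\<^sub>m (length (fobj T [?xgh]))))
    = \<mu> x [g, h] \<cdot>\<^sub>m (fstr T [x] [g] * fstr T [?xg] [h])"
    using a b by (simp add: mult_smult_distrib[OF b one_carrier_mat] mult_smult_distrib[OF a b])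
  finally show ?thesis .
qed

text \<open>
  Only the entries of \<open>u\<close> at positions of degree \<open>y\<close> are nonzero, and there \<open>c\<close> has the value
  \<open>c y\<close>.
\<close>

lemma diagonal_mult_graded:
  assumes "u \<in> graded_hom [y] zs"
  shows "diagonal (map c zs) * u = c y \<cdot>\<^sub>m u"
proof (rule eq_matI)
  fix i j assume "i < dim_row (c y \<cdot>\<^sub>m u)" "j < dim_col (c y \<cdot>\<^sub>m u)"
  then have ij: "i < length zs" "j = 0" using assms[THEN graded_homD] by auto
  have "(diagonal (map c zs) * u) $$ (i, j) = (\<Sum>k<length zs. diagonal (map c zs) $$ (i, k) * u $$ (k, j))"
    using ij assms[THEN graded_homD]
    by (intro index_mult_sum[of _ _ "length zs" _ 1]) (auto simp: diagonal_def mat_diag_def)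
  also have "\<dots> = (\<Sum>k<length zs. if k = i then c (zs ! i) * u $$ (i, j) else 0)"
    using ij by (intro sum.cong refl) (auto simp: diagonal_def mat_diag_def)
  also have "\<dots> = (c y \<cdot>\<^sub>m u) $$ (i, j)"
    using ij assms[THEN graded_homD] graded_hom_nonzeroD[OF assms, of i j] by (cases "u $$ (i, j) = 0") auto
  finally show "(diagonal (map c zs) * u) $$ (i, j) = (c y \<cdot>\<^sub>m u) $$ (i, j)" .
qed (use assms[THEN graded_homD] in \<open>auto simp: diagonal_def mat_diag_def\<close>)

lemma columns_eqI:
  fixes P Q :: "complex mat"
  assumes "P \<in> carrier_mat m n" "Q \<in> carrier_mat m n" "\<And>r. r < n \<Longrightarrow> P * incl n r = Q * incl n r"
  shows "P = Q"
proof (rule eq_matI)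
  fix i r assume "i < dim_row Q" "r < dim_col Q"
  then have "i < m" "r < n" using assms by auto
  then show "P $$ (i, r) = Q $$ (i, r)"
    using arg_cong[OF assms(3)[of r], of "\<lambda>M. M $$ (i, 0)"] by (simp add: mult_incl[OF assms(1)] mult_incl[OF assms(2)])
qed (use assms in auto)

text \<open>
  The regular functor represents the functor that sends \<open>Z\<close> to the morphisms \<open>[y] \<rightarrow> Z [\<one>]\<close>: the
  basis vector \<open>g\<close> over \<open>x\<close> must go to \<open>u \<otimes> g\<close>, pulled back along the structure isomorphism
  \<open>Z [x] \<cong> Z [\<one>] \<otimes> [g]\<close>, and the pentagon axiom of \<open>Z\<close> makes this a module transformation. It is
  recorded together with its naturality in \<open>Z\<close>: if \<open>f\<close> kills \<open>u\<close>, it kills the transformation.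
\<close>

lemma yoneda:
  assumes Z: "mods Z" and y: "y \<in> carrier K" and u: "u \<in> graded_hom [y] (fobj Z [\<one>\<^bsub>K\<^esub>])"
  obtains \<theta> v where "\<theta> \<in> mnat (reg_functor y) Z" "v \<in> carrier_mat (length (fobj (reg_functor y) [\<one>\<^bsub>K\<^esub>])) 1"
    "\<theta> [\<one>\<^bsub>K\<^esub>] * v = u"
    "\<And>Y f x. mods Y \<Longrightarrow> f \<in> mnat Z Y \<Longrightarrow> f [\<one>\<^bsub>K\<^esub>] * u = 0\<^sub>m (length (fobj Y [\<one>\<^bsub>K\<^esub>])) 1 \<Longrightarrow> x \<in> carrier K
      \<Longrightarrow> f [x] * \<theta> [x] = 0\<^sub>m (length (fobj Y [x])) (length (fobj (reg_functor y) [x]))"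
proof -
  let ?T = "reg_functor y"
  define n where "n = length (fobj Z [\<one>\<^bsub>K\<^esub>])"
  note T = reg_functor_module[OF y]
  have len: "length (fobj Z [x]) = n" if "x \<in> carrier K" for x unfolding n_def by (rule length_fun_single[OF Z that])
  have lenT: "length (fobj ?T [x]) = N" for x by (simp add: reg_functor_obj)
  have uc: "u \<in> carrier_mat n 1" using u[THEN graded_homD] by (simp add: n_def)
  have "\<forall>g\<in>carrier G. \<exists>J. J \<in> graded_hom (act (fobj Z [\<one>\<^bsub>K\<^esub>]) [g]) (fobj Z [snd g]) \<and>
      J * fstr Z [\<one>\<^bsub>K\<^esub>] [g] = 1\<^sub>m n \<and> fstr Z [\<one>\<^bsub>K\<^esub>] [g] * J = 1\<^sub>m n"
  proof
    fix g assume g: "g \<in> carrier G"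
    show "\<exists>J. J \<in> graded_hom (act (fobj Z [\<one>\<^bsub>K\<^esub>]) [g]) (fobj Z [snd g]) \<and>
      J * fstr Z [\<one>\<^bsub>K\<^esub>] [g] = 1\<^sub>m n \<and> fstr Z [\<one>\<^bsub>K\<^esub>] [g] * J = 1\<^sub>m n"
      using str_iso_one[OF Z g] len[OF snd_G(1)[OF g]] by (auto simp: is_iso_M_cat n_def)
  qed
  from bchoice[OF this] obtain J where
    J: "\<And>g. g \<in> carrier G \<Longrightarrow> J g \<in> graded_hom (act (fobj Z [\<one>\<^bsub>K\<^esub>]) [g]) (fobj Z [snd g])"
    and J_inv: "\<And>g. g \<in> carrier G \<Longrightarrow> J g * fstr Z [\<one>\<^bsub>K\<^esub>] [g] = 1\<^sub>m n"
      "\<And>g. g \<in> carrier G \<Longrightarrow> fstr Z [\<one>\<^bsub>K\<^esub>] [g] * J g = 1\<^sub>m n" by blast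
  have Jc: "J g \<in> carrier_mat n n" if "g \<in> carrier G" for g
    using J[OF that, THEN graded_homD] len that by simp
  have strc: "fstr Z [x] [g] \<in> carrier_mat n n" if "x \<in> carrier K" "g \<in> carrier G" for x g
    using str_graded[OF Z, of "[x]" "[g]", THEN graded_homD] len that by simp
  define w where "w g = J g * u" for g
  have w: "w g \<in> graded_hom [y \<otimes>\<^bsub>K\<^esub> snd g] (fobj Z [snd g])" if g: "g \<in> carrier G" for g
  proof -
    have "u \<in> graded_hom (act [y] [g]) (act (fobj Z [\<one>\<^bsub>K\<^esub>]) [g])"
      using kronecker_graded[OF u graded_hom_one[of "[g]"], of "right_act K"] by simp
    then show ?thesis using graded_hom_mult[OF J[OF g]] by (simp add: w_def right_act_def)
  qed
  have wc: "w g \<in> carrier_mat n 1" if "g \<in> carrier G" for g using w[OF that, THEN graded_homD] len that by simp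
  \<comment> \<open>The pentagon axiom of \<open>Z\<close> at \<open>[\<one>]\<close>, applied to \<open>u\<close>, where the associativity constraint of
    \<open>Z [\<one>]\<close> acts by its value at the degree \<open>y\<close> of \<open>u\<close>.\<close>
  have w_mult: "fstr Z [snd g] [h] * w (g \<otimes>\<^bsub>G\<^esub> h) = \<mu>_ratio y g h \<cdot>\<^sub>m w g" if g: "g \<in> carrier G" and h: "h \<in> carrier G" for g h
  proof -
    let ?s = "fstr Z [\<one>\<^bsub>K\<^esub>]" and ?c = "\<mu> \<one>\<^bsub>K\<^esub> [g, h]" and ?W = "fstr Z [snd g] [h] * w (g \<otimes>\<^bsub>G\<^esub> h)"
    have gh: "g \<otimes>\<^bsub>G\<^esub> h \<in> carrier G" and sg: "snd g \<in> carrier K" using g h by auto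
    have Wc: "?W \<in> carrier_mat n 1" using strc[OF sg h] wc[OF gh] by auto
    have D: "diagonal (map (\<lambda>z. \<mu> z [g, h]) (fobj Z [\<one>\<^bsub>K\<^esub>])) \<in> carrier_mat n n"
      by (simp add: diagonal_def mat_diag_def n_def)
    have "\<mu> y [g, h] \<cdot>\<^sub>m u = diagonal (map (\<lambda>z. \<mu> z [g, h]) (fobj Z [\<one>\<^bsub>K\<^esub>])) * u"
      by (rule diagonal_mult_graded[OF u, symmetric])
    also have "\<dots> = diagonal (map (\<lambda>z. \<mu> z [g, h]) (fobj Z [\<one>\<^bsub>K\<^esub>])) * ((?s [g \<otimes>\<^bsub>G\<^esub> h] * J (g \<otimes>\<^bsub>G\<^esub> h)) * u)"
      using uc by (simp add: J_inv(2)[OF gh])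
    also have "\<dots> = (diagonal (map (\<lambda>z. \<mu> z [g, h]) (fobj Z [\<one>\<^bsub>K\<^esub>])) * ?s [g \<otimes>\<^bsub>G\<^esub> h]) * w (g \<otimes>\<^bsub>G\<^esub> h)"
      using strc[OF K.one_closed gh] Jc[OF gh] uc D wc[OF gh]
      by (simp add: w_def assoc_mult_mat[OF strc[OF K.one_closed gh] Jc[OF gh] uc]
          assoc_mult_mat[OF D strc[OF K.one_closed gh] mult_carrier_mat[OF Jc[OF gh] uc]])
    also have "\<dots> = (?c \<cdot>\<^sub>m (?s [g] * fstr Z [snd g] [h])) * w (g \<otimes>\<^bsub>G\<^esub> h)"
      using str_pentagon_single[OF Z K.one_closed g h] g by (simp add: right_act_def)
    also have "\<dots> = ?c \<cdot>\<^sub>m (?s [g] * ?W)"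
      by (simp only: mult_smult_assoc_mat[OF mult_carrier_mat[OF strc[OF K.one_closed g] strc[OF sg h]] wc[OF gh]]
          assoc_mult_mat[OF strc[OF K.one_closed g] strc[OF sg h] wc[OF gh]])
    finally have *: "\<mu> y [g, h] \<cdot>\<^sub>m u = ?c \<cdot>\<^sub>m (?s [g] * ?W)" .
    have "?c \<cdot>\<^sub>m ?W = ?c \<cdot>\<^sub>m ((J g * ?s [g]) * ?W)"
      using left_mult_one_mat[OF Wc] by (simp add: J_inv(1)[OF g])
    also have "\<dots> = J g * (\<mu> y [g, h] \<cdot>\<^sub>m u)"
      by (simp only: * assoc_mult_mat[OF Jc[OF g] strc[OF K.one_closed g] Wc]
          mult_smult_distrib[OF Jc[OF g] mult_carrier_mat[OF strc[OF K.one_closed g] Wc]])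
    also have "\<dots> = \<mu> y [g, h] \<cdot>\<^sub>m w g" by (simp add: w_def mult_smult_distrib[OF Jc[OF g] uc])
    finally have eq: "?c \<cdot>\<^sub>m ?W = \<mu> y [g, h] \<cdot>\<^sub>m w g" .
    show ?thesis
    proof (rule eq_matI)
      fix i j assume ij: "i < dim_row (\<mu>_ratio y g h \<cdot>\<^sub>m w g)" "j < dim_col (\<mu>_ratio y g h \<cdot>\<^sub>m w g)"
      then have ij': "i < n" "j < 1" using wc[OF g] by auto
      have "?c * ?W $$ (i, j) = \<mu> y [g, h] * w g $$ (i, j)"
        using arg_cong[OF eq, of "\<lambda>M. M $$ (i, j)"] ij' carrier_matD[OF Wc] carrier_matD[OF wc[OF g]]
        by (simp only: index_smult_mat(1))
      then show "?W $$ (i, j) = (\<mu>_ratio y g h \<cdot>\<^sub>m w g) $$ (i, j)"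
        using ij \<mu>_nonzero[OF K.one_closed g h] by (simp add: \<mu>_ratio_def field_simps del: index_mult_mat(1))
    qed (use wc[OF g] Wc in auto)
  qed
  \<comment> \<open>The column of \<open>\<theta>0 x\<close> at an element of \<open>A\<close> is the image of the corresponding basis vector.\<close>
  define \<theta>0 where "\<theta>0 x = mat n N (\<lambda>(i, r). w (A_list ! r, x) $$ (i, 0))" for x
  have in_G: "(A_list ! r, x) \<in> carrier G" if "r < N" "x \<in> carrier K" for r x using that by (simp add: carrier_G)
  have \<theta>0c: "\<theta>0 x \<in> carrier_mat n N" for x by (simp add: \<theta>0_def)
  have \<theta>0_col: "\<theta>0 x * incl N r = w (A_list ! r, x)" if "r < N" "x \<in> carrier K" for x r
    using wc[OF in_G[OF that]] that by (subst mult_incl[OF \<theta>0c]) (auto simp: \<theta>0_def intro!: eq_matI)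
  have \<theta>0: "\<theta>0 x \<in> graded_hom (fobj ?T [x]) (fobj Z [x])" if x: "x \<in> carrier K" for x
  proof -
    have "\<theta>0 x $$ (i, r) = 0" if "i < n" "r < N" "fobj Z [x] ! i \<noteq> y \<otimes>\<^bsub>K\<^esub> x" for i r
      using that len[OF x] graded_hom_nonzeroD[OF w[OF in_G[OF that(2) x]], of i 0] by (auto simp: \<theta>0_def)
    then show ?thesis using \<theta>0c[of x] len[OF x] by (auto simp: graded_hom_def reg_functor_obj)
  qed
  let ?E = "extend_simple ?T Z \<theta>0"
  let ?\<theta> = "restrict ?E (lists (carrier K))"
  have E: "?E [x] = \<theta>0 x" if "x \<in> carrier K" for x by (rule extend_simple_single[OF T Z \<theta>0 that])
  have "?\<theta> \<in> mnat ?T Z"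
  proof (rule module_nat_from_simple[OF T Z extend_simple_natural[OF T Z \<theta>0]])
    fix x h assume x: "x \<in> carrier K" and h: "h \<in> carrier G"
    let ?xh = "right_act K x h" and ?S = "reg_mat y x h"
    have xh: "?xh \<in> carrier K" using x h by simp
    have "fstr Z [x] [h] * \<theta>0 ?xh = \<theta>0 x * ?S"
    proof (rule columns_eqI)
      show "fstr Z [x] [h] * \<theta>0 ?xh \<in> carrier_mat n N" by (rule mult_carrier_mat[OF strc[OF x h] \<theta>0c])
      show "\<theta>0 x * ?S \<in> carrier_mat n N" by (rule mult_carrier_mat[OF \<theta>0c reg_mat_carrier])
      fix s assume s: "s < N"
      \<comment> \<open>The only nonzero entry of this column of \<open>?S\<close> is in the row of the preimage under translation.\<close>
      let ?a = "A_list ! s \<otimes>\<^bsub>A\<^esub> inv\<^bsub>A\<^esub> shift x h"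
      have a: "?a \<in> carrier A" using s x h by simp
      obtain r where r: "r < N" "A_list ! r = ?a" using A_list_index[OF a] by blast
      have rs: "A_list ! s = A_list ! r \<otimes>\<^bsub>A\<^esub> shift x h" using s x h by (simp add: r A.m_assoc)
      have g: "(A_list ! r, x) \<in> carrier G" using in_G[OF r(1) x] .
      have gh: "(A_list ! s, ?xh) = (A_list ! r, x) \<otimes>\<^bsub>G\<^esub> h" using r(1) x h by (simp add: G_mult_shift rs)
      have uniq: "A_list ! s = A_list ! r' \<otimes>\<^bsub>A\<^esub> shift x h \<longleftrightarrow> r' = r" if "r' < N" for r'
        unfolding rs using that r(1) x h A_list(1) by (auto simp: nth_eq_iff_index_eq)
      have col: "?S * incl N s = \<mu>_ratio y (A_list ! r, x) h \<cdot>\<^sub>m incl N r"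
        using s r(1) uniq by (subst mult_incl[OF reg_mat_carrier]) (auto simp: incl_def reg_mat_def intro!: eq_matI)
      have "fstr Z [x] [h] * \<theta>0 ?xh * incl N s = fstr Z [x] [h] * w ((A_list ! r, x) \<otimes>\<^bsub>G\<^esub> h)"
        by (simp add: assoc_mult_mat[OF strc[OF x h] \<theta>0c incl_carrier] \<theta>0_col[OF s xh] gh)
      also have "\<dots> = \<mu>_ratio y (A_list ! r, x) h \<cdot>\<^sub>m w (A_list ! r, x)" using w_mult[OF g h] by simp
      also have "\<dots> = \<theta>0 x * ?S * incl N s"
        by (simp add: assoc_mult_mat[OF \<theta>0c reg_mat_carrier incl_carrier] col
            mult_smult_distrib[OF \<theta>0c incl_carrier] \<theta>0_col[OF r(1) x])
      finally show "fstr Z [x] [h] * \<theta>0 ?xh * incl N s = \<theta>0 x * ?S * incl N s" .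
    qed
    then show "fstr Z [x] [h] * ?E [?xh] = ?E [x] * fstr ?T [x] [h]"
      by (simp add: E x xh reg_functor_str)
  qed
  moreover obtain r where r: "r < N" "A_list ! r = \<one>\<^bsub>A\<^esub>" using A_list_index[OF A.one_closed] by blast
  have "?\<theta> [\<one>\<^bsub>K\<^esub>] * incl N r = u"
  proof -
    have one: "fstr Z [\<one>\<^bsub>K\<^esub>] [\<one>\<^bsub>G\<^esub>] = 1\<^sub>m n" by (simp add: str_unit[OF Z] n_def)
    have "?\<theta> [\<one>\<^bsub>K\<^esub>] * incl N r = w \<one>\<^bsub>G\<^esub>" using \<theta>0_col[OF r(1) K.one_closed] by (simp add: E r G_one)
    also have "\<dots> = u"
      using J_inv(1)[OF G_one_closed] right_mult_one_mat[OF Jc[OF G_one_closed]] left_mult_one_mat[OF uc]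
      by (simp add: w_def one)
    finally show ?thesis .
  qed
  moreover have "f [x] * ?\<theta> [x] = 0\<^sub>m (length (fobj Y [x])) (length (fobj ?T [x]))"
    if Y: "mods Y" and f: "f \<in> mnat Z Y" and fu: "f [\<one>\<^bsub>K\<^esub>] * u = 0\<^sub>m (length (fobj Y [\<one>\<^bsub>K\<^esub>])) 1" and x: "x \<in> carrier K" for Y f x
  proof -
    let ?m = "length (fobj Y [\<one>\<^bsub>K\<^esub>])"
    have lenY: "length (fobj Y [x]) = ?m" by (rule length_fun_single[OF Y x])
    have fc: "f [z] \<in> carrier_mat ?m n" if "z \<in> carrier K" for z
      using natural_graded[OF mnat_natural[OF f], of "[z]", THEN graded_homD] that
      by (simp add: len length_fun_single[OF Y that])
    have "f [x] * \<theta>0 x = 0\<^sub>m ?m N"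
    proof (rule columns_eqI[of _ ?m N])
      fix r assume r: "r < N"
      define g where "g = (A_list ! r, x)"
      have g: "g \<in> carrier G" and sg: "snd g = x" using in_G[OF r x] by (auto simp: g_def)
      obtain I where I: "I \<in> carrier_mat ?m ?m" "I * fstr Y [\<one>\<^bsub>K\<^esub>] [g] = 1\<^sub>m ?m"
        using str_iso_one[OF Y g] lenY by (auto simp: is_iso_M_cat sg dest!: graded_homD)
      have Ys: "fstr Y [\<one>\<^bsub>K\<^esub>] [g] \<in> carrier_mat ?m ?m"
        using str_graded[OF Y, of "[\<one>\<^bsub>K\<^esub>]" "[g]", THEN graded_homD] lenY g x by (simp add: right_act_def sg)
      have nat: "fstr Y [\<one>\<^bsub>K\<^esub>] [g] * f [x] = f [\<one>\<^bsub>K\<^esub>] * fstr Z [\<one>\<^bsub>K\<^esub>] [g]"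
        using mnat_str[OF f K.one_closed g] g x by (simp add: right_act_def sg)
      have fw: "f [x] * w g \<in> carrier_mat ?m 1" by (rule mult_carrier_mat[OF fc[OF x] wc[OF g]])
      note Zs = strc[OF K.one_closed g]
      have "fstr Y [\<one>\<^bsub>K\<^esub>] [g] * (f [x] * w g) = f [\<one>\<^bsub>K\<^esub>] * ((fstr Z [\<one>\<^bsub>K\<^esub>] [g] * J g) * u)"
        by (simp only: w_def assoc_mult_mat[OF Ys fc[OF x] mult_carrier_mat[OF Jc[OF g] uc], symmetric] nat
            assoc_mult_mat[OF fc[OF K.one_closed] Zs mult_carrier_mat[OF Jc[OF g] uc]] assoc_mult_mat[OF Zs Jc[OF g] uc])
      also have "\<dots> = 0\<^sub>m ?m 1" using fu left_mult_one_mat[OF uc] by (simp add: J_inv(2)[OF g])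
      finally have "I * (fstr Y [\<one>\<^bsub>K\<^esub>] [g] * (f [x] * w g)) = 0\<^sub>m ?m 1" using I(1) by simp
      then have "f [x] * w g = 0\<^sub>m ?m 1"
        using left_mult_one_mat[OF fw] by (simp add: assoc_mult_mat[OF I(1) Ys fw, symmetric] I(2))
      then show "f [x] * \<theta>0 x * incl N r = 0\<^sub>m ?m N * incl N r"
        using left_mult_zero_mat[OF incl_carrier, of ?m N r]
        by (simp add: assoc_mult_mat[OF fc[OF x] \<theta>0c incl_carrier] \<theta>0_col[OF r x] g_def)
    qed (rule mult_carrier_mat[OF fc[OF x] \<theta>0c], simp)
    then show ?thesis using x by (simp add: E lenY lenT)
  qed
  ultimately show ?thesis using that[of ?\<theta> "incl N r"] by (simp add: lenT)
qed

text \<open>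
  Morphisms from the regular functor test injectivity, so no kernels of module functors have to
  be constructed: if \<open>f u = 0\<close>, the transformation that represents \<open>u\<close> is equalized by \<open>f\<close> with
  the zero transformation, hence vanishes.
\<close>

lemma mono_Fun_injective:
  assumes Z: "mods Z" and Y: "mods Y" and f: "is_mono Fun Z Y f"
    and y: "y \<in> carrier K" and u: "u \<in> graded_hom [y] (fobj Z [\<one>\<^bsub>K\<^esub>])"
    and fu: "f [\<one>\<^bsub>K\<^esub>] * u = 0\<^sub>m (length (fobj Y [\<one>\<^bsub>K\<^esub>])) 1"
  shows "u = 0\<^sub>m (length (fobj Z [\<one>\<^bsub>K\<^esub>])) 1"
proof -
  let ?T = "reg_functor y"
  note T = reg_functor_module[OF y]
  have fn: "f \<in> mnat Z Y" using f by (simp add: is_mono_def)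
  obtain \<theta> v where \<theta>: "\<theta> \<in> mnat ?T Z" and v: "v \<in> carrier_mat (length (fobj ?T [\<one>\<^bsub>K\<^esub>])) 1" "\<theta> [\<one>\<^bsub>K\<^esub>] * v = u"
    and f\<theta>: "\<And>x. x \<in> carrier K \<Longrightarrow> f [x] * \<theta> [x] = 0\<^sub>m (length (fobj Y [x])) (length (fobj ?T [x]))"
    using yoneda[OF Z y u] fn fu Y by metis
  note nf = mnat_natural[OF fn] and n\<theta> = mnat_natural[OF \<theta>]
  have "f X * \<theta> X = 0\<^sub>m (length (fobj Y X)) (length (fobj ?T X))" if X: "X \<in> lists (carrier K)" for X
  proof (rule eq_on_summands[OF T X])
    note fX = natural_graded[OF nf X] and \<theta>X = natural_graded[OF n\<theta> X]
    show "f X * \<theta> X \<in> carrier_mat (length (fobj Y X)) (length (fobj ?T X))"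
      by (rule graded_homD[OF graded_hom_mult[OF fX \<theta>X]])
    fix i assume i: "i < length X"
    let ?x = "X ! i"
    have x: "?x \<in> carrier K" "[?x] \<in> lists (carrier K)" using X i by auto
    note t = fun_incl[OF T X i] and z = fun_incl[OF Z X i] and y' = fun_incl[OF Y X i]
    note fx = natural_graded[OF nf x(2)] and \<theta>x = natural_graded[OF n\<theta> x(2)]
    have "f X * \<theta> X * fmor ?T [?x] X (incl (length X) i) = f X * fmor Z [?x] X (incl (length X) i) * \<theta> [?x]"
      by (simp only: graded_assoc[OF fX \<theta>X t] naturalD[OF n\<theta> x(2) X incl_graded[OF i]] graded_assoc[OF fX z \<theta>x])
    also have "\<dots> = fmor Y [?x] X (incl (length X) i) * (f [?x] * \<theta> [?x])"
      by (simp only: naturalD[OF nf x(2) X incl_graded[OF i]] graded_assoc[OF y' fx \<theta>x])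
    also have "\<dots> = 0\<^sub>m (length (fobj Y X)) (length (fobj ?T X)) * fmor ?T [?x] X (incl (length X) i)"
      using y'[THEN graded_homD] t[THEN graded_homD] by (simp add: f\<theta>[OF x(1)])
    finally show "f X * \<theta> X * fmor ?T [?x] X (incl (length X) i)
      = 0\<^sub>m (length (fobj Y X)) (length (fobj ?T X)) * fmor ?T [?x] X (incl (length X) i)" .
  qed simp
  note f\<theta>X = this
  have "ccomp Fun f \<theta> = ccomp Fun f (\<lambda>X\<in>lists (carrier K). 0\<^sub>m (length (fobj Z X)) (length (fobj ?T X)))"
  proof (rule ext)
    fix X
    show "ccomp Fun f \<theta> X = ccomp Fun f (\<lambda>X\<in>lists (carrier K). 0\<^sub>m (length (fobj Z X)) (length (fobj ?T X))) X"
    proof (cases "X \<in> lists (carrier K)")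
      case True
      then show ?thesis
        using f\<theta>X[OF True] right_mult_zero_mat[OF natural_graded[OF nf True, THEN graded_homD]]
        by (simp del: in_lists_conv_set)
    qed (simp del: in_lists_conv_set)
  qed
  then have "\<theta> = (\<lambda>X\<in>lists (carrier K). 0\<^sub>m (length (fobj Z X)) (length (fobj ?T X)))"
    using f \<theta> zero_mnat[OF T Z] T by (auto simp: is_mono_def)
  then show ?thesis using v by simp
qed

section \<open>The simple functor over an element of the quotient\<close>

text \<open>
  A monomorphism \<open>Z \<rightarrow> Y\<close> is injective on \<open>Z [\<one>]\<close>. Hence \<open>Z [\<one>]\<close> is also a multiple of \<open>k\<close>, of
  multiplicity at most \<open>n\<close>, and by minimality either \<open>0\<close> or exactly \<open>n\<close>. In the second case the
  morphism is invertible at \<open>[\<one>]\<close>, and by transitivity everywhere.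
\<close>

lemma minimal_functor_simple:
  assumes k: "k \<in> carrier K" and Y: "mods Y" and Y1: "fobj Y [\<one>\<^bsub>K\<^esub>] = replicate n k" and n: "n > 0"
    and minimal: "\<And>Z m. mods Z \<Longrightarrow> fobj Z [\<one>\<^bsub>K\<^esub>] = replicate m k \<Longrightarrow> m > 0 \<Longrightarrow> n \<le> m"
  shows "simple_object Fun Y"
proof -
  have "\<not> zero_object Fun Y" using n by (simp add: zero_object_Fun[OF Y] Y1)
  moreover have "zero_object Fun Z \<or> is_iso Fun Z Y f" if Z: "mods Z" and f: "is_mono Fun Z Y f" for Z f
  proof -
    have fn: "f \<in> mnat Z Y" using f by (simp add: is_mono_def)
    have one: "[\<one>\<^bsub>K\<^esub>] \<in> lists (carrier K)" by simp
    let ?m = "length (fobj Z [\<one>\<^bsub>K\<^esub>])" and ?f = "f [\<one>\<^bsub>K\<^esub>]"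
    have f1: "?f \<in> graded_hom (fobj Z [\<one>\<^bsub>K\<^esub>]) (replicate n k)"
      using natural_graded[OF mnat_natural[OF fn] one] by (simp add: Y1)
    note f1c = f1[THEN graded_homD, simplified]
    \<comment> \<open>A summand of another degree would be killed by \<open>f\<close>.\<close>
    have "fobj Z [\<one>\<^bsub>K\<^esub>] ! i = k" if i: "i < ?m" for i
    proof (rule ccontr)
      let ?y = "fobj Z [\<one>\<^bsub>K\<^esub>] ! i" and ?u = "incl ?m i"
      assume "?y \<noteq> k"
      have "?f * ?u = 0\<^sub>m n 1"
        using f1 i \<open>?y \<noteq> k\<close> by (subst mult_incl[OF f1c i]) (auto simp: graded_hom_def intro!: eq_matI)
      moreover have "?y \<in> carrier K" using fun_obj[OF Z one] i by simp
      ultimately have "?u = 0\<^sub>m ?m 1"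
        using mono_Fun_injective[OF Z Y f _ incl_graded[OF i]] by (simp add: Y1)
      from arg_cong[OF this, of "\<lambda>M. M $$ (i, 0)"] show False using i by (simp add: incl_def)
    qed
    then have Z1: "fobj Z [\<one>\<^bsub>K\<^esub>] = replicate ?m k" by (intro nth_equalityI) simp_all
    show ?thesis
    proof (cases "?m = 0")
      case True
      then show ?thesis by (simp add: zero_object_Fun[OF Z])
    next
      case False
      have inj: "u = 0\<^sub>m ?m 1" if "u \<in> carrier_mat ?m 1" "?f * u = 0\<^sub>m n 1" for u
      proof -
        have "u \<in> graded_hom [k] (fobj Z [\<one>\<^bsub>K\<^esub>])" using that(1) by (subst Z1) (auto simp: graded_hom_def)
        then show ?thesis using mono_Fun_injective[OF Z Y f k] that(2) by (simp add: Y1)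
      qed
      have "?m = n"
        using trivial_kernel_dim_le[OF f1c inj] minimal[OF Z Z1] False by (intro antisym) blast+
      have fc: "?f \<in> carrier_mat n n" using f1c by (simp only: \<open>?m = n\<close>)
      obtain B where B: "B \<in> carrier_mat n n" "?f * B = 1\<^sub>m n" "B * ?f = 1\<^sub>m n"
        using trivial_kernel_invertible[OF fc] inj unfolding \<open>?m = n\<close> by metis
      have Z1': "fobj Z [\<one>\<^bsub>K\<^esub>] = replicate n k" by (subst Z1) (simp only: \<open>?m = n\<close>)
      have "iso (fobj Z [x]) (fobj Y [x]) (f [x])" if x: "x \<in> carrier K" for x
      proof -
        let ?g = "(\<one>\<^bsub>A\<^esub>, x)" and ?R = "replicate n (k \<otimes>\<^bsub>K\<^esub> x)"
        note g = right_act_transitive[OF x]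
        have act: "act (replicate n k) [?g] = ?R" by (induction n) (simp_all add: right_act_def)
        \<comment> \<open>Both lists are constant, so every matrix between them is graded.\<close>
        have R: "iso ?R ?R ?f"
          using B fc by (auto simp: is_iso_M_cat graded_hom_def)
        have sZ: "iso (fobj Z [x]) ?R (fstr Z [\<one>\<^bsub>K\<^esub>] [?g])" and sY: "iso (fobj Y [x]) ?R (fstr Y [\<one>\<^bsub>K\<^esub>] [?g])"
          using str_iso_one[OF Z g(1)] str_iso_one[OF Y g(1)] by (simp_all only: Z1' Y1 act snd_conv)
        obtain I where I: "I \<in> graded_hom ?R (fobj Y [x])" "I * fstr Y [\<one>\<^bsub>K\<^esub>] [?g] = 1\<^sub>m (length (fobj Y [x]))"
          using sY by (auto simp: is_iso_M_cat)
        have sYc: "fstr Y [\<one>\<^bsub>K\<^esub>] [?g] \<in> graded_hom (fobj Y [x]) ?R" and sZc: "fstr Z [\<one>\<^bsub>K\<^esub>] [?g] \<in> graded_hom (fobj Z [x]) ?R"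
          using sY sZ by (auto simp: is_iso_M_cat)
        have Iiso: "iso ?R (fobj Y [x]) I" by (rule iso_M_cat_inverse[OF sY I(1)[THEN graded_homD] I(2)])
        have fx: "f [x] \<in> graded_hom (fobj Z [x]) (fobj Y [x])"
          using natural_graded[OF mnat_natural[OF fn], of "[x]"] x by simp
        have "f [x] = (I * fstr Y [\<one>\<^bsub>K\<^esub>] [?g]) * f [x]" using fx[THEN graded_homD] by (simp add: I(2))
        also have "\<dots> = I * (?f * fstr Z [\<one>\<^bsub>K\<^esub>] [?g])"
          using mnat_str[OF fn K.one_closed g(1)] by (simp add: g(2) graded_assoc[OF I(1) sYc fx])
        finally have "f [x] = I * (?f * fstr Z [\<one>\<^bsub>K\<^esub>] [?g])" .
        then show ?thesis using iso_M_cat_comp[OF Iiso iso_M_cat_comp[OF R sZ]] by simp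
      qed
      then show ?thesis using iso_Fun_cat[OF Z Y fn] by blast
    qed
  qed
  ultimately show ?thesis using Y by (simp add: simple_object_def)
qed

text \<open>
  Lengths multiply under composition: \<open>W (Y [\<one>]) \<cong> [\<one>]\<close> gives
  \<open>length (Y [\<one>]) * length (W [\<one>]) = 1\<close>.
\<close>

lemma invertible_functor_length:
  assumes Y: "mods Y" and inv: "invertible_object Fun Y"
  shows "length (fobj Y [\<one>\<^bsub>K\<^esub>]) = 1"
proof -
  obtain W \<nu> where W: "mods W" and \<nu>: "is_iso Fun (fun_comp (M_cat K \<mu>) W Y) (fun_id (M_cat K \<mu>)) \<nu>"
    using inv by (auto simp: invertible_object_def isomorphic_def)
  obtain \<rho> where \<rho>: "\<nu> \<in> mnat (fun_comp (M_cat K \<mu>) W Y) (fun_id (M_cat K \<mu>))"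
    "\<rho> \<in> mnat (fun_id (M_cat K \<mu>)) (fun_comp (M_cat K \<mu>) W Y)"
    "ccomp Fun \<rho> \<nu> = cid Fun (fun_comp (M_cat K \<mu>) W Y)" "ccomp Fun \<nu> \<rho> = cid Fun (fun_id (M_cat K \<mu>))"
    using \<nu> unfolding is_iso_def by auto
  have one: "[\<one>\<^bsub>K\<^esub>] \<in> lists (carrier K)" by simp
  have "iso (fobj W (fobj Y [\<one>\<^bsub>K\<^esub>])) [\<one>\<^bsub>K\<^esub>] (\<nu> [\<one>\<^bsub>K\<^esub>])"
    using natural_graded[OF mnat_natural[OF \<rho>(1)] one] natural_graded[OF mnat_natural[OF \<rho>(2)] one]
      fun_cong[OF \<rho>(3), of "[\<one>\<^bsub>K\<^esub>]"] fun_cong[OF \<rho>(4), of "[\<one>\<^bsub>K\<^esub>]"]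
    by (auto simp: is_iso_M_cat fun_comp_def fun_id_def)
  then have "length (fobj W (fobj Y [\<one>\<^bsub>K\<^esub>])) = 1" using iso_M_cat_length by fastforce
  then show ?thesis using length_fun[OF W fun_obj[OF Y one]] by simp
qed

text \<open>
  For each \<open>k\<close> the regular functor over \<open>k\<close> shows that some functor sends \<open>[\<one>]\<close> to a positive
  multiple of \<open>k\<close>. One of minimal multiplicity is simple, hence invertible, hence of
  multiplicity one, so that its structure maps are scalars \<open>s x g\<close>. The pentagon axiom for
  them says that \<open>s\<close> cobounds the quotient of \<open>\<mu>\<close> and its translate by \<open>k\<close>.
\<close>

lemma pointed_imp_translates_cohomologous:
  assumes pointed: "pointed Fun" and k: "k \<in> carrier K"
  shows "\<exists>s. (\<forall>x\<in>carrier K. \<forall>g\<in>carrier G. s x g \<noteq> (0::complex)) \<and> (\<forall>x\<in>carrier K. s x \<one>\<^bsub>G\<^esub> = 1) \<and>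
      (\<forall>x\<in>carrier K. \<forall>g\<in>carrier G. \<forall>h\<in>carrier G.
         \<mu> (k \<otimes>\<^bsub>K\<^esub> x) [g, h] * s x (g \<otimes>\<^bsub>G\<^esub> h) = s x g * s (right_act K x g) h * \<mu> x [g, h])"
proof -
  let ?P = "\<lambda>n. n > 0 \<and> (\<exists>Y. mods Y \<and> fobj Y [\<one>\<^bsub>K\<^esub>] = replicate n k)"
  have "?P N" using N_pos reg_functor_module[OF k] reg_functor_obj[of k "\<one>\<^bsub>K\<^esub>"] k by auto
  then have least: "?P (LEAST n. ?P n)" by (rule LeastI)
  define n where "n = (LEAST n. ?P n)"
  obtain Y where n: "n > 0" and Y: "mods Y" and Y1: "fobj Y [\<one>\<^bsub>K\<^esub>] = replicate n k"
    using least unfolding n_def by blast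
  have "simple_object Fun Y"
  proof (rule minimal_functor_simple[OF k Y Y1 n])
    fix Z m assume "mods Z" "fobj Z [\<one>\<^bsub>K\<^esub>] = replicate m k" "m > 0"
    then show "n \<le> m" unfolding n_def by (intro Least_le) blast
  qed
  then have "invertible_object Fun Y" using pointed by (simp add: pointed_def)
  then have "n = 1" using invertible_functor_length[OF Y] by (simp add: Y1)
  then have Yx: "fobj Y [x] = [k \<otimes>\<^bsub>K\<^esub> x]" if "x \<in> carrier K" for x
    using fobj_replicate[OF Y that Y1] by simp
  define s where "s x g = fstr Y [x] [g] $$ (0, 0)" for x g
  have str: "fstr Y [x] [g] = s x g \<cdot>\<^sub>m 1\<^sub>m (Suc 0)" if "x \<in> carrier K" "g \<in> carrier G" for x g
    using str_graded[OF Y, of "[x]" "[g]", THEN graded_homD] that Yx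
    by (intro eq_matI) (auto simp: s_def)
  have smult: "(a \<cdot>\<^sub>m 1\<^sub>m (Suc 0)) * (b \<cdot>\<^sub>m 1\<^sub>m (Suc 0)) = (a * b) \<cdot>\<^sub>m (1\<^sub>m (Suc 0) :: complex mat)" for a b
    by (rule eq_matI) (auto simp: scalar_prod_def)
  have "s x g \<noteq> 0" if x: "x \<in> carrier K" and g: "g \<in> carrier G" for x g
  proof
    assume "s x g = 0"
    obtain B where B: "B \<in> carrier_mat 1 1" "B * fstr Y [x] [g] = 1\<^sub>m 1"
      using str_iso[OF Y, of "[x]" "[g]"] x g Yx by (auto simp: is_iso_M_cat dest!: graded_homD)
    have "fstr Y [x] [g] = 0\<^sub>m 1 1" using str[OF x g] \<open>s x g = 0\<close> by auto
    then have "(0\<^sub>m 1 1 :: complex mat) = 1\<^sub>m 1" using B by simp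
    from arg_cong[OF this, of "\<lambda>M. M $$ (0, 0)"] show False by simp
  qed
  moreover have "s x \<one>\<^bsub>G\<^esub> = 1" if "x \<in> carrier K" for x
    using str_unit[OF Y, of "[x]"] that Yx by (simp add: s_def)
  moreover have "\<mu> (k \<otimes>\<^bsub>K\<^esub> x) [g, h] * s x (g \<otimes>\<^bsub>G\<^esub> h) = s x g * s (right_act K x g) h * \<mu> x [g, h]"
    if x: "x \<in> carrier K" and g: "g \<in> carrier G" and h: "h \<in> carrier G" for x g h
  proof -
    let ?k = "k \<otimes>\<^bsub>K\<^esub> x" and ?xg = "right_act K x g" and ?I = "1\<^sub>m (Suc 0) :: complex mat"
    have "(\<mu> ?k [g, h] \<cdot>\<^sub>m ?I) * (s x (g \<otimes>\<^bsub>G\<^esub> h) \<cdot>\<^sub>m ?I)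
      = \<mu> x [g, h] \<cdot>\<^sub>m ((s x g \<cdot>\<^sub>m ?I) * (s ?xg h \<cdot>\<^sub>m ?I))"
      using str_pentagon_single[OF Y x g h]
      by (simp add: Yx[OF x] str[OF x g] str[OF right_act_closed[OF x g] h] str[OF x G_closed[OF g h]] diagonal_single)
    then have "(\<mu> ?k [g, h] * s x (g \<otimes>\<^bsub>G\<^esub> h)) \<cdot>\<^sub>m ?I = \<mu> x [g, h] \<cdot>\<^sub>m ((s x g * s ?xg h) \<cdot>\<^sub>m ?I)"
      by (simp only: smult)
    from arg_cong[OF this, of "\<lambda>M. M $$ (0, 0)"] show ?thesis by (simp add: mult.commute)
  qed
  ultimately show ?thesis by blast
qed

end

section \<open>Low degrees of the double complex\<close>

lemma tuples_0: "gs \<in> tuples G 0 \<longleftrightarrow> gs = []"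
  by (auto simp: tuples_def)

lemma tuples_Suc: "gs \<in> tuples G (Suc n) \<longleftrightarrow> (\<exists>g hs. gs = g # hs \<and> g \<in> carrier G \<and> hs \<in> tuples G n)"
  by (auto simp: tuples_def length_Suc_conv)

lemma length_merge: "1 \<le> i \<Longrightarrow> i < length gs \<Longrightarrow> length (merge G i gs) = length gs - 1"
  by (simp add: merge_def)

lemma delta_G_one: "delta_G K G (\<lambda>_ _. 1) = (\<lambda>_ _. 1)"
  by (simp add: delta_G_def fun_eq_iff)

lemma delta_K_one: "delta_K K (\<lambda>_ _ _. 1) = (\<lambda>_ _ _. 1)"
  by (simp add: delta_K_def translate_def fun_eq_iff)

lemma delta_G_inverse: "delta_G K G (\<lambda>x gs. inverse (f x gs)) x gs = inverse (delta_G K G f x gs)"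
  by (simp add: delta_G_def power_int_inverse prod_inversef[symmetric])

text \<open>
  Cochains take the value \<open>1\<close> off their degree, so differentials only have to be computed on
  lists of one length.
\<close>

lemma delta_G_degree:
  assumes "\<And>x gs. length gs \<noteq> q \<Longrightarrow> f x gs = 1" "length gs \<noteq> Suc q"
  shows "delta_G K G f x gs = 1"
proof (cases "gs = []")
  case False
  then have len: "length gs - 1 \<noteq> q" using assms(2) by (cases gs) auto
  then have "length (tl gs) \<noteq> q" "length (butlast gs) \<noteq> q" by simp_all
  moreover have "length (merge G i gs) \<noteq> q" if "i \<in> {1..<length gs}" for i
    using that len by (simp add: length_merge)
  ultimately show ?thesis by (simp add: delta_G_def assms(1))
qed (simp add: delta_G_def)

lemma delta_K_degree:
  assumes "\<And>ks. length ks \<noteq> p \<Longrightarrow> f ks = (\<lambda>_ _. 1)" "length ks \<noteq> Suc p"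
  shows "delta_K K f ks x gs = 1"
proof (cases "ks = []")
  case False
  then have len: "length ks - 1 \<noteq> p" using assms(2) by (cases ks) auto
  then have "length (tl ks) \<noteq> p" "length (butlast ks) \<noteq> p" by simp_all
  moreover have "length (merge K i ks) \<noteq> p" if "i \<in> {1..<length ks}" for i
    using that len by (simp add: length_merge)
  ultimately show ?thesis by (simp add: delta_K_def translate_def assms(1))
qed (simp add: delta_K_def)

lemma delta_G_1:
  "x \<in> carrier K \<Longrightarrow> g \<in> carrier G \<Longrightarrow> h \<in> carrier G
    \<Longrightarrow> delta_G K G f x [g, h] = f (right_act K x g) [h] * inverse (f x [g \<otimes>\<^bsub>G\<^esub> h]) * f x [g]"
  by (simp add: delta_G_def merge_def atLeastLessThanSuc)

lemma delta_K_0: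
  "k \<in> carrier K \<Longrightarrow> x \<in> carrier K \<Longrightarrow> delta_K K f [k] x gs = f [] x gs * inverse (f [] (k \<otimes>\<^bsub>K\<^esub> x) gs)"
  by (simp add: delta_K_def translate_def)

lemma delta_K_1:
  "k \<in> carrier K \<Longrightarrow> l \<in> carrier K \<Longrightarrow> x \<in> carrier K
    \<Longrightarrow> delta_K K f [k, l] x gs = f [l] x gs * inverse (f [k \<otimes>\<^bsub>K\<^esub> l] x gs) * f [k] (l \<otimes>\<^bsub>K\<^esub> x) gs"
  by (simp add: delta_K_def translate_def merge_def atLeastLessThanSuc)

lemma delta_K_2:
  "k \<in> carrier K \<Longrightarrow> l \<in> carrier K \<Longrightarrow> m \<in> carrier K \<Longrightarrow> x \<in> carrier K
    \<Longrightarrow> delta_K K f [k, l, m] x gs = f [l, m] x gs * inverse (f [k \<otimes>\<^bsub>K\<^esub> l, m] x gs)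
          * f [k, l \<otimes>\<^bsub>K\<^esub> m] x gs * inverse (f [k, l] (m \<otimes>\<^bsub>K\<^esub> x) gs)"
  by (simp add: delta_K_def translate_def merge_def atLeastLessThanSuc mult_ac)

lemma one_map_cochain [simp]: "(\<lambda>_ _. 1) \<in> map_cochains K G q"
  by (simp add: map_cochains_def)

lemma one_bicochain [simp]: "(\<lambda>_ _ _. 1) \<in> bicochains K G p q"
  by (simp add: bicochains_def)

lemma column0_bicochain: "f \<in> map_cochains K G q \<Longrightarrow> column0 f 0 \<in> bicochains K G 0 q"
  by (auto simp: bicochains_def column0_def tuples_0)

lemma column0_Suc [simp]: "p > 0 \<Longrightarrow> column0 f p = (\<lambda>_ _ _. 1)"
  by (auto simp: column0_def)

context extension_data begin

lemma pullback_nonzero: "pullback K \<omega> x gs \<noteq> 0"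
  using \<omega> unfolding cocycles_def cochains_def pullback_def by (cases "gs \<in> tuples G 3") auto

lemma pullback_cochain: "pullback K \<omega> \<in> map_cochains K G 3"
  using \<omega> by (auto simp: pullback_def map_cochains_def cocycles_def cochains_def)

lemma delta_G_pullback: "delta_G K G (pullback K \<omega>) = (\<lambda>_ _. 1)"
proof (intro ext)
  fix x gs
  show "delta_G K G (pullback K \<omega>) x gs = 1"
  proof (cases "x \<in> carrier K \<and> gs \<in> lists (carrier G) \<and> gs \<noteq> []")
    case True
    then have "right_act K x (hd gs) \<in> carrier K" by (cases gs) auto
    then have "delta_G K G (pullback K \<omega>) x gs = coboundary G \<omega> gs"
      using True by (simp add: delta_G_def coboundary_def pullback_def)
    then show ?thesis using \<omega> by (simp add: cocycles_def)
  qed (auto simp: delta_G_def)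
qed

text \<open>
  The pullback is constant in the variable in \<open>K\<close>, hence fixed by translation, so its
  differential in the \<open>K\<close>-direction is trivial as well.
\<close>

lemma pullback_total_cocycle: "column0 (pullback K \<omega>) \<in> total_cocycles K G 3"
proof -
  have "column0 (pullback K \<omega>) p \<in> bicochains K G p (3 - p)" for p
    using column0_bicochain[OF pullback_cochain] by (cases "p = 0") auto
  moreover have "delta_Tot K G (column0 (pullback K \<omega>)) p ks x gs = 1" for p ks x gs
  proof (cases "p = 0")
    case True
    then show ?thesis
      by (cases "ks = []") (simp_all add: delta_Tot_def column0_def delta_G_pullback delta_G_one)
  next
    case False
    have "delta_K K (column0 (pullback K \<omega>) (p - 1)) ks x gs = 1"
    proof (cases "p = 1 \<and> length ks = 1")
      case True
      then obtain k where k: "ks = [k]" by (auto simp: length_Suc_conv)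
      show ?thesis
      proof (cases "k \<in> carrier K \<and> x \<in> carrier K")
        case True
        then show ?thesis using \<open>p = 1 \<and> length ks = 1\<close> pullback_nonzero[of x gs]
          by (simp add: k delta_K_0 column0_def) (simp add: pullback_def)
      qed (auto simp: k delta_K_def)
    next
      case not: False
      show ?thesis
      proof (cases "p = 1")
        case True
        show ?thesis by (rule delta_K_degree[of 0]) (use True not in \<open>auto simp: column0_def\<close>)
      qed (use False in \<open>simp add: delta_K_one\<close>)
    qed
    then show ?thesis using False by (simp add: delta_Tot_def delta_G_one)
  qed
  ultimately show ?thesis by (auto simp: total_cocycles_def total_cochains_def fun_eq_iff)
qed

lemma delta_G_\<mu>: "pullback K \<omega> x gs * delta_G K G \<mu> x gs = 1"
proof -
  have "inverse (delta_G K G \<mu> x gs) = pullback K \<omega> x gs"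
    by (simp only: delta_G_inverse[symmetric] pentagon)
  then show ?thesis using pullback_nonzero[of x gs] by (metis left_inverse inverse_nonzero_iff_nonzero)
qed

text \<open>
  Multiplying by the total differential of \<open>\<mu>\<close> trades the component in bidegree \<open>(0, 3)\<close> for the
  quotient of \<open>\<mu>\<close> and its translates, in bidegree \<open>(1, 2)\<close>. The inverses of the scalars in the
  hypothesis form a cochain \<open>c1\<close> of bidegree \<open>(1, 1)\<close> whose differential removes that component in turn; what
  remains is \<open>delta_K K c1\<close> in bidegree \<open>(2, 1)\<close>.
\<close>

lemma total_cohomologous_if_translates_cohomologous:
  assumes "\<And>k. k \<in> carrier K \<Longrightarrow> \<exists>s.
      (\<forall>x\<in>carrier K. \<forall>g\<in>carrier G. s x g \<noteq> (0::complex)) \<and> (\<forall>x\<in>carrier K. s x \<one>\<^bsub>G\<^esub> = 1) \<and>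
      (\<forall>x\<in>carrier K. \<forall>g\<in>carrier G. \<forall>h\<in>carrier G.
         \<mu> (k \<otimes>\<^bsub>K\<^esub> x) [g, h] * s x (g \<otimes>\<^bsub>G\<^esub> h) = s x g * s (right_act K x g) h * \<mu> x [g, h])"
  shows "\<exists>z \<in> total_cocycles K G 3.
           (\<forall>p. p \<noteq> 2 \<and> p \<noteq> 3 \<longrightarrow> z p = (\<lambda>_ _ _. 1)) \<and>
           total_cohomologous K G 3 (column0 (pullback K \<omega>)) z"
proof -
  obtain s where s: "\<And>k x g. k \<in> carrier K \<Longrightarrow> x \<in> carrier K \<Longrightarrow> g \<in> carrier G \<Longrightarrow> s k x g \<noteq> (0::complex)"
    "\<And>k x. k \<in> carrier K \<Longrightarrow> x \<in> carrier K \<Longrightarrow> s k x \<one>\<^bsub>G\<^esub> = 1"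
    "\<And>k x g h. k \<in> carrier K \<Longrightarrow> x \<in> carrier K \<Longrightarrow> g \<in> carrier G \<Longrightarrow> h \<in> carrier G \<Longrightarrow>
         \<mu> (k \<otimes>\<^bsub>K\<^esub> x) [g, h] * s k x (g \<otimes>\<^bsub>G\<^esub> h) = s k x g * s k (right_act K x g) h * \<mu> x [g, h]"
  proof -
    let ?P = "\<lambda>k s. (\<forall>x\<in>carrier K. \<forall>g\<in>carrier G. s x g \<noteq> (0::complex)) \<and> (\<forall>x\<in>carrier K. s x \<one>\<^bsub>G\<^esub> = 1) \<and>
      (\<forall>x\<in>carrier K. \<forall>g\<in>carrier G. \<forall>h\<in>carrier G.
         \<mu> (k \<otimes>\<^bsub>K\<^esub> x) [g, h] * s x (g \<otimes>\<^bsub>G\<^esub> h) = s x g * s (right_act K x g) h * \<mu> x [g, h])"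
    have "?P k (SOME s. ?P k s)" if "k \<in> carrier K" for k
      using someI_ex[OF assms[OF that]] .
    then show ?thesis by (intro that[of "\<lambda>k. SOME s. ?P k s"]) blast+
  qed
  \<comment> \<open>Normalization in the first variable forces the trivial choice at the unit of \<open>K\<close>.\<close>
  define \<gamma> where "\<gamma> k x g = (if k = \<one>\<^bsub>K\<^esub> then 1 else inverse (s k x g))" for k x g
  have \<gamma>_nonzero: "\<gamma> k x g \<noteq> 0" if "k \<in> carrier K" "x \<in> carrier K" "g \<in> carrier G" for k x g
    using s(1)[OF that] by (simp add: \<gamma>_def)
  have \<gamma>_one: "\<gamma> k x \<one>\<^bsub>G\<^esub> = 1" if "k \<in> carrier K" "x \<in> carrier K" for k x
    using s(2)[OF that] by (simp add: \<gamma>_def)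
  have \<gamma>_one': "\<gamma> \<one>\<^bsub>K\<^esub> x g = 1" for x g by (simp add: \<gamma>_def)
  have \<gamma>: "\<gamma> k (right_act K x g) h * inverse (\<gamma> k x (g \<otimes>\<^bsub>G\<^esub> h)) * \<gamma> k x g
      = \<mu> x [g, h] * inverse (\<mu> (k \<otimes>\<^bsub>K\<^esub> x) [g, h])"
    if "k \<in> carrier K" "x \<in> carrier K" "g \<in> carrier G" "h \<in> carrier G" for k x g h
    using s(3)[OF that] s(1)[of k x g] s(1)[of k "right_act K x g" h] s(1)[of k x "g \<otimes>\<^bsub>G\<^esub> h"] that
      \<mu>_nonzero[of x g h] \<mu>_nonzero[of "k \<otimes>\<^bsub>K\<^esub> x" g h]
    by (auto simp: \<gamma>_def field_simps)
  define c1 :: "('a, 'k) bicochain" where "c1 ks x gs =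
    (if ks \<in> tuples K 1 \<and> x \<in> carrier K \<and> gs \<in> tuples G 1 then \<gamma> (hd ks) x (hd gs) else 1)" for ks x gs
  have c1_eq: "c1 [k] x [g] = \<gamma> k x g" if "k \<in> carrier K" "x \<in> carrier K" "g \<in> carrier G" for k x g
    using that by (simp add: c1_def tuples_def)
  have c1_ks: "c1 ks = (\<lambda>_ _. 1)" if "ks \<notin> tuples K 1" for ks using that by (simp add: c1_def fun_eq_iff)
  have c1_gs: "c1 ks x gs = 1" if "gs \<notin> tuples G 1 \<or> x \<notin> carrier K" for ks x gs
    using that by (auto simp: c1_def)
  have c1_nonzero: "c1 ks x gs \<noteq> 0" for ks x gs
    using \<gamma>_nonzero by (auto simp: c1_def tuples_Suc tuples_0)
  have c1_one: "c1 [\<one>\<^bsub>K\<^esub>] x gs = 1" for x gs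
    by (simp add: c1_def \<gamma>_one')
  have c1_one': "c1 ks x [\<one>\<^bsub>G\<^esub>] = 1" for ks x
    using \<gamma>_one by (auto simp: c1_def tuples_Suc tuples_0)
  define c where "c p = (if p = 0 then column0 \<mu> 0 else if p = 1 then c1 else (\<lambda>_ _ _. 1))" for p :: nat
  define z where "z = (\<lambda>p ks x gs. column0 (pullback K \<omega>) p ks x gs * delta_Tot K G c p ks x gs)"
  have z0: "z 0 = (\<lambda>_ _ _. 1)"
  proof (intro ext)
    fix ks x gs
    show "z 0 ks x gs = 1"
      by (cases "ks = []") (simp_all add: z_def delta_Tot_def c_def column0_def delta_G_\<mu> delta_G_one)
  qed
  have delta_G_c1: "delta_G K G (c1 [k]) x gs = \<mu> x gs * inverse (\<mu> (k \<otimes>\<^bsub>K\<^esub> x) gs)"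
    if "k \<in> carrier K" "x \<in> carrier K" for k x gs
  proof (cases "gs \<in> tuples G 2")
    case True
    then obtain g h where gs: "gs = [g, h]" and gh: "g \<in> carrier G" "h \<in> carrier G"
      by (auto simp: tuples_Suc tuples_0 numeral_2_eq_2)
    then show ?thesis using that gh \<gamma>[OF that gh] by (simp add: delta_G_1 c1_eq)
  next
    case False
    have "delta_G K G (c1 [k]) x gs = 1"
    proof (cases "length gs = 2")
      case True
      then show ?thesis using False by (simp add: delta_G_def tuples_def)
    next
      case len: False
      show ?thesis by (rule delta_G_degree[of 1]) (use len c1_gs in \<open>auto simp: tuples_def\<close>)
    qed
    moreover have "\<mu> y gs = 1" for y using \<mu> False by (auto simp: map_cochains_def)
    ultimately show ?thesis by simp
  qed
  have z1: "z 1 = (\<lambda>_ _ _. 1)"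
  proof (intro ext)
    fix ks x gs
    have *: "z 1 ks x gs = delta_K K (column0 \<mu> 0) ks x gs * inverse (delta_G K G (c1 ks) x gs)"
      by (simp add: z_def delta_Tot_def c_def)
    show "z 1 ks x gs = 1"
    proof (cases "ks \<in> tuples K 1 \<and> x \<in> carrier K")
      case True
      then obtain k where k: "ks = [k]" "k \<in> carrier K" "x \<in> carrier K" by (auto simp: tuples_Suc tuples_0)
      have "\<mu> y gs \<noteq> 0" if "y \<in> carrier K" for y
        using \<mu> that unfolding map_cochains_def by (cases "gs \<in> tuples G 2") auto
      then have "\<mu> x gs \<noteq> 0" "\<mu> (k \<otimes>\<^bsub>K\<^esub> x) gs \<noteq> 0" using k by auto
      then show ?thesis using k unfolding * by (simp add: delta_K_0 delta_G_c1 column0_def field_simps)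
    next
      case False
      have "delta_K K (column0 \<mu> 0) ks x gs = 1"
      proof (cases "length ks = 1")
        case True
        then show ?thesis using False by (auto simp: delta_K_def tuples_def)
      next
        case len: False
        show ?thesis by (rule delta_K_degree[of 0]) (use len in \<open>auto simp: column0_def\<close>)
      qed
      moreover have "delta_G K G (c1 ks) x gs = 1"
        using False c1_ks[of ks] by (cases "x \<in> carrier K") (auto simp: delta_G_one delta_G_def)
      ultimately show ?thesis unfolding * by simp
    qed
  qed
  have z2: "z 2 = delta_K K c1"
    by (simp add: z_def delta_Tot_def c_def delta_G_one fun_eq_iff)
  have z3: "z p = (\<lambda>_ _ _. 1)" if "p \<noteq> 2" for p
  proof -
    have "p = 0 \<or> p = 1 \<or> p > 2" using that by linarith
    moreover have "z p = (\<lambda>_ _ _. 1)" if "p > 2"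
      using that by (simp add: z_def delta_Tot_def c_def delta_G_one delta_K_one fun_eq_iff)
    ultimately show ?thesis using z0 z1 by auto
  qed
  have z2_eq: "z 2 [k, l] x gs = c1 [l] x gs * inverse (c1 [k \<otimes>\<^bsub>K\<^esub> l] x gs) * c1 [k] (l \<otimes>\<^bsub>K\<^esub> x) gs"
    if "k \<in> carrier K" "l \<in> carrier K" "x \<in> carrier K" for k l x gs
    using that by (simp add: z2 delta_K_1)
  have z2_out: "z 2 ks = (\<lambda>_ _. 1)" if "ks \<notin> tuples K 2" for ks
  proof (intro ext)
    fix x gs
    show "z 2 ks x gs = 1"
    proof (cases "length ks = 2")
      case True
      then show ?thesis using that by (auto simp: z2 delta_K_def tuples_def)
    next
      case len: False
      show ?thesis unfolding z2
        by (rule delta_K_degree[of 1]) (use len c1_ks in \<open>auto simp: tuples_def\<close>)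
    qed
  qed
  have z2_x: "z 2 ks x gs = 1" if "x \<notin> carrier K" for ks x gs
    using that by (simp add: z2 delta_K_def)
  have z2_gs: "z 2 ks x gs = 1" if "gs \<notin> tuples G 1" for ks x gs
    using that by (simp add: z2 delta_K_def translate_def c1_gs)
  have z2_nonzero: "z 2 ks x gs \<noteq> 0" for ks x gs
    by (simp add: z2 delta_K_def translate_def c1_nonzero)
  have z2_bicochain: "z 2 \<in> bicochains K G 2 1"
  proof -
    have "z 2 ks \<in> map_cochains K G 1" for ks
    proof -
      have "z 2 ks x [\<one>\<^bsub>G\<^esub>] = 1" for x by (simp add: z2 delta_K_def translate_def c1_one')
      then show ?thesis using z2_nonzero z2_x z2_gs
        by (auto simp: map_cochains_def tuples_Suc tuples_0)
    qed
    moreover have "z 2 ks = (\<lambda>_ _. 1)" if ks: "ks \<in> tuples K 2" "\<one>\<^bsub>K\<^esub> \<in> set ks" for ks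
    proof (intro ext)
      fix x gs
      obtain k l where "ks = [k, l]" "k \<in> carrier K" "l \<in> carrier K"
        using ks(1) by (auto simp: tuples_Suc tuples_0 numeral_2_eq_2)
      then show "z 2 ks x gs = 1"
        using ks(2) z2_x[of x ks gs] c1_nonzero by (cases "x \<in> carrier K") (auto simp: z2_eq c1_one)
    qed
    ultimately show ?thesis using z2_out by (auto simp: bicochains_def)
  qed
  have delta_G_z2: "delta_G K G (z 2 ks) x gs = 1" for ks x gs
  proof (cases "ks \<in> tuples K 2 \<and> x \<in> carrier K \<and> gs \<in> tuples G 2")
    case True
    then obtain k l g h where kl: "ks = [k, l]" "k \<in> carrier K" "l \<in> carrier K" and x: "x \<in> carrier K"
      and gh: "gs = [g, h]" "g \<in> carrier G" "h \<in> carrier G"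
      by (auto simp: tuples_Suc tuples_0 numeral_2_eq_2)
    have "delta_G K G (z 2 ks) x gs = delta_G K G (c1 [l]) x gs * inverse (delta_G K G (c1 [k \<otimes>\<^bsub>K\<^esub> l]) x gs)
        * delta_G K G (c1 [k]) (l \<otimes>\<^bsub>K\<^esub> x) gs"
      using kl x gh by (simp add: delta_G_1 z2_eq right_act_translate)
    also have "\<dots> = 1"
      using kl x gh \<mu>_nonzero[of x g h] \<mu>_nonzero[of "l \<otimes>\<^bsub>K\<^esub> x" g h]
        \<mu>_nonzero[of "k \<otimes>\<^bsub>K\<^esub> (l \<otimes>\<^bsub>K\<^esub> x)" g h]
      by (simp add: delta_G_c1 K.m_assoc field_simps)
    finally show ?thesis .
  next
    case False
    then consider "ks \<notin> tuples K 2" | "x \<notin> carrier K" | "gs \<notin> tuples G 2" "length gs = 2" | "length gs \<noteq> 2"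
      by blast
    then show ?thesis
    proof cases
      case 4
      show ?thesis by (rule delta_G_degree[of 1]) (use 4 z2_gs in \<open>auto simp: tuples_def\<close>)
    qed (auto simp: z2_out delta_G_one delta_G_def tuples_def)
  qed
  have delta_K_z2: "delta_K K (z 2) ks x gs = 1" for ks x gs
  proof (cases "ks \<in> tuples K 3 \<and> x \<in> carrier K")
    case True
    then obtain k l m where klm: "ks = [k, l, m]" "k \<in> carrier K" "l \<in> carrier K" "m \<in> carrier K"
      and x: "x \<in> carrier K"
      by (auto simp: tuples_Suc tuples_0 numeral_3_eq_3)
    then show ?thesis by (simp add: delta_K_2 z2_eq K.m_assoc c1_nonzero field_simps)
  next
    case False
    then consider "x \<notin> carrier K" | "ks \<notin> tuples K 3" "length ks = 3" | "length ks \<noteq> 3"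
      by blast
    then show ?thesis
    proof cases
      case 3
      show ?thesis by (rule delta_K_degree[of 2]) (use 3 z2_out in \<open>auto simp: tuples_def\<close>)
    qed (auto simp: delta_K_def tuples_def)
  qed
  have "delta_Tot K G z p ks x gs = 1" for p ks x gs
  proof -
    have "p = 0 \<or> delta_K K (z (p - 1)) ks x gs = 1"
      using delta_K_z2 by (cases "p - 1 = 2") (simp_all add: z3 delta_K_one)
    moreover have "delta_G K G (z p ks) x gs = 1"
      using delta_G_z2 by (cases "p = 2") (simp_all add: z3 delta_G_one)
    ultimately show ?thesis by (auto simp: delta_Tot_def)
  qed
  moreover have "z p \<in> bicochains K G p (3 - p)" for p
    using z2_bicochain by (cases "p = 2") (simp_all add: z3)
  ultimately have z: "z \<in> total_cocycles K G 3"
    by (auto simp: total_cocycles_def total_cochains_def z3 fun_eq_iff)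
  have c1_bicochain: "c1 \<in> bicochains K G 1 1"
    using c1_nonzero c1_gs c1_one c1_one' c1_ks
    by (auto simp: bicochains_def map_cochains_def tuples_Suc tuples_0 fun_eq_iff)
  have "c \<in> total_cochains K G (3 - 1)"
    using column0_bicochain[OF \<mu>] c1_bicochain by (auto simp: total_cochains_def c_def)
  then have "total_cohomologous K G 3 (column0 (pullback K \<omega>)) z"
    using z pullback_total_cocycle by (auto simp: total_cohomologous_def z_def)
  then show ?thesis using z z3 by blast
qed

end

theorem corollary3p2:
  fixes A :: "('a, 'x) monoid_scheme" and K :: "('k, 'y) monoid_scheme"
    and \<phi> :: "'k \<Rightarrow> 'a \<Rightarrow> 'a" and F :: "'k \<Rightarrow> 'k \<Rightarrow> 'a"
    and G :: "('a \<times> 'k) monoid"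
    and \<omega> :: "('a \<times> 'k) list \<Rightarrow> complex"
    and \<mu> :: "'k \<Rightarrow> ('a \<times> 'k) list \<Rightarrow> complex"
  assumes "comm_group A" and "finite (carrier A)"
    and "group K" and "finite (carrier K)"
    and "\<phi> \<in> hom K (AutoGroup A)"
    and "normalized_2_cocycle K A \<phi> F"
    and "G = twisted_product A K \<phi> F"
    and "\<omega> \<in> cocycles G 3"
    and "\<mu> \<in> map_cochains K G 2"
    and "delta_G K G (\<lambda>x gs. inverse (\<mu> x gs)) = pullback K \<omega>"
    and "pointed (Fun_cat (V_cat G \<omega>) (M_cat K \<mu>))"
  shows "\<exists>z \<in> total_cocycles K G 3.
           (\<forall>p. p \<noteq> 2 \<and> p \<noteq> 3 \<longrightarrow> z p = (\<lambda>_ _ _. 1)) \<and>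
           total_cohomologous K G 3 (column0 (pullback K \<omega>)) z"
proof -
  interpret extension_data A K \<phi> F G \<omega> \<mu>
    by (rule extension_data.intro; fact assms)
  show ?thesis
    by (rule total_cohomologous_if_translates_cohomologous[OF pointed_imp_translates_cohomologous[OF assms(11)]])
qed

end
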